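(* Every Cameron--Walker graph is vertex decomposable; in particular, it is shellable and sequentially Cohen--Macaulay.
   Context: All graphs are finite and simple. A matching of $G$ is a set $M$ of pairwise disjoint edges; $m(G)$ is the maximum size of a matching. A matching $M$ is an induced matching if for distinct $e,e'\in M$ there is no edge $f\in E(G)$ with $f\cap e\neq\emptyset$ and $f\cap e'\neq\emptyset$; $im(G)$ is the maximum size of an induced matching. A star is a complete bipartite graph $K_{1,k}$ with $k\ge 0$ (a single vertex counts as a star). A star triangle is a graph obtained by joining some number ($\geq 1$) of triangles at one common vertex. A Cameron--Walker graph is a finite connected simple graph $G$ with $im(G)=m(G)$ that is neither a star nor a star triangle. A graph $G$ is vertex decomposable, shellable or sequentially Cohen--Macaulay if the clique complex $\Delta(\overline G)$ of the complementary graph (i.e. the simplicial complex of independent sets of $G$) is vertex decomposable, shellable or sequentially Cohen--Macaulay (over a fixed field $K$), respectively. For a simplicial complex $\Delta$ and a vertex $x$, put $\Delta\setminus x=\{\sigma\in\Delta : x\notin\sigma\}$ and $\mathrm{link}_\Delta(x)=\{\sigma\in\Delta : x\notin\sigma,\ \sigma\cup\{x\}\in\Delta\}$. $\Delta$ is vertex decomposable if $\Delta$ is a simplex, or if there is a vertex $x$ such that (i) $\Delta\setminus x$ and $\mathrm{link}_\Delta(x)$ are vertex decomposable and (ii) no face of $\mathrm{link}_\Delta(x)$ is a facet of $\Delta\setminus x$. $\Delta$ is shellable (not necessarily pure) if its facets can be listed as $F_1,\ldots,F_s$ so that $\left(\bigcup_{j=1}^{i-1}\langle F_j\rangle\right)\cap\langle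 F_i\rangle$ is a pure simplicial complex of dimension $\dim F_i-1$ for every $1<i\leq s$, where $\langle F\rangle=\{\sigma : \sigma\subset F\}$. $\Delta$ is sequentially Cohen--Macaulay over $K$ if its Stanley--Reisner ring $K[\Delta]$ is a sequentially Cohen--Macaulay module; equivalently, for every $i$, the pure subcomplex of $\Delta$ generated by all $i$-dimensional faces of $\Delta$ is Cohen--Macaulay over $K$. *)

theory Defs
  imports
    "HOL-Library.Poly_Mapping"
    "HOL-Library.Extended_Nat"
    "HOL-Algebra.QuotRing"
    "HOL-Algebra.Module"
begin

section \<open>Graphs\<close>

definition simple_graph :: "'a set \<Rightarrow> 'a set set \<Rightarrow> bool" where
  "simple_graph V E \<longleftrightarrow> finite V \<and> (\<forall>e\<in>E. e \<subseteq> V \<and> card e = 2)"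

definition connected_graph :: "'a set \<Rightarrow> 'a set set \<Rightarrow> bool" where
  "connected_graph V E \<longleftrightarrow>
     V \<noteq> {} \<and> (\<forall>u\<in>V. \<forall>v\<in>V. (u, v) \<in> {(x, y). {x, y} \<in> E}\<^sup>*)"

definition complement_edges :: "'a set \<Rightarrow> 'a set set \<Rightarrow> 'a set set" where
  "complement_edges V E = {e. e \<subseteq> V \<and> card e = 2 \<and> e \<notin> E}"

definition matching :: "'a set set \<Rightarrow> 'a set set \<Rightarrow> bool" where
  "matching E M \<longleftrightarrow> M \<subseteq> E \<and> (\<forall>e\<in>M. \<forall>e'\<in>M. e \<noteq> e' \<longrightarrow> e \<inter> e' = {})"

definition induced_matching :: "'a set set \<Rightarrow> 'a set set \<Rightarrow> bool" where
  "induced_matching E M \<longleftrightarrow> matching E M \<and>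
     (\<forall>e\<in>M. \<forall>e'\<in>M. e \<noteq> e' \<longrightarrow> \<not> (\<exists>f\<in>E. f \<inter> e \<noteq> {} \<and> f \<inter> e' \<noteq> {}))"

definition matching_number :: "'a set set \<Rightarrow> nat" where
  "matching_number E = Max {card M | M. matching E M}"

definition induced_matching_number :: "'a set set \<Rightarrow> nat" where
  "induced_matching_number E = Max {card M | M. induced_matching E M}"

definition is_star :: "'a set \<Rightarrow> 'a set set \<Rightarrow> bool" where
  "is_star V E \<longleftrightarrow> (\<exists>c\<in>V. E = {{c, v} | v. v \<in> V - {c}})"

text \<open>\<open>c\<close> is the common vertex and \<open>T\<close> is the set of the edges opposite to \<open>c\<close>, one for
  each triangle.\<close>

definition is_star_triangle :: "'a set \<Rightarrow> 'a set set \<Rightarrow> bool" where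
  "is_star_triangle V E \<longleftrightarrow> (\<exists>c T.
     finite T \<and> T \<noteq> {} \<and> (\<forall>e\<in>T. card e = 2 \<and> c \<notin> e) \<and>
     (\<forall>e\<in>T. \<forall>e'\<in>T. e \<noteq> e' \<longrightarrow> e \<inter> e' = {}) \<and>
     V = insert c (\<Union>T) \<and> E = T \<union> {{c, v} | v. v \<in> \<Union>T})"

definition cameron_walker :: "'a set \<Rightarrow> 'a set set \<Rightarrow> bool" where
  "cameron_walker V E \<longleftrightarrow> simple_graph V E \<and> connected_graph V E \<and>
     induced_matching_number E = matching_number E \<and>
     \<not> is_star V E \<and> \<not> is_star_triangle V E"


section \<open>Simplicial complexes\<close>

text \<open>A simplicial complex is given by its set of faces, the empty face included; its vertex
  set is the union of its faces.\<close>

definition clique_complex :: "'a set \<Rightarrow> 'a set set \<Rightarrow> 'a set set" where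
  "clique_complex V E = {\<sigma>. \<sigma> \<subseteq> V \<and> (\<forall>x\<in>\<sigma>. \<forall>y\<in>\<sigma>. x \<noteq> y \<longrightarrow> {x, y} \<in> E)}"

definition is_facet :: "'a set \<Rightarrow> 'a set set \<Rightarrow> bool" where
  "is_facet F \<Delta> \<longleftrightarrow> F \<in> \<Delta> \<and> (\<forall>\<sigma>\<in>\<Delta>. F \<subseteq> \<sigma> \<longrightarrow> \<sigma> = F)"

definition face_dim :: "'a set \<Rightarrow> int" where
  "face_dim \<sigma> = int (card \<sigma>) - 1"

definition pure_of_dim :: "int \<Rightarrow> 'a set set \<Rightarrow> bool" where
  "pure_of_dim d \<Delta> \<longleftrightarrow> \<Delta> \<noteq> {} \<and> (\<forall>F. is_facet F \<Delta> \<longrightarrow> face_dim F = d)"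

definition deletion :: "'a set set \<Rightarrow> 'a \<Rightarrow> 'a set set" where
  "deletion \<Delta> x = {\<sigma>\<in>\<Delta>. x \<notin> \<sigma>}"

definition link :: "'a set set \<Rightarrow> 'a \<Rightarrow> 'a set set" where
  "link \<Delta> x = {\<sigma>\<in>\<Delta>. x \<notin> \<sigma> \<and> insert x \<sigma> \<in> \<Delta>}"

text \<open>The simplices include \<open>{{}}\<close>, the simplex on the empty vertex set.\<close>

inductive vertex_decomposable :: "'a set set \<Rightarrow> bool" where
  simplex: "finite F \<Longrightarrow> vertex_decomposable (Pow F)"
| shedding: "\<lbrakk>{x} \<in> \<Delta>; vertex_decomposable (deletion \<Delta> x); vertex_decomposable (link \<Delta> x);
     \<forall>\<sigma>\<in>link \<Delta> x. \<not> is_facet \<sigma> (deletion \<Delta> x)\<rbrakk> \<Longrightarrow> vertex_decomposable \<Delta>"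

definition shellable :: "'a set set \<Rightarrow> bool" where
  "shellable \<Delta> \<longleftrightarrow> (\<exists>Fs. distinct Fs \<and> set Fs = {F. is_facet F \<Delta>} \<and>
     (\<forall>i. 0 < i \<and> i < length Fs \<longrightarrow>
        pure_of_dim (face_dim (Fs ! i) - 1) ((\<Union>j<i. Pow (Fs ! j)) \<inter> Pow (Fs ! i))))"


section \<open>Sequentially Cohen-Macaulay modules\<close>

text \<open>\<open>R\<close> is a commutative graded ring, with homogeneous components \<open>A d\<close>, and \<open>M\<close> is an
  \<open>R\<close>-module. The fields \<open>mult\<close> and \<open>one\<close> of the record \<open>M\<close> play no role.\<close>

definition quot_module :: "('r, 'm) module \<Rightarrow> 'm set \<Rightarrow> ('r, 'm set) module" where
  "quot_module M N =
     \<lparr>carrier = a_rcosets\<^bsub>M\<^esub> N, mult = rcoset_mult M N, one = N +>\<^bsub>M\<^esub> \<one>\<^bsub>M\<^esub>,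
      zero = N, add = set_add M, smult = (\<lambda>r X. \<Union>x\<in>X. N +>\<^bsub>M\<^esub> (r \<odot>\<^bsub>M\<^esub> x))\<rparr>"

definition annihilator :: "'r ring \<Rightarrow> ('r, 'm) module \<Rightarrow> 'r set" where
  "annihilator R M = {r \<in> carrier R. \<forall>x\<in>carrier M. r \<odot>\<^bsub>M\<^esub> x = \<zero>\<^bsub>M\<^esub>}"

text \<open>The Krull dimension of \<open>R\<close> modulo the annihilator of \<open>M\<close>, by chains of prime ideals of
  \<open>R\<close> that contain the annihilator. It is \<open>0\<close> for the zero module.\<close>

definition module_dim :: "'r ring \<Rightarrow> ('r, 'm) module \<Rightarrow> enat" where
  "module_dim R M = Sup {enat n | n. \<exists>P :: nat \<Rightarrow> 'r set.
     (\<forall>i\<le>n. primeideal (P i) R \<and> annihilator R M \<subseteq> P i) \<and> (\<forall>i<n. P i \<subset> P (Suc i))}"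

text \<open>The submodule \<open>(\<theta>\<^sub>1, \<dots>, \<theta>\<^sub>r) M\<close>.\<close>

definition seq_submodule :: "('r, 'm) module \<Rightarrow> 'r list \<Rightarrow> 'm set" where
  "seq_submodule M \<theta>s = {\<Oplus>\<^bsub>M\<^esub>j\<in>{..<length \<theta>s}. (\<theta>s ! j) \<odot>\<^bsub>M\<^esub> y j | y.
     y \<in> {..<length \<theta>s} \<rightarrow> carrier M}"

definition regular_sequence :: "('r, 'm) module \<Rightarrow> 'r list \<Rightarrow> bool" where
  "regular_sequence M \<theta>s \<longleftrightarrow>
     (\<forall>i<length \<theta>s. \<forall>x\<in>carrier M.
        (\<theta>s ! i) \<odot>\<^bsub>M\<^esub> x \<in> seq_submodule M (take i \<theta>s) \<longrightarrow> x \<in> seq_submodule M (take i \<theta>s)) \<and>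
     seq_submodule M \<theta>s \<noteq> carrier M"

text \<open>The depth of a graded module is the maximal length of a regular sequence of homogeneous
  elements of positive degree.\<close>

definition module_depth :: "(nat \<Rightarrow> 'r set) \<Rightarrow> ('r, 'm) module \<Rightarrow> enat" where
  "module_depth A M = Sup {enat (length \<theta>s) | \<theta>s.
     (\<forall>\<theta>\<in>set \<theta>s. \<exists>d>0. \<theta> \<in> A d) \<and> regular_sequence M \<theta>s}"

definition cohen_macaulay :: "'r ring \<Rightarrow> (nat \<Rightarrow> 'r set) \<Rightarrow> ('r, 'm) module \<Rightarrow> bool" where
  "cohen_macaulay R A M \<longleftrightarrow> module_depth A M = module_dim R M"

definition graded_submodule ::
    "'r ring \<Rightarrow> ('r, 'm) module \<Rightarrow> (nat \<Rightarrow> 'm set) \<Rightarrow> 'm set \<Rightarrow> bool" where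
  "graded_submodule R M G N \<longleftrightarrow> submodule N R M \<and>
     (\<forall>x\<in>N. \<exists>n f. (\<forall>d\<le>n. f d \<in> N \<inter> G d) \<and> x = (\<Oplus>\<^bsub>M\<^esub>d\<in>{..n}. f d))"

text \<open>There is a filtration \<open>0 = N\<^sub>0 \<subset> \<dots> \<subset> N\<^sub>r = M\<close> by graded submodules whose quotients are
  Cohen-Macaulay of increasing dimension. \<open>G d\<close> are the homogeneous components of \<open>M\<close>.\<close>

definition sequentially_CM_module ::
    "'r ring \<Rightarrow> (nat \<Rightarrow> 'r set) \<Rightarrow> ('r, 'm) module \<Rightarrow> (nat \<Rightarrow> 'm set) \<Rightarrow> bool" where
  "sequentially_CM_module R A M G \<longleftrightarrow> (\<exists>(r::nat) N.
     N 0 = {\<zero>\<^bsub>M\<^esub>} \<and> N r = carrier M \<and>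
     (\<forall>i\<le>r. graded_submodule R M G (N i)) \<and>
     (\<forall>i<r. N i \<subset> N (Suc i) \<and>
        cohen_macaulay R A (quot_module (M\<lparr>carrier := N (Suc i)\<rparr>) (N i))) \<and>
     (\<forall>i. Suc i < r \<longrightarrow>
        module_dim R (quot_module (M\<lparr>carrier := N (Suc i)\<rparr>) (N i)) <
        module_dim R (quot_module (M\<lparr>carrier := N (Suc (Suc i))\<rparr>) (N (Suc i)))))"


section \<open>Stanley-Reisner rings\<close>

text \<open>Monomials are finitely supported exponent vectors \<open>'a \<Rightarrow>\<^sub>0 nat\<close>, and polynomials are
  finitely supported families of coefficients indexed by monomials. Only the variables in \<open>V\<close>
  may occur in the elements of \<open>poly_ring V\<close>.\<close>

definition poly_ring :: "'a set \<Rightarrow> (('a \<Rightarrow>\<^sub>0 nat) \<Rightarrow>\<^sub>0 'k::field) ring" where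
  "poly_ring V = \<lparr>carrier = {p. \<forall>m\<in>Poly_Mapping.keys p. Poly_Mapping.keys m \<subseteq> V},
     mult = (*), one = 1, zero = 0, add = (+)\<rparr>"

definition monomial_degree :: "('a \<Rightarrow>\<^sub>0 nat) \<Rightarrow> nat" where
  "monomial_degree m = (\<Sum>v\<in>Poly_Mapping.keys m. Poly_Mapping.lookup m v)"

definition homogeneous_polys :: "'a set \<Rightarrow> nat \<Rightarrow> (('a \<Rightarrow>\<^sub>0 nat) \<Rightarrow>\<^sub>0 'k::field) set" where
  "homogeneous_polys V d =
     {p \<in> carrier (poly_ring V). \<forall>m\<in>Poly_Mapping.keys p. monomial_degree m = d}"

definition variable :: "'a \<Rightarrow> (('a \<Rightarrow>\<^sub>0 nat) \<Rightarrow>\<^sub>0 'k::field)" where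
  "variable v = Poly_Mapping.single (Poly_Mapping.single v 1) 1"

definition stanley_reisner_ideal :: "'a set set \<Rightarrow> (('a \<Rightarrow>\<^sub>0 nat) \<Rightarrow>\<^sub>0 'k::field) set" where
  "stanley_reisner_ideal \<Delta> = genideal (poly_ring (\<Union>\<Delta>))
     {\<Prod>v\<in>\<sigma>. variable v | \<sigma>. finite \<sigma> \<and> \<sigma> \<subseteq> \<Union>\<Delta> \<and> \<sigma> \<notin> \<Delta>}"

definition regular_module :: "'r ring \<Rightarrow> ('r, 'r) module" where
  "regular_module R = \<lparr>carrier = carrier R, mult = mult R, one = one R,
     zero = zero R, add = add R, smult = mult R\<rparr>"

text \<open>The Stanley-Reisner ring, as a module over the polynomial ring.\<close>

definition stanley_reisner_module ::
    "'a set set \<Rightarrow> (('a \<Rightarrow>\<^sub>0 nat) \<Rightarrow>\<^sub>0 'k::field, (('a \<Rightarrow>\<^sub>0 nat) \<Rightarrow>\<^sub>0 'k) set) module" where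
  "stanley_reisner_module \<Delta> =
     quot_module (regular_module (poly_ring (\<Union>\<Delta>))) (stanley_reisner_ideal \<Delta>)"

definition stanley_reisner_component ::
    "'a set set \<Rightarrow> nat \<Rightarrow> (('a \<Rightarrow>\<^sub>0 nat) \<Rightarrow>\<^sub>0 'k::field) set set" where
  "stanley_reisner_component \<Delta> d =
     (\<lambda>p. stanley_reisner_ideal \<Delta> +>\<^bsub>poly_ring (\<Union>\<Delta>)\<^esub> p) ` homogeneous_polys (\<Union>\<Delta>) d"

definition sequentially_CM_complex :: "'k::field itself \<Rightarrow> 'a set set \<Rightarrow> bool" where
  "sequentially_CM_complex K \<Delta> \<longleftrightarrow>
     sequentially_CM_module (poly_ring (\<Union>\<Delta>) :: (('a \<Rightarrow>\<^sub>0 nat) \<Rightarrow>\<^sub>0 'k) ring)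
       (homogeneous_polys (\<Union>\<Delta>)) (stanley_reisner_module \<Delta>) (stanley_reisner_component \<Delta>)"


section \<open>Properties of graphs\<close>

definition vertex_decomposable_graph :: "'a set \<Rightarrow> 'a set set \<Rightarrow> bool" where
  "vertex_decomposable_graph V E \<longleftrightarrow>
     vertex_decomposable (clique_complex V (complement_edges V E))"

definition shellable_graph :: "'a set \<Rightarrow> 'a set set \<Rightarrow> bool" where
  "shellable_graph V E \<longleftrightarrow> shellable (clique_complex V (complement_edges V E))"

definition sequentially_CM_graph :: "'k::field itself \<Rightarrow> 'a set \<Rightarrow> 'a set set \<Rightarrow> bool" where
  "sequentially_CM_graph K V E \<longleftrightarrow>
     sequentially_CM_complex K (clique_complex V (complement_edges V E))"

end

theory Submission
  imports Defs
begin

text \<open>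
  A graph whose induced matching number equals its matching number has an induced matching \<open>M\<close> that is
  a maximum matching. If \<open>M\<close> is nonempty, there is a shedding vertex \<open>x\<close>, namely the neighbour of a
  leaf or the apex of a triangle over an edge of \<open>M\<close>, such that removing \<open>x\<close>, or removing its closed
  neighbourhood, leaves a graph of the same kind (\<open>maximum_induced_matching_shedding\<close>). By induction the
  independence complex is vertex decomposable.

  The facets of a vertex decomposable complex can be attached one by one in order of decreasing size, so
  that the new faces below a facet \<open>F\<close> are those that contain a certain \<open>R \<subseteq> F\<close>
  (\<open>vertex_decomposable_attach\<close>). This order is a shelling.

  It also gives the filtration of the Stanley-Reisner ring that is required for sequential
  Cohen-Macaulayness. Let \<open>J\<^sub>i\<close> be the ideal spanned by the monomials whose support does not lie in a
  face of size at least \<open>i\<close>. The quotient \<open>J\<^sub>i\<^sub>+\<^sub>1 / J\<^sub>i\<close> has a filtration with one factor for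
  each facet \<open>F\<close> of size \<open>i\<close>, a copy of the polynomial ring in the variables of \<open>F\<close>. The elementary
  symmetric polynomials of degrees \<open>1, \<dots>, i\<close> in all variables form a regular sequence on each factor
  (\<open>esym_weakly_regular_simplex\<close>), so on the quotient (\<open>attach_weakly_regular\<close>), whose depth is
  therefore at least \<open>i\<close>. Its dimension is at most \<open>i\<close>, since a prime over its annihilator contains all
  variables outside some set of \<open>i\<close> vertices, and a polynomial ring in \<open>i\<close> variables has no chain of
  more than \<open>i + 1\<close> primes (\<open>prime_chain_length_le\<close>). Finally depth is at most dimension, because a
  regular sequence yields a chain of primes (\<open>prime_chain_from_regular_sequence\<close>).
\<close>

section \<open>Graphs with an induced maximum matching\<close>

text \<open>Edges outside \<open>V\<close> are admitted in \<open>E\<close>, so that deletions and links of the complex belong to the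
  same \<open>E\<close> and a smaller \<open>V\<close>.\<close>

definition indep_complex :: "'a set \<Rightarrow> 'a set set \<Rightarrow> 'a set set" where
  "indep_complex V E = {\<sigma>. \<sigma> \<subseteq> V \<and> (\<forall>x\<in>\<sigma>. \<forall>y\<in>\<sigma>. {x, y} \<notin> E)}"

lemma clique_complex_complement:
  assumes "simple_graph V E"
  shows "clique_complex V (complement_edges V E) = indep_complex V E"
proof -
  have "{x, x} \<notin> E" for x
    using assms by (auto simp: simple_graph_def)
  then have "(x \<noteq> y \<longrightarrow> {x, y} \<in> complement_edges V E) \<longleftrightarrow> {x, y} \<notin> E"
    if "x \<in> V" "y \<in> V" for x y
    using that by (cases "x = y") (auto simp: complement_edges_def)
  then show ?thesis
    unfolding clique_complex_def indep_complex_def by blast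
qed

lemma simple_graph_finite_edges:
  assumes "simple_graph V E"
  shows "finite E"
proof -
  have "E \<subseteq> Pow V" "finite V" using assms by (auto simp: simple_graph_def)
  then show "finite E" by (meson finite_Pow_iff finite_subset)
qed

text \<open>Only the edges inside \<open>V\<close> count, so that \<open>E\<close> can stay fixed while \<open>V\<close> shrinks.\<close>

definition maximum_induced_matching :: "'a set \<Rightarrow> 'a set set \<Rightarrow> 'a set set \<Rightarrow> bool" where
  "maximum_induced_matching V E M \<longleftrightarrow> induced_matching {e\<in>E. e \<subseteq> V} M \<and>
     (\<forall>N. matching {e\<in>E. e \<subseteq> V} N \<longrightarrow> card N \<le> card M)"

lemma exists_maximum_induced_matching:
  assumes "simple_graph V E" "induced_matching_number E = matching_number E"
  obtains M where "maximum_induced_matching V E M"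
proof -
  have E: "{e\<in>E. e \<subseteq> V} = E" using assms(1) by (auto simp: simple_graph_def)
  have fin: "finite {card M | M. matching E M}"
    by (rule finite_subset[of _ "card ` Pow E"])
      (auto simp: matching_def simple_graph_finite_edges[OF assms(1)])
  have "finite {card M | M. induced_matching E M}"
    by (rule finite_subset[OF _ fin]) (auto simp: induced_matching_def)
  moreover have "induced_matching E {}"
    by (simp add: induced_matching_def matching_def)
  ultimately have "Max {card M | M. induced_matching E M} \<in> {card M | M. induced_matching E M}"
    by (intro Max_in) auto
  then obtain M where M: "induced_matching E M" "card M = induced_matching_number E"
    by (auto simp: induced_matching_number_def)
  have "card N \<le> card M" if "matching E N" for N
    unfolding M(2) assms(2) matching_number_def by (rule Max_ge[OF fin]) (use that in auto)
  then show ?thesis using M that[of M] by (auto simp: maximum_induced_matching_def E)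
qed

lemma matching_insert:
  assumes "matching E N" "e \<in> E" "\<And>f. f \<in> N \<Longrightarrow> f \<inter> e = {}"
  shows "matching E (insert e N)"
  using assms by (auto simp: matching_def)

text \<open>An uncovered vertex next to one end of an edge of \<open>M\<close>, and another one next to the other end,
  would give an augmenting path of length three.\<close>

lemma unique_outer_neighbour:
  assumes G: "simple_graph V E" and M: "maximum_induced_matching V E M"
    and e: "{a, b} \<in> M" "a \<noteq> b" and u: "{b, u} \<in> E" "u \<noteq> a" and u': "{a, u'} \<in> E" "u' \<noteq> b"
  shows "u = u'" "u \<notin> \<Union>M"
proof -
  have E: "{e\<in>E. e \<subseteq> V} = E" "finite V" and two: "\<And>e. e \<in> E \<Longrightarrow> card e = 2"
    using G by (auto simp: simple_graph_def)
  have im: "induced_matching E M" and mx: "\<And>N. matching E N \<Longrightarrow> card N \<le> card M"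
    using M by (simp_all add: maximum_induced_matching_def E)
  have ME: "M \<subseteq> E" and mat: "\<And>e e'. e \<in> M \<Longrightarrow> e' \<in> M \<Longrightarrow> e \<noteq> e' \<Longrightarrow> e \<inter> e' = {}"
    using im by (simp_all add: induced_matching_def matching_def)
  have ind: "f \<inter> e' = {}" if "e \<in> M" "e' \<in> M" "e \<noteq> e'" "f \<in> E" "f \<inter> e \<noteq> {}" for e e' f
    using im that unfolding induced_matching_def by blast
  have "M \<subseteq> Pow V" using ME G by (auto simp: simple_graph_def)
  then have "finite M" using E(2) by (simp add: finite_subset)
  have neq: "u \<noteq> b" "u' \<noteq> a" using two[OF u(1)] two[OF u'(1)] by auto
  have out: "u \<notin> f" "u' \<notin> f" if "f \<in> M" for f
    using ind[OF e(1) that, of "{b,u}"] ind[OF e(1) that, of "{a,u'}"] u u' neq by auto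
  then show "u \<notin> \<Union>M" by blast
  show "u = u'"
  proof (rule ccontr)
    assume "u \<noteq> u'"
    let ?N = "insert {a,u'} (insert {b,u} (M - {{a,b}}))"
    have dj: "f \<inter> {a, b} = {}" if "f \<in> M - {{a,b}}" for f using mat e that by blast
    have d2: "f \<inter> {a,u'} = {}" "f \<inter> {b,u} = {}" if "f \<in> M - {{a,b}}" for f
      using dj[OF that] out that by blast+
    have d3: "{a,u'} \<inter> {b,u} = {}" using \<open>u \<noteq> u'\<close> e u u' neq by auto
    have "matching E (M - {{a,b}})"
      using ME mat by (simp add: matching_def) blast
    then have "matching E (insert {b,u} (M - {{a,b}}))"
      using u(1) d2(2) by (intro matching_insert) simp_all
    then have "matching E ?N"
    proof (rule matching_insert[OF _ u'(1)])
      fix f assume "f \<in> insert {b,u} (M - {{a,b}})"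
      then show "f \<inter> {a,u'} = {}"
        using d3 d2(1) by (elim insertE) (simp_all only: Int_commute)
    qed
    then have "card ?N \<le> card M" by (rule mx)
    moreover have "{b,u} \<notin> M - {{a,b}}" "{a,u'} \<notin> insert {b,u} (M - {{a,b}})"
      using out d3 by blast+
    then have "card ?N = Suc (Suc (card (M - {{a,b}})))"
      using \<open>finite M\<close> by simp
    moreover have "card M = Suc (card (M - {{a,b}}))"
      using \<open>finite M\<close> e(1) by (rule card.remove)
    ultimately show False by simp
  qed
qed

text \<open>Every matching inside \<open>V'\<close> can be enlarged by the edges of \<open>M - M'\<close>, so the maximality of \<open>M\<close>
  in \<open>V\<close> is inherited by \<open>M'\<close> in \<open>V'\<close>.\<close>

lemma maximum_induced_matching_restrict:
  assumes G: "simple_graph V E" and M: "maximum_induced_matching V E M"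
    and V': "V' \<subseteq> V" and M': "M' \<subseteq> M" "\<And>e. e \<in> M' \<Longrightarrow> e \<subseteq> V'"
    and apart: "\<And>e f. e \<in> M - M' \<Longrightarrow> f \<in> E \<Longrightarrow> f \<subseteq> V' \<Longrightarrow> f \<inter> e = {}"
  shows "maximum_induced_matching V' E M'"
proof -
  have E: "{e\<in>E. e \<subseteq> V} = E" using G by (auto simp: simple_graph_def)
  have im: "induced_matching E M" and mx: "\<And>N. matching E N \<Longrightarrow> card N \<le> card M"
    using M by (simp_all add: maximum_induced_matching_def E)
  have ME: "M \<subseteq> E" and mat: "\<And>e e'. e \<in> M \<Longrightarrow> e' \<in> M \<Longrightarrow> e \<noteq> e' \<Longrightarrow> e \<inter> e' = {}"
    using im by (simp_all add: induced_matching_def matching_def)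
  have finM: "finite M" using ME simple_graph_finite_edges[OF G] by (rule finite_subset)
  have nonempty: "e \<noteq> {}" if "e \<in> E" for e
    using G that by (force simp: simple_graph_def)
  have "e \<inter> e' = {}" if "e \<in> M'" "e' \<in> M'" "e \<noteq> e'" for e e'
    using mat M'(1) that by (meson subsetD)
  then have "matching {e\<in>E. e \<subseteq> V'} M'"
    using ME M' by (simp add: matching_def subset_eq)
  moreover have "\<not> (\<exists>f\<in>{e\<in>E. e \<subseteq> V'}. f \<inter> e \<noteq> {} \<and> f \<inter> e' \<noteq> {})"
    if "e \<in> M'" "e' \<in> M'" "e \<noteq> e'" for e e'
  proof -
    have "e \<in> M" "e' \<in> M" using that M'(1) by auto
    then show ?thesis using im \<open>e \<noteq> e'\<close> unfolding induced_matching_def by auto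
  qed
  ultimately have "induced_matching {e\<in>E. e \<subseteq> V'} M'"
    unfolding induced_matching_def by blast
  moreover have "card N \<le> card M'" if N: "matching {e\<in>E. e \<subseteq> V'} N" for N
  proof -
    have NE: "N \<subseteq> E" and NV: "\<And>f. f \<in> N \<Longrightarrow> f \<subseteq> V'"
      and Nmat: "\<And>e e'. e \<in> N \<Longrightarrow> e' \<in> N \<Longrightarrow> e \<noteq> e' \<Longrightarrow> e \<inter> e' = {}"
      using N by (auto simp: matching_def)
    have cross: "f \<inter> e = {}" if "f \<in> N" "e \<in> M - M'" for e f
      using apart[OF that(2)] that(1) NE NV by blast
    have "matching E (N \<union> (M - M'))"
      unfolding matching_def
    proof (intro conjI ballI impI)
      show "N \<union> (M - M') \<subseteq> E" using NE ME by auto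
      fix e f assume "e \<in> N \<union> (M - M')" "f \<in> N \<union> (M - M')" "e \<noteq> f"
      then show "e \<inter> f = {}"
        using Nmat mat cross cross[of f e, unfolded Int_commute[of f e]] by (elim UnE) simp_all
    qed
    then have "card (N \<union> (M - M')) \<le> card M" by (rule mx)
    moreover have "N \<inter> (M - M') = {}"
    proof (rule ccontr)
      assume "N \<inter> (M - M') \<noteq> {}"
      then obtain e where "e \<in> N" "e \<in> M - M'" by auto
      then have "e = {}" using cross[of e e] by simp
      then show False using nonempty \<open>e \<in> N\<close> NE by auto
    qed
    moreover have "finite N" using NE simple_graph_finite_edges[OF G] by (rule finite_subset)
    ultimately have "card N + card (M - M') \<le> card M"
      using finM by (simp add: card_Un_disjoint)
    then show ?thesis using M'(1) finM
      by (metis add_le_cancel_left add.commute card_Diff_subset card_mono finite_subset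
          le_add_diff_inverse)
  qed
  ultimately show ?thesis by (simp add: maximum_induced_matching_def)
qed

text \<open>If some edge of \<open>M\<close> ends in a leaf, the other end of it is shed. Otherwise both ends of each
  edge of \<open>M\<close> have uncovered neighbours, which then are one and the same vertex, and the apex of such
  a triangle is shed: its closed neighbourhood covers each edge of \<open>M\<close> completely or not at all.\<close>

lemma maximum_induced_matching_shedding:
  assumes G: "simple_graph V E" and M: "maximum_induced_matching V E M" and "M \<noteq> {}"
  obtains x w M1 M2 where "{x, w} \<in> E" "\<And>y. {w, y} \<in> E \<Longrightarrow> y = x \<or> {x, y} \<in> E"
    "maximum_induced_matching (V - {x}) E M1"
    "maximum_induced_matching (V - insert x {y. {x, y} \<in> E}) E M2"
proof -
  have E: "{e\<in>E. e \<subseteq> V} = E" and two: "\<And>e. e \<in> E \<Longrightarrow> card e = 2" and EV: "\<And>e. e \<in> E \<Longrightarrow> e \<subseteq> V"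
    using G by (auto simp: simple_graph_def)
  have im: "induced_matching E M"
    using M by (simp add: maximum_induced_matching_def E)
  have ME: "M \<subseteq> E" and mat: "\<And>e e'. e \<in> M \<Longrightarrow> e' \<in> M \<Longrightarrow> e \<noteq> e' \<Longrightarrow> e \<inter> e' = {}"
    using im by (simp_all add: induced_matching_def matching_def)
  have ind: "f \<inter> e' = {}" if "e \<in> M" "e' \<in> M" "e \<noteq> e'" "f \<in> E" "f \<inter> e \<noteq> {}" for e e' f
    using im that unfolding induced_matching_def by blast
  show ?thesis
  proof (cases "\<exists>a b. {a, b} \<in> M \<and> (\<forall>y. {b, y} \<in> E \<longrightarrow> y = a)")
    case True
    then obtain a b where ab: "{a, b} \<in> M" and leaf: "\<And>y. {b, y} \<in> E \<Longrightarrow> y = a" by blast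
    have abE: "{a, b} \<in> E" using ab ME by auto
    have away: "a \<notin> e" "b \<notin> e" if "e \<in> M - {{a, b}}" for e
      using mat[OF ab, of e] that by auto
    have b_only: "f = {a, b}" if "f \<in> E" "b \<in> f" for f
    proof -
      obtain p q where "f = {p, q}" using two[OF \<open>f \<in> E\<close>] by (auto simp: card_2_iff)
      then show ?thesis using leaf[of p] leaf[of q] that by (auto simp: insert_commute)
    qed
    show ?thesis
    proof (rule that[of a b "M - {{a, b}}" "M - {{a, b}}"])
      show "maximum_induced_matching (V - {a}) E (M - {{a, b}})"
      proof (rule maximum_induced_matching_restrict[OF G M])
        show "e \<subseteq> V - {a}" if "e \<in> M - {{a, b}}" for e
          using away[OF that] EV ME that by auto
        show "f \<inter> e = {}" if "e \<in> M - (M - {{a, b}})" "f \<in> E" "f \<subseteq> V - {a}" for e f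
          using b_only[OF that(2)] that by auto
      qed auto
      show "maximum_induced_matching (V - insert a {y. {a, y} \<in> E}) E (M - {{a, b}})"
      proof (rule maximum_induced_matching_restrict[OF G M])
        show "e \<subseteq> V - insert a {y. {a, y} \<in> E}" if e: "e \<in> M - {{a, b}}" for e
        proof -
          have "y \<notin> e" if "{a, y} \<in> E" for y
            using ind[OF ab _ _ that, of e] e by auto
          then show ?thesis using away[OF e] EV ME e by auto
        qed
        show "f \<inter> e = {}"
          if "e \<in> M - (M - {{a, b}})" "f \<in> E" "f \<subseteq> V - insert a {y. {a, y} \<in> E}" for e f
          using b_only[OF that(2)] that abE by auto
      qed auto
    qed (use abE leaf in auto)
  next
    case False
    have triangle: "\<exists>u. u \<notin> \<Union>M \<and> {a, u} \<in> E \<and> {b, u} \<in> E \<and>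
        (\<forall>y. {a, y} \<in> E \<longrightarrow> y = b \<or> y = u) \<and> (\<forall>y. {b, y} \<in> E \<longrightarrow> y = a \<or> y = u)"
      if ab: "{a, b} \<in> M" for a b
    proof -
      have "a \<noteq> b" using two ab ME by force
      have ba: "{b, a} \<in> M" using ab by (simp add: insert_commute)
      obtain u where u: "{b, u} \<in> E" "u \<noteq> a" using False ab by blast
      obtain u' where u': "{a, u'} \<in> E" "u' \<noteq> b" using False ba by blast
      note eq = unique_outer_neighbour[OF G M ab \<open>a \<noteq> b\<close>]
      have "u = u'" "u \<notin> \<Union>M" using eq[OF u u'] by auto
      moreover have "y = u" if "{a, y} \<in> E" "y \<noteq> b" for y using eq(1)[OF u that] by simp
      moreover have "y = u" if "{b, y} \<in> E" "y \<noteq> a" for y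
        using eq(1)[OF that u'] \<open>u = u'\<close> by simp
      ultimately show ?thesis using u u' by blast
    qed
    obtain e where "e \<in> M" using \<open>M \<noteq> {}\<close> by auto
    moreover then obtain a b where "e = {a, b}" using two[of e] ME by (auto simp: card_2_iff)
    ultimately have ab: "{a, b} \<in> M" by simp
    from triangle[OF this] obtain u where u: "u \<notin> \<Union>M" "{a, u} \<in> E" "{b, u} \<in> E"
      "\<And>y. {b, y} \<in> E \<Longrightarrow> y = a \<or> y = u" by blast
    let ?C = "insert u {y. {u, y} \<in> E}"
    have whole: "e \<subseteq> ?C" if e: "e \<in> M" "e \<inter> ?C \<noteq> {}" for e
    proof -
      obtain p q where pq: "e = {p, q}" using two[of e] ME e by (auto simp: card_2_iff)
      from triangle[OF e(1)[unfolded pq]] obtain v where v: "v \<notin> \<Union>M" "{p, v} \<in> E" "{q, v} \<in> E"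
        "\<And>y. {p, y} \<in> E \<Longrightarrow> y = q \<or> y = v" "\<And>y. {q, y} \<in> E \<Longrightarrow> y = p \<or> y = v" by blast
      have "u \<noteq> p" "u \<noteq> q" using u(1) e(1) pq by auto
      then have "{p, u} \<in> E \<or> {q, u} \<in> E"
        using e(2) pq by (auto simp: insert_commute)
      then have "v = u" using v(4)[of u] v(5)[of u] \<open>u \<noteq> p\<close> \<open>u \<noteq> q\<close> by blast
      then show ?thesis using v(2,3) pq by (auto simp: insert_commute)
    qed
    show ?thesis
    proof (rule that[of u b M "{e \<in> M. e \<inter> ?C = {}}"])
      show "maximum_induced_matching (V - {u}) E M"
        by (rule maximum_induced_matching_restrict[OF G M]) (use u(1) EV ME in auto)
      show "maximum_induced_matching (V - ?C) E {e \<in> M. e \<inter> ?C = {}}"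
      proof (rule maximum_induced_matching_restrict[OF G M])
        show "f \<inter> e = {}" if "e \<in> M - {e \<in> M. e \<inter> ?C = {}}" "f \<in> E" "f \<subseteq> V - ?C" for e f
          using whole[of e] that by blast
        show "e \<subseteq> V - ?C" if "e \<in> {e \<in> M. e \<inter> ?C = {}}" for e
          using that EV ME by blast
      qed auto
      show "y = u \<or> {u, y} \<in> E" if "{b, y} \<in> E" for y
        using u(2) u(4)[OF that] by (auto simp: insert_commute)
    qed (use u(3) in \<open>simp add: insert_commute\<close>)
  qed
qed

text \<open>Deletion and link of the vertex \<open>x\<close> provided by \<open>maximum_induced_matching_shedding\<close> are independence
  complexes of smaller graphs of the same kind. An independent set that avoids the closed
  neighbourhood of \<open>x\<close> is not maximal in the deletion, because the closed neighbourhood of \<open>w\<close> is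
  contained in that of \<open>x\<close> and so \<open>w\<close> can be added.\<close>

theorem vertex_decomposable_indep_complex:
  assumes "simple_graph V E" "maximum_induced_matching V E M"
  shows "vertex_decomposable (indep_complex V E)"
  using assms
proof (induction "card V" arbitrary: V E M rule: less_induct)
  case less
  note G = less.prems(1)
  have "finite V" and EV: "\<And>e. e \<in> E \<Longrightarrow> e \<subseteq> V" and two: "\<And>e. e \<in> E \<Longrightarrow> card e = 2"
    using G by (auto simp: simple_graph_def)
  have sub: "vertex_decomposable (indep_complex V' E)"
    if "V' \<subset> V" "maximum_induced_matching V' E M'" for V' M'
  proof -
    let ?E = "{e\<in>E. e \<subseteq> V'}"
    have "simple_graph V' ?E"
      using G that(1) finite_subset by (auto simp: simple_graph_def)
    moreover have "maximum_induced_matching V' ?E M'"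
      using that(2) by (simp add: maximum_induced_matching_def)
    moreover have "card V' < card V" using \<open>finite V\<close> that(1) by (rule psubset_card_mono)
    ultimately have "vertex_decomposable (indep_complex V' ?E)" using less.hyps by blast
    moreover have "indep_complex V' ?E = indep_complex V' E"
      by (auto simp: indep_complex_def)
    ultimately show ?thesis by simp
  qed
  show ?case
  proof (cases "M = {}")
    case True
    have "E = {}"
    proof (rule ccontr)
      assume "E \<noteq> {}"
      then obtain e where "e \<in> E" by blast
      then have "matching {e\<in>E. e \<subseteq> V} {e}" using EV by (auto simp: matching_def)
      then have "card {e} \<le> card M" using less.prems(2) unfolding maximum_induced_matching_def by blast
      then show False using True by simp
    qed
    then have "indep_complex V E = Pow V" by (auto simp: indep_complex_def)
    then show ?thesis using \<open>finite V\<close> by (simp add: vertex_decomposable.simplex)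
  next
    case False
    from maximum_induced_matching_shedding[OF less.prems this]
    obtain x w M1 M2 where w: "{x, w} \<in> E" "\<And>y. {w, y} \<in> E \<Longrightarrow> y = x \<or> {x, y} \<in> E"
      and M1: "maximum_induced_matching (V - {x}) E M1"
      and M2: "maximum_induced_matching (V - insert x {y. {x, y} \<in> E}) E M2"
      by metis
    have "x \<in> V" "w \<in> V" "w \<noteq> x" using w(1) EV two[OF w(1)] by auto
    have loop: "{y} \<notin> E" for y using two[of "{y}"] by auto
    let ?\<Delta> = "indep_complex V E"
    have del: "deletion ?\<Delta> x = indep_complex (V - {x}) E"
      by (auto simp: deletion_def indep_complex_def)
    have link: "link ?\<Delta> x = indep_complex (V - insert x {y. {x, y} \<in> E}) E"
      using \<open>x \<in> V\<close> loop
      by (auto simp: link_def indep_complex_def insert_commute subset_eq)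
    show ?thesis
    proof (rule vertex_decomposable.shedding)
      show "{x} \<in> ?\<Delta>" using \<open>x \<in> V\<close> loop by (simp add: indep_complex_def)
      show "vertex_decomposable (deletion ?\<Delta> x)"
        unfolding del using M1 \<open>x \<in> V\<close> by (intro sub) auto
      show "vertex_decomposable (link ?\<Delta> x)"
        unfolding link using M2 \<open>x \<in> V\<close> by (intro sub) auto
      show "\<forall>\<sigma>\<in>link ?\<Delta> x. \<not> is_facet \<sigma> (deletion ?\<Delta> x)"
      proof
        fix \<sigma> assume \<sigma>: "\<sigma> \<in> link ?\<Delta> x"
        then have "w \<notin> \<sigma>" "\<And>y. y \<in> \<sigma> \<Longrightarrow> {w, y} \<notin> E"
          using w unfolding link by (auto simp: indep_complex_def)
        then have "insert w \<sigma> \<in> deletion ?\<Delta> x"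
          using \<sigma> loop \<open>w \<in> V\<close> \<open>w \<noteq> x\<close> unfolding link del
          by (auto simp: indep_complex_def insert_commute)
        then show "\<not> is_facet \<sigma> (deletion ?\<Delta> x)"
          using \<open>w \<notin> \<sigma>\<close> by (auto simp: is_facet_def)
      qed
    qed
  qed
qed

section \<open>Attaching facets in order of decreasing size\<close>

definition simplicial_complex :: "'a set set \<Rightarrow> bool" where
  "simplicial_complex \<Delta> \<longleftrightarrow> finite (\<Union>\<Delta>) \<and> (\<forall>\<sigma>\<in>\<Delta>. Pow \<sigma> \<subseteq> \<Delta>)"

lemma simplicial_complexD:
  assumes "simplicial_complex \<Delta>"
  shows "\<sigma> \<in> \<Delta> \<Longrightarrow> \<tau> \<subseteq> \<sigma> \<Longrightarrow> \<tau> \<in> \<Delta>" "\<sigma> \<in> \<Delta> \<Longrightarrow> finite \<sigma>"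
proof -
  show "\<sigma> \<in> \<Delta> \<Longrightarrow> \<tau> \<subseteq> \<sigma> \<Longrightarrow> \<tau> \<in> \<Delta>"
    using assms unfolding simplicial_complex_def by blast
  show "\<sigma> \<in> \<Delta> \<Longrightarrow> finite \<sigma>"
    using assms finite_subset[OF Union_upper, of \<sigma> \<Delta>] by (simp add: simplicial_complex_def)
qed

lemma simplicial_complex_deletion_link:
  assumes "simplicial_complex \<Delta>"
  shows "simplicial_complex (deletion \<Delta> x)" "simplicial_complex (link \<Delta> x)"
proof -
  have "finite (\<Union>(deletion \<Delta> x))" "finite (\<Union>(link \<Delta> x))"
    using assms unfolding simplicial_complex_def deletion_def link_def
    by (auto intro: finite_subset[of _ "\<Union>\<Delta>"])
  moreover have "\<tau> \<in> deletion \<Delta> x" if "\<sigma> \<in> deletion \<Delta> x" "\<tau> \<subseteq> \<sigma>" for \<sigma> \<tau>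
    using simplicial_complexD(1)[OF assms, of \<sigma> \<tau>] that by (auto simp: deletion_def)
  moreover have "\<tau> \<in> link \<Delta> x" if "\<sigma> \<in> link \<Delta> x" "\<tau> \<subseteq> \<sigma>" for \<sigma> \<tau>
    using simplicial_complexD(1)[OF assms, of \<sigma> \<tau>]
      simplicial_complexD(1)[OF assms, of "insert x \<sigma>" "insert x \<tau>"] that
    by (auto simp: link_def)
  ultimately show "simplicial_complex (deletion \<Delta> x)" "simplicial_complex (link \<Delta> x)"
    by (auto simp: simplicial_complex_def)
qed

text \<open>The subcomplex generated by the faces of size at least \<open>i\<close>. For \<open>i = 0\<close> it is the complex itself, and
  it is empty for large \<open>i\<close>.\<close>

definition faces_below :: "'a set set \<Rightarrow> nat \<Rightarrow> 'a set set" where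
  "faces_below \<Delta> i = {\<sigma>. \<exists>F\<in>\<Delta>. \<sigma> \<subseteq> F \<and> i \<le> card F}"

lemma faces_below_Suc_subset: "faces_below \<Delta> (Suc i) \<subseteq> faces_below \<Delta> i"
  by (auto simp: faces_below_def)

lemma faces_below_0:
  assumes "simplicial_complex \<Delta>"
  shows "faces_below \<Delta> 0 = \<Delta>"
  using simplicial_complexD(1)[OF assms] unfolding faces_below_def by blast

lemma faces_below_subset:
  assumes "simplicial_complex \<Delta>"
  shows "faces_below \<Delta> i \<subseteq> \<Delta>"
  using simplicial_complexD(1)[OF assms] unfolding faces_below_def by blast

lemma faces_below_large:
  assumes "simplicial_complex \<Delta>" "card (\<Union>\<Delta>) < i"
  shows "faces_below \<Delta> i = {}"
proof -
  have "card F \<le> card (\<Union>\<Delta>)" if "F \<in> \<Delta>" for F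
    using assms that by (intro card_mono) (auto simp: simplicial_complex_def)
  then have "\<not> i \<le> card F" if "F \<in> \<Delta>" for F
    using assms(2) that by (meson leD le_trans)
  then show ?thesis unfolding faces_below_def by blast
qed

text \<open>The set \<open>R\<close> is the smallest new face: the faces that \<open>F\<close> adds are those between \<open>R\<close> and \<open>F\<close>. This form
  of a shelling step translates directly into ideals, where \<open>R\<close> becomes the generator of a quotient.\<close>

inductive attach :: "nat \<Rightarrow> 'a set set \<Rightarrow> 'a set set \<Rightarrow> bool" for i \<Gamma> where
  start: "attach i \<Gamma> \<Gamma>"
| add: "\<lbrakk>attach i \<Gamma> \<Gamma>'; finite F; card F = i; R \<subseteq> F; \<And>\<sigma>. \<sigma> \<subseteq> F \<Longrightarrow> \<sigma> \<in> \<Gamma>' \<longleftrightarrow> \<not> R \<subseteq> \<sigma>\<rbrakk> \<Longrightarrow>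
     attach i \<Gamma> (\<Gamma>' \<union> Pow F)"

lemma attach_subset: "attach i \<Gamma> \<Gamma>' \<Longrightarrow> \<Gamma> \<subseteq> \<Gamma>'"
  by (induction rule: attach.induct) auto

lemma attach_trans:
  assumes "attach i \<Gamma>' \<Gamma>''" "attach i \<Gamma> \<Gamma>'"
  shows "attach i \<Gamma> \<Gamma>''"
  using assms
proof (induction rule: attach.induct)
  case start
  then show ?case .
next
  case (add \<Gamma>'' F R)
  have *: "attach i \<Gamma> \<Gamma>''" by (rule add.IH[OF add.prems])
  show ?case
    by (rule attach.add[where R = R, OF * add.hyps(2) add.hyps(3) add.hyps(4)])
      (rule add.hyps(5))
qed

text \<open>Faces through a vertex \<open>x\<close> outside the attached facets do not interfere with their attachment.\<close>

lemma attach_Un_away: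
  assumes "attach i \<Gamma> \<Gamma>'" "\<And>\<sigma>. \<sigma> \<in> \<Gamma>' \<Longrightarrow> x \<notin> \<sigma>" "\<And>\<sigma>. \<sigma> \<in> X \<Longrightarrow> x \<in> \<sigma>"
  shows "attach i (\<Gamma> \<union> X) (\<Gamma>' \<union> X)"
  using assms
proof (induction rule: attach.induct)
  case start
  show ?case by (rule attach.start)
next
  case (add \<Gamma>' F R)
  have "x \<notin> F" using add.prems(1)[of F] by simp
  have "attach i (\<Gamma> \<union> X) ((\<Gamma>' \<union> X) \<union> Pow F)"
  proof (rule attach.add)
    show "attach i (\<Gamma> \<union> X) (\<Gamma>' \<union> X)" using add by auto
    show "\<sigma> \<in> \<Gamma>' \<union> X \<longleftrightarrow> \<not> R \<subseteq> \<sigma>" if "\<sigma> \<subseteq> F" for \<sigma>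
      using add.hyps(5)[OF that] add.prems(2) \<open>x \<notin> F\<close> that by blast
  qed (use add.hyps in auto)
  moreover have "(\<Gamma>' \<union> X) \<union> Pow F = (\<Gamma>' \<union> Pow F) \<union> X" by auto
  ultimately show ?case by simp
qed

text \<open>Attaching \<open>F\<close> along \<open>[R, F]\<close> becomes attaching \<open>F \<union> {x}\<close> along \<open>[R \<union> {x}, F \<union> {x}]\<close>, provided that
  all faces of the bases are there already.\<close>

lemma attach_cone:
  assumes "attach i \<Gamma> \<Gamma>'" "\<Gamma>' \<subseteq> Y" "\<And>\<sigma>. \<sigma> \<in> Y \<Longrightarrow> x \<notin> \<sigma>"
  shows "attach (Suc i) (Y \<union> insert x ` \<Gamma>) (Y \<union> insert x ` \<Gamma>')"
  using assms
proof (induction rule: attach.induct)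
  case start
  show ?case by (rule attach.start)
next
  case (add \<Gamma>' F R)
  have "x \<notin> F" "Pow F \<subseteq> Y" using add.prems by auto
  have "attach (Suc i) (Y \<union> insert x ` \<Gamma>) ((Y \<union> insert x ` \<Gamma>') \<union> Pow (insert x F))"
  proof (rule attach.add)
    show "attach (Suc i) (Y \<union> insert x ` \<Gamma>) (Y \<union> insert x ` \<Gamma>')" using add by auto
    show "card (insert x F) = Suc i" using add.hyps \<open>x \<notin> F\<close> by simp
    show "insert x R \<subseteq> insert x F" using add.hyps by auto
    show "\<sigma> \<in> Y \<union> insert x ` \<Gamma>' \<longleftrightarrow> \<not> insert x R \<subseteq> \<sigma>" if \<sigma>: "\<sigma> \<subseteq> insert x F" for \<sigma>
    proof (cases "x \<in> \<sigma>")
      case True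
      have "\<sigma> = insert x \<tau> \<longleftrightarrow> \<tau> = \<sigma> - {x}" if "\<tau> \<in> \<Gamma>'" for \<tau>
        using that add.prems True by auto
      then have "\<sigma> \<in> insert x ` \<Gamma>' \<longleftrightarrow> \<sigma> - {x} \<in> \<Gamma>'" using True by (auto simp: image_iff)
      also have "\<dots> \<longleftrightarrow> \<not> R \<subseteq> \<sigma> - {x}" using \<sigma> by (intro add.hyps(5)) auto
      finally show ?thesis using True add.prems(2) add.hyps(4) \<open>x \<notin> F\<close> by auto
    next
      case False
      then show ?thesis using \<sigma> \<open>Pow F \<subseteq> Y\<close> by auto
    qed
  qed (use add.hyps in auto)
  moreover have "(Y \<union> insert x ` \<Gamma>') \<union> Pow (insert x F) = Y \<union> insert x ` (\<Gamma>' \<union> Pow F)"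
    using \<open>Pow F \<subseteq> Y\<close> by (auto simp: Pow_insert)
  ultimately show ?case by simp
qed

text \<open>A face of the link is not a facet of the deletion, so it lies in a face of the deletion with at
  least one more vertex. This makes up for the lost vertex when \<open>x\<close> is removed from a face of \<open>\<Delta>\<close>.\<close>

lemma faces_below_shedding:
  assumes \<Delta>: "simplicial_complex \<Delta>"
    and shed: "\<forall>\<sigma>\<in>link \<Delta> x. \<not> is_facet \<sigma> (deletion \<Delta> x)"
  shows "faces_below \<Delta> (Suc i) =
    faces_below (deletion \<Delta> x) (Suc i) \<union> insert x ` faces_below (link \<Delta> x) i"
    (is "?l = ?D \<union> ?L")
    and "faces_below (link \<Delta> x) i \<subseteq> faces_below (deletion \<Delta> x) (Suc i)"
proof -
  note down = simplicial_complexD(1)[OF \<Delta>] and fin = simplicial_complexD(2)[OF \<Delta>]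
  show link_sub: "faces_below (link \<Delta> x) i \<subseteq> ?D"
  proof
    fix \<sigma> assume "\<sigma> \<in> faces_below (link \<Delta> x) i"
    then obtain F where F: "F \<in> link \<Delta> x" "\<sigma> \<subseteq> F" "i \<le> card F" by (auto simp: faces_below_def)
    moreover have "F \<in> deletion \<Delta> x" using F(1) by (simp add: link_def deletion_def)
    ultimately obtain F' where F': "F' \<in> deletion \<Delta> x" "F \<subset> F'"
      using shed unfolding is_facet_def by blast
    moreover have "finite F'" using F' fin by (auto simp: deletion_def)
    ultimately have "card F < card F'" by (simp add: psubset_card_mono)
    then have "Suc i \<le> card F'" "\<sigma> \<subseteq> F'" using F F' by auto
    then show "\<sigma> \<in> ?D" using F'(1) by (auto simp: faces_below_def)
  qed
  show "?l = ?D \<union> ?L"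
  proof
    show "?l \<subseteq> ?D \<union> ?L"
    proof
      fix \<sigma> assume "\<sigma> \<in> ?l"
      then obtain F where F: "F \<in> \<Delta>" "\<sigma> \<subseteq> F" "Suc i \<le> card F" by (auto simp: faces_below_def)
      show "\<sigma> \<in> ?D \<union> ?L"
      proof (cases "x \<in> F")
        case False
        then show ?thesis using F by (auto simp: faces_below_def deletion_def)
      next
        case True
        have "F - {x} \<in> link \<Delta> x"
          using True F(1) down by (auto simp: link_def insert_absorb)
        moreover have "i \<le> card (F - {x})" using F True fin by (simp add: card_Diff_singleton)
        ultimately have below: "\<sigma> - {x} \<in> faces_below (link \<Delta> x) i"
          using F(2) unfolding faces_below_def by blast
        show ?thesis
        proof (cases "x \<in> \<sigma>")
          case True
          then have "\<sigma> = insert x (\<sigma> - {x})" by auto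
          then show ?thesis using below by blast
        next
          case False
          then show ?thesis using below link_sub by auto
        qed
      qed
    qed
    show "?D \<union> ?L \<subseteq> ?l"
    proof
      fix \<sigma> assume "\<sigma> \<in> ?D \<union> ?L"
      then consider "\<sigma> \<in> ?D" | \<tau> where "\<sigma> = insert x \<tau>" "\<tau> \<in> faces_below (link \<Delta> x) i" by auto
      then show "\<sigma> \<in> ?l"
      proof cases
        case 1
        then show ?thesis by (auto simp: faces_below_def deletion_def)
      next
        case 2
        then obtain F where F: "F \<in> link \<Delta> x" "\<tau> \<subseteq> F" "i \<le> card F" by (auto simp: faces_below_def)
        then have "insert x F \<in> \<Delta>" "finite F" "x \<notin> F" using fin by (auto simp: link_def)
        then have "insert x F \<in> \<Delta>" "Suc i \<le> card (insert x F)" "\<sigma> \<subseteq> insert x F"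
          using F(2,3) 2(1) by auto
        then show ?thesis unfolding faces_below_def by blast
      qed
    qed
  qed
qed

text \<open>At a shedding vertex \<open>x\<close> the facets of \<open>\<Delta>\<close> of size \<open>i\<close> are those of the deletion, followed by
  the cones over the facets of size \<open>i - 1\<close> of the link. The bases of these cones are already
  present: by the shedding condition every face of the link lies in a larger face of the deletion.\<close>

lemma vertex_decomposable_attach:
  assumes "vertex_decomposable \<Delta>" "simplicial_complex \<Delta>"
  shows "attach i (faces_below \<Delta> (Suc i)) (faces_below \<Delta> i)"
  using assms
proof (induction arbitrary: i rule: vertex_decomposable.induct)
  case (simplex F)
  have "card G \<le> card F" if "G \<subseteq> F" for G
    using simplex.hyps that by (rule card_mono)
  then have below: "faces_below (Pow F) j = (if j \<le> card F then Pow F else {})" for j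
    unfolding faces_below_def by (auto dest: le_trans)
  show ?case
  proof (cases "i = card F")
    case True
    have "attach (card F) {} ({} \<union> Pow F)"
      by (rule attach.add[of _ _ _ _ "{}"]) (use simplex.hyps in \<open>auto intro: attach.start\<close>)
    then show ?thesis using True by (simp add: below)
  next
    case False
    then have "faces_below (Pow F) (Suc i) = faces_below (Pow F) i" by (auto simp: below)
    then show ?thesis by (simp add: attach.start)
  qed
next
  case (shedding x \<Delta>)
  note \<Delta> = shedding.prems
  note D = simplicial_complex_deletion_link(1)[OF \<Delta>] and L = simplicial_complex_deletion_link(2)[OF \<Delta>]
  note below = faces_below_shedding[OF \<Delta> shedding.hyps(4)]
  show ?case
  proof (cases i)
    case 0
    have "faces_below \<Delta> 0 \<subseteq> faces_below \<Delta> 1"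
    proof
      fix \<sigma> assume "\<sigma> \<in> faces_below \<Delta> 0"
      then have \<sigma>: "\<sigma> \<in> \<Delta>" using faces_below_0[OF \<Delta>] by simp
      show "\<sigma> \<in> faces_below \<Delta> 1"
      proof (cases "\<sigma> = {}")
        case True
        \<comment> \<open>The empty face lies below \<open>{x}\<close>.\<close>
        then show ?thesis using shedding.hyps(1) by (force simp: faces_below_def)
      next
        case False
        then have "1 \<le> card \<sigma>" using simplicial_complexD(2)[OF \<Delta> \<sigma>] by (simp add: Suc_le_eq card_gt_0_iff)
        then show ?thesis using \<sigma> by (auto simp: faces_below_def)
      qed
    qed
    then have "faces_below \<Delta> (Suc i) = faces_below \<Delta> i"
      using faces_below_Suc_subset[of \<Delta> 0] 0 by auto
    then show ?thesis by (simp add: attach.start)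
  next
    case (Suc k)
    let ?D = "faces_below (deletion \<Delta> x)" and ?L = "faces_below (link \<Delta> x)"
    have away: "x \<notin> \<sigma>" if "\<sigma> \<in> ?D j" for \<sigma> j
      using that faces_below_subset[OF D] by (auto simp: deletion_def)
    have "attach i (?D (Suc i) \<union> insert x ` ?L i) (?D i \<union> insert x ` ?L i)"
      by (rule attach_Un_away[of _ _ _ x]) (use shedding.IH(1)[OF D] away in auto)
    moreover have "attach i (?D i \<union> insert x ` ?L i) (?D i \<union> insert x ` ?L k)"
      unfolding Suc by (rule attach_cone[OF shedding.IH(2)[OF L] below(2)]) (rule away)
    ultimately show ?thesis
      unfolding below(1)[of i] below(1)[of k, folded Suc] by (rule attach_trans[rotated])
  qed
qed

subsection \<open>Shellability\<close>

definition shelling :: "'a set list \<Rightarrow> bool" where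
  "shelling Fs \<longleftrightarrow> distinct Fs \<and> (\<forall>i. 0 < i \<and> i < length Fs \<longrightarrow>
     pure_of_dim (face_dim (Fs ! i) - 1) ((\<Union>j<i. Pow (Fs ! j)) \<inter> Pow (Fs ! i)))"

text \<open>The maximal subsets of \<open>F\<close> that do not contain \<open>R\<close> arise from \<open>F\<close> by removing one element of \<open>R\<close>.\<close>

lemma pure_not_above:
  assumes "finite F" "R \<subseteq> F" "R \<noteq> {}"
  shows "pure_of_dim (face_dim F - 1) {\<sigma>. \<sigma> \<subseteq> F \<and> \<not> R \<subseteq> \<sigma>}"
  unfolding pure_of_dim_def
proof (intro conjI allI impI)
  show "{\<sigma>. \<sigma> \<subseteq> F \<and> \<not> R \<subseteq> \<sigma>} \<noteq> {}" using assms(3) by blast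
  fix G assume G: "is_facet G {\<sigma>. \<sigma> \<subseteq> F \<and> \<not> R \<subseteq> \<sigma>}"
  then have "G \<subseteq> F" "\<not> R \<subseteq> G"
    and max: "\<And>\<sigma>. \<sigma> \<subseteq> F \<Longrightarrow> \<not> R \<subseteq> \<sigma> \<Longrightarrow> G \<subseteq> \<sigma> \<Longrightarrow> \<sigma> = G"
    by (simp_all add: is_facet_def)
  then obtain r where r: "r \<in> R" "r \<notin> G" by blast
  have "F - {r} = G"
    by (rule max) (use r \<open>G \<subseteq> F\<close> in blast)+
  have "card F = Suc (card (F - {r}))"
    using assms r by (intro card.remove) auto
  then show "face_dim G = face_dim F - 1"
    unfolding \<open>F - {r} = G\<close> by (simp add: face_dim_def)
qed

lemma shelling_snoc:
  assumes Fs: "shelling Fs" and F: "finite F" "R \<subseteq> F"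
    and new: "\<And>\<sigma>. \<sigma> \<subseteq> F \<Longrightarrow> \<sigma> \<in> (\<Union>G\<in>set Fs. Pow G) \<longleftrightarrow> \<not> R \<subseteq> \<sigma>"
  shows "shelling (Fs @ [F])"
  unfolding shelling_def
proof (intro conjI allI impI)
  have "F \<notin> (\<Union>G\<in>set Fs. Pow G)" using new[of F] F(2) by blast
  then have "F \<notin> set Fs" by blast
  then show "distinct (Fs @ [F])" using Fs by (simp add: shelling_def)
  fix i assume i: "0 < i \<and> i < length (Fs @ [F])"
  have below: "(\<Union>j<i. Pow ((Fs @ [F]) ! j)) = (\<Union>j<i. Pow (Fs ! j))"
    using i by (auto simp: nth_append)
  show "pure_of_dim (face_dim ((Fs @ [F]) ! i) - 1)
      ((\<Union>j<i. Pow ((Fs @ [F]) ! j)) \<inter> Pow ((Fs @ [F]) ! i))"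
  proof (cases "i < length Fs")
    case True
    then show ?thesis using Fs i unfolding below by (simp add: shelling_def nth_append)
  next
    case False
    then have i_eq: "i = length Fs" using i by simp
    have all: "(\<Union>j<i. Pow (Fs ! j)) = (\<Union>G\<in>set Fs. Pow G)"
      unfolding i_eq by (auto simp: set_conv_nth)
    have "Fs ! 0 \<in> set Fs" using i i_eq by (intro nth_mem) simp
    then have "{} \<in> (\<Union>G\<in>set Fs. Pow G)" by blast
    then have "R \<noteq> {}" using new[of "{}"] by auto
    have "(\<Union>j<i. Pow (Fs ! j)) \<inter> Pow F = {\<sigma>. \<sigma> \<subseteq> F \<and> \<not> R \<subseteq> \<sigma>}"
      unfolding all using new by blast
    then show ?thesis unfolding below using pure_not_above[OF F \<open>R \<noteq> {}\<close>] i_eq by simp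
  qed
qed

text \<open>A set \<open>F\<close> of size \<open>i\<close> that is not below any larger face is a facet; this identifies the attached
  sets with facets of \<open>\<Delta>\<close>.\<close>

lemma attach_shelling:
  assumes "attach i \<Gamma> \<Gamma>'" "\<Gamma>' \<subseteq> \<Delta>" "simplicial_complex \<Delta>" "faces_below \<Delta> (Suc i) \<subseteq> \<Gamma>"
    and "shelling Fs" "\<Gamma> = (\<Union>F\<in>set Fs. Pow F)" "\<forall>F\<in>set Fs. is_facet F \<Delta>"
  shows "\<exists>Gs. shelling Gs \<and> \<Gamma>' = (\<Union>F\<in>set Gs. Pow F) \<and> (\<forall>F\<in>set Gs. is_facet F \<Delta>)"
  using assms
proof (induction rule: attach.induct)
  case start
  then show ?case by blast
next
  case (add \<Gamma>' F R)
  have "\<Gamma>' \<subseteq> \<Delta>" "F \<in> \<Delta>" using add.prems(1) by blast+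
  then obtain Gs where Gs: "shelling Gs" "\<Gamma>' = (\<Union>F\<in>set Gs. Pow F)" "\<forall>F\<in>set Gs. is_facet F \<Delta>"
    using add.IH add.prems by blast
  have "shelling (Gs @ [F])"
    by (rule shelling_snoc[OF Gs(1) add.hyps(2,4)]) (use add.hyps(5) Gs(2) in simp)
  moreover have "is_facet F \<Delta>"
    unfolding is_facet_def
  proof (intro conjI ballI impI)
    fix \<sigma> assume \<sigma>: "\<sigma> \<in> \<Delta>" "F \<subseteq> \<sigma>"
    show "\<sigma> = F"
    proof (rule ccontr)
      assume "\<sigma> \<noteq> F"
      then have "card F < card \<sigma>"
        using \<sigma> simplicial_complexD(2)[OF add.prems(2) \<sigma>(1)] by (intro psubset_card_mono) auto
      then have "F \<in> faces_below \<Delta> (Suc i)" using \<sigma> add.hyps(3) by (auto simp: faces_below_def)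
      then have "F \<in> \<Gamma>'" using add.prems(3) attach_subset[OF add.hyps(1)] by blast
      then show False using add.hyps(4,5) by simp
    qed
  qed fact
  ultimately show ?case using Gs(2,3) by (intro exI[of _ "Gs @ [F]"]) auto
qed

theorem vertex_decomposable_shellable:
  assumes "vertex_decomposable \<Delta>" and \<Delta>: "simplicial_complex \<Delta>"
  shows "shellable \<Delta>"
proof -
  have "\<exists>Fs. shelling Fs \<and> faces_below \<Delta> 0 = (\<Union>F\<in>set Fs. Pow F) \<and> (\<forall>F\<in>set Fs. is_facet F \<Delta>)"
  proof (induction rule: inc_induct[OF le0[of "Suc (card (\<Union>\<Delta>))"]])
    case 1
    then show ?case
      by (intro exI[of _ "[]"]) (simp add: faces_below_large[OF \<Delta>] shelling_def)
  next
    case (2 i)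
    then obtain Fs where "shelling Fs" "faces_below \<Delta> (Suc i) = (\<Union>F\<in>set Fs. Pow F)"
      "\<forall>F\<in>set Fs. is_facet F \<Delta>" by blast
    from attach_shelling[OF vertex_decomposable_attach[OF assms] faces_below_subset[OF \<Delta>] \<Delta> order_refl this]
    show ?case .
  qed
  then obtain Fs where Fs: "shelling Fs" "\<Delta> = (\<Union>F\<in>set Fs. Pow F)" "\<forall>F\<in>set Fs. is_facet F \<Delta>"
    using faces_below_0[OF \<Delta>] by auto
  have "F \<in> set Fs" if "is_facet F \<Delta>" for F
  proof -
    have "F \<in> (\<Union>F\<in>set Fs. Pow F)" using that Fs(2) by (simp add: is_facet_def)
    then obtain G where G: "G \<in> set Fs" "F \<subseteq> G" by blast
    then have "G \<in> \<Delta>" using Fs(3) by (simp add: is_facet_def)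
    then have "G = F" using that G(2) by (simp add: is_facet_def)
    then show ?thesis using G(1) by simp
  qed
  then have "set Fs = {F. is_facet F \<Delta>}" using Fs(3) by auto
  then show ?thesis using Fs(1) unfolding shellable_def shelling_def by blast
qed

section \<open>Weakly regular sequences on quotients of ideals\<close>

text \<open>For ideals \<open>C \<subseteq> B\<close> this is the preimage in \<open>B\<close> of \<open>t (B / C)\<close>, and \<open>plus_seq\<close> below is
  the preimage of \<open>(t\<^sub>1, \<dots>, t\<^sub>n) (B / C)\<close>. All modules of this development are quotients \<open>B / C\<close>, so
  that their elements can be represented by ring elements.\<close>

definition plus_mult :: "'r::comm_ring_1 set \<Rightarrow> 'r \<Rightarrow> 'r set \<Rightarrow> 'r set" where
  "plus_mult C t B = {c + t * b | c b. c \<in> C \<and> b \<in> B}"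

fun plus_seq :: "'r::comm_ring_1 list \<Rightarrow> 'r set \<Rightarrow> 'r set \<Rightarrow> 'r set" where
  "plus_seq [] B C = C"
| "plus_seq (t # ts) B C = plus_seq ts B (plus_mult C t B)"

text \<open>Weak regularity of a sequence on \<open>B / C\<close>: no condition is put on the last quotient, which may vanish.\<close>

fun weakly_regular :: "'r::comm_ring_1 list \<Rightarrow> 'r set \<Rightarrow> 'r set \<Rightarrow> bool" where
  "weakly_regular [] B C \<longleftrightarrow> True"
| "weakly_regular (t # ts) B C \<longleftrightarrow>
     (\<forall>b\<in>B. t * b \<in> C \<longrightarrow> b \<in> C) \<and> weakly_regular ts B (plus_mult C t B)"

lemma plus_seq_snoc: "plus_seq (ts @ [t]) B C = plus_mult (plus_seq ts B C) t B"
  by (induction ts arbitrary: C) auto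

lemma weakly_regular_snoc:
  "weakly_regular (ts @ [t]) B C \<longleftrightarrow> weakly_regular ts B C \<and>
     (\<forall>b\<in>B. t * b \<in> plus_seq ts B C \<longrightarrow> b \<in> plus_seq ts B C)"
  by (induction ts arbitrary: C) auto

lemma weakly_regular_nth:
  "weakly_regular ts B C \<longleftrightarrow> (\<forall>i<length ts. \<forall>b\<in>B.
     ts ! i * b \<in> plus_seq (take i ts) B C \<longrightarrow> b \<in> plus_seq (take i ts) B C)"
proof (induction ts rule: rev_induct)
  case (snoc t ts)
  show ?case
    unfolding weakly_regular_snoc snoc.IH by (auto simp: less_Suc_eq nth_append)
qed simp

lemma plus_seq_eq_sums:
  assumes "0 \<in> B"
  shows "plus_seq ts B C = {c + (\<Sum>j<length ts. ts ! j * y j) | c y. c \<in> C \<and> (\<forall>j<length ts. y j \<in> B)}"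
proof (induction ts rule: rev_induct)
  case (snoc t ts)
  show ?case (is "_ = ?r")
  proof
    show "plus_seq (ts @ [t]) B C \<subseteq> ?r"
    proof
      fix p assume "p \<in> plus_seq (ts @ [t]) B C"
      then obtain c y b where p: "p = (c + (\<Sum>j<length ts. ts ! j * y j)) + t * b"
        "c \<in> C" "\<forall>j<length ts. y j \<in> B" "b \<in> B"
        unfolding plus_seq_snoc plus_mult_def snoc.IH by blast
      let ?y = "y(length ts := b)"
      have "(\<Sum>j<length (ts @ [t]). (ts @ [t]) ! j * ?y j) = (\<Sum>j<length ts. ts ! j * y j) + t * b"
        by (simp add: nth_append)
      moreover have "\<forall>j<length (ts @ [t]). ?y j \<in> B" using p by (simp add: less_Suc_eq)
      ultimately show "p \<in> ?r" using p by (auto intro!: exI[of _ c] exI[of _ ?y] simp: add.assoc)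
    qed
    show "?r \<subseteq> plus_seq (ts @ [t]) B C"
    proof
      fix p assume "p \<in> ?r"
      then obtain c y where p: "p = c + (\<Sum>j<length (ts @ [t]). (ts @ [t]) ! j * y j)"
        "c \<in> C" "\<forall>j<length (ts @ [t]). y j \<in> B" by blast
      have "p = (c + (\<Sum>j<length ts. ts ! j * y j)) + t * y (length ts)"
        unfolding p(1) by (simp add: nth_append add.assoc)
      moreover have "y (length ts) \<in> B" "\<forall>j<length ts. y j \<in> B" using p(3) by simp_all
      ultimately show "p \<in> plus_seq (ts @ [t]) B C"
        using p(2) unfolding plus_seq_snoc plus_mult_def snoc.IH by blast
    qed
  qed
qed simp

text \<open>The polynomials in a set of variables form a subset of a type. The ideals and quotients needed here
  live in such a subset, and are described by their elements.\<close>

locale subring_set =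
  fixes A :: "'r::comm_ring_1 set"
  assumes one_closed: "1 \<in> A"
    and add_closed: "p \<in> A \<Longrightarrow> q \<in> A \<Longrightarrow> p + q \<in> A"
    and mult_closed: "p \<in> A \<Longrightarrow> q \<in> A \<Longrightarrow> p * q \<in> A"
    and uminus_closed: "p \<in> A \<Longrightarrow> - p \<in> A"
begin

lemma zero_closed: "0 \<in> A"
  using add_closed[OF one_closed uminus_closed[OF one_closed]] by simp

lemma prod_closed: "(\<And>i. i \<in> I \<Longrightarrow> f i \<in> A) \<Longrightarrow> prod f I \<in> A"
  by (induction I rule: infinite_finite_induct) (auto simp: one_closed mult_closed)

lemma sum_closed: "(\<And>i. i \<in> I \<Longrightarrow> f i \<in> A) \<Longrightarrow> sum f I \<in> A"
  by (induction I rule: infinite_finite_induct) (auto simp: zero_closed add_closed)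

definition ideal_in :: "'r set \<Rightarrow> bool" where
  "ideal_in I \<longleftrightarrow> I \<subseteq> A \<and> 0 \<in> I \<and> (\<forall>p\<in>I. \<forall>q\<in>I. p + q \<in> I) \<and> (\<forall>a\<in>A. \<forall>p\<in>I. a * p \<in> I)"

lemma ideal_inD:
  assumes "ideal_in I"
  shows "p \<in> I \<Longrightarrow> p \<in> A" "0 \<in> I" "p \<in> I \<Longrightarrow> q \<in> I \<Longrightarrow> p + q \<in> I" "a \<in> A \<Longrightarrow> p \<in> I \<Longrightarrow> a * p \<in> I"
    "p \<in> I \<Longrightarrow> - p \<in> I" "p \<in> I \<Longrightarrow> q \<in> I \<Longrightarrow> p - q \<in> I"
proof -
  show neg: "- p \<in> I" if "p \<in> I" for p
  proof -
    have "- 1 * p \<in> I"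
      using assms that uminus_closed[OF one_closed] unfolding ideal_in_def by blast
    then show ?thesis by simp
  qed
  show "p - q \<in> I" if "p \<in> I" "q \<in> I"
  proof -
    have "p + - q \<in> I" using assms neg[of q] that unfolding ideal_in_def by blast
    then show ?thesis by simp
  qed
qed (use assms in \<open>auto simp: ideal_in_def\<close>)

lemma ideal_in_whole: "ideal_in A"
  by (simp add: ideal_in_def zero_closed add_closed mult_closed)

lemma ideal_in_sum: "ideal_in I \<Longrightarrow> (\<And>j. j \<in> J \<Longrightarrow> f j \<in> I) \<Longrightarrow> sum f J \<in> I"
  by (induction J rule: infinite_finite_induct) (auto intro: ideal_inD)

lemma ideal_in_plus_mult:
  assumes "ideal_in B" "ideal_in C" "t \<in> A"
  shows "ideal_in (plus_mult C t B)" "C \<subseteq> plus_mult C t B" "b \<in> B \<Longrightarrow> t * b \<in> plus_mult C t B"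
    "C \<subseteq> B \<Longrightarrow> plus_mult C t B \<subseteq> B"
proof -
  note B = ideal_inD[OF assms(1)] and C = ideal_inD[OF assms(2)]
  have CB: "c + t * b \<in> plus_mult C t B" if "c \<in> C" "b \<in> B" for c b
    using that by (auto simp: plus_mult_def)
  show "C \<subseteq> plus_mult C t B" using CB[OF _ B(2)] by auto
  show "t * b \<in> plus_mult C t B" if "b \<in> B" using CB[OF C(2) that] by simp
  show "plus_mult C t B \<subseteq> B" if "C \<subseteq> B"
    using that B(3,4) assms(3) by (auto simp: plus_mult_def)
  show "ideal_in (plus_mult C t B)"
    unfolding ideal_in_def
  proof (intro conjI ballI)
    show "plus_mult C t B \<subseteq> A"
      using B(1) C(1) assms(3) by (auto simp: plus_mult_def intro: add_closed mult_closed)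
    show "0 \<in> plus_mult C t B" using CB[OF C(2) B(2)] by simp
    fix p assume "p \<in> plus_mult C t B"
    then obtain c b where p: "p = c + t * b" "c \<in> C" "b \<in> B" by (auto simp: plus_mult_def)
    show "a * p \<in> plus_mult C t B" if "a \<in> A" for a
    proof -
      have "a * p = a * c + t * (a * b)" unfolding p by (simp add: algebra_simps)
      then show ?thesis using CB C(4) B(4) p that by simp
    qed
    fix q assume "q \<in> plus_mult C t B"
    then obtain c' b' where q: "q = c' + t * b'" "c' \<in> C" "b' \<in> B" by (auto simp: plus_mult_def)
    have "p + q = (c + c') + t * (b + b')" unfolding p q by (simp add: algebra_simps)
    then show "p + q \<in> plus_mult C t B"
      using CB[OF C(3)[OF p(2) q(2)] B(3)[OF p(3) q(3)]] by (simp only:)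
  qed
qed

lemma ideal_in_plus_seq:
  assumes "ideal_in B" "ideal_in C" "C \<subseteq> B" "set ts \<subseteq> A"
  shows "ideal_in (plus_seq ts B C)" "C \<subseteq> plus_seq ts B C" "plus_seq ts B C \<subseteq> B"
proof -
  have "ideal_in (plus_seq ts B C) \<and> C \<subseteq> plus_seq ts B C \<and> plus_seq ts B C \<subseteq> B"
    using assms
  proof (induction ts arbitrary: C)
    case (Cons t ts)
    then have "t \<in> A" by simp
    note C = ideal_in_plus_mult[OF Cons.prems(1,2) this]
    show ?case using Cons.IH[of "plus_mult C t B"] C Cons.prems by auto
  qed auto
  then show "ideal_in (plus_seq ts B C)" "C \<subseteq> plus_seq ts B C" "plus_seq ts B C \<subseteq> B" by auto
qed

text \<open>Multiplication by \<open>u\<close> induces an isomorphism from \<open>B / C\<close> to \<open>B' / C'\<close>. This covers the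
  second isomorphism theorem (\<open>u = 1\<close>) and shifts by a monomial.\<close>

lemma weakly_regular_transfer:
  assumes "weakly_regular ts B C" "ideal_in B" "ideal_in C" "ideal_in B'" "ideal_in C'" "C' \<subseteq> B'"
    and "u \<in> A" "set ts \<subseteq> A" "B' = plus_mult C' u B" "C = {b \<in> B. u * b \<in> C'}"
  shows "weakly_regular ts B' C'"
  using assms
proof (induction ts arbitrary: C C')
  case (Cons t ts)
  then have t: "t \<in> A" by simp
  note B = ideal_inD[OF Cons.prems(2)] and C = ideal_inD[OF Cons.prems(3)]
    and B' = ideal_inD[OF Cons.prems(4)] and C' = ideal_inD[OF Cons.prems(5)]
  note D = ideal_in_plus_mult[OF Cons.prems(2,3) t] and D' = ideal_in_plus_mult[OF Cons.prems(4,5) t]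
  have reg: "b \<in> C" if "b \<in> B" "t * b \<in> C" for b using Cons.prems(1) that by simp
  have B'_split: "\<exists>c b. p = c + u * b \<and> c \<in> C' \<and> b \<in> B" if "p \<in> B'" for p
    using that Cons.prems(9) by (auto simp: plus_mult_def)
  have uB: "u * b \<in> B'" if "b \<in> B" for b
    using ideal_in_plus_mult(3)[OF Cons.prems(2,5,7) that] Cons.prems(9) by simp
  have "p \<in> C'" if p: "p \<in> B'" "t * p \<in> C'" for p
  proof -
    obtain c b where cb: "p = c + u * b" "c \<in> C'" "b \<in> B" using B'_split[OF p(1)] by blast
    have "u * (t * b) = t * p - t * c" unfolding cb by (simp add: algebra_simps)
    then have "u * (t * b) \<in> C'" using C'(6)[OF p(2) C'(4)[OF t cb(2)]] by simp
    then have "t * b \<in> C" using Cons.prems(10) B(4)[OF t cb(3)] by simp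
    then have "b \<in> C" using reg cb(3) by simp
    then have "u * b \<in> C'" using Cons.prems(10) by simp
    then show ?thesis unfolding cb(1) by (rule C'(3)[OF cb(2)])
  qed
  moreover have "weakly_regular ts B' (plus_mult C' t B')"
  proof (rule Cons.IH[OF _ Cons.prems(2) D(1) Cons.prems(4) D'(1) D'(4)[OF Cons.prems(6)] Cons.prems(7)])
    show "weakly_regular ts B (plus_mult C t B)" using Cons.prems(1) by simp
    show "set ts \<subseteq> A" using Cons.prems by simp
    show "B' = plus_mult (plus_mult C' t B') u B"
    proof
      show "B' \<subseteq> plus_mult (plus_mult C' t B') u B"
        using B'_split D'(2) by (fastforce simp: plus_mult_def[of _ u])
      have "plus_mult C' t B' \<subseteq> B'" using D'(4) Cons.prems(6) by simp
      then show "plus_mult (plus_mult C' t B') u B \<subseteq> B'"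
        using B'(3) uB by (auto simp: plus_mult_def[of _ u])
    qed
    show "plus_mult C t B = {b \<in> B. u * b \<in> plus_mult C' t B'}"
    proof
      show "plus_mult C t B \<subseteq> {b \<in> B. u * b \<in> plus_mult C' t B'}"
      proof
        fix p assume p: "p \<in> plus_mult C t B"
        then obtain c b where cb: "p = c + t * b" "c \<in> C" "b \<in> B" by (auto simp: plus_mult_def)
        have "u * p = u * c + t * (u * b)" unfolding cb by (simp add: algebra_simps)
        moreover have "u * c \<in> C'" "u * b \<in> B'" using cb uB Cons.prems(10) by auto
        moreover have "p \<in> B" using p D(4) Cons.prems(10) by blast
        ultimately show "p \<in> {b \<in> B. u * b \<in> plus_mult C' t B'}" by (auto simp: plus_mult_def)
      qed
      show "{b \<in> B. u * b \<in> plus_mult C' t B'} \<subseteq> plus_mult C t B"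
      proof
        fix p assume "p \<in> {b \<in> B. u * b \<in> plus_mult C' t B'}"
        then obtain c q where p: "p \<in> B" "u * p = c + t * q" "c \<in> C'" "q \<in> B'"
          by (auto simp: plus_mult_def)
        obtain c1 b where q: "q = c1 + u * b" "c1 \<in> C'" "b \<in> B" using B'_split[OF p(4)] by blast
        have "u * (p - t * b) = c + t * c1" using p(2) unfolding q(1) by (simp add: algebra_simps)
        then have "u * (p - t * b) \<in> C'" using C'(3)[OF p(3) C'(4)[OF t q(2)]] by simp
        then have "p - t * b \<in> C" using Cons.prems(10) B(6)[OF p(1) B(4)[OF t q(3)]] by simp
        moreover have "p = (p - t * b) + t * b" by simp
        ultimately show "p \<in> plus_mult C t B" using q(3) unfolding plus_mult_def by blast
      qed
    qed
  qed
  ultimately show ?case by simp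
qed simp

text \<open>A sequence that is weakly regular on the two ends of the exact sequence
  \<open>0 \<rightarrow> B / C \<rightarrow> A' / C \<rightarrow> A' / B \<rightarrow> 0\<close> is so on its middle.\<close>

lemma weakly_regular_extension:
  assumes "weakly_regular ts A' B" "weakly_regular ts B C" "ideal_in A'" "ideal_in B" "ideal_in C"
    and "C \<subseteq> B" "B \<subseteq> A'" "set ts \<subseteq> A"
  shows "weakly_regular ts A' C"
  using assms
proof (induction ts arbitrary: B C)
  case (Cons t ts)
  then have t: "t \<in> A" by simp
  note A' = ideal_inD[OF Cons.prems(3)] and B = ideal_inD[OF Cons.prems(4)] and C = ideal_inD[OF Cons.prems(5)]
  note tB = ideal_in_plus_mult[OF Cons.prems(3,4) t] and tC = ideal_in_plus_mult[OF Cons.prems(3,5) t]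
    and tCB = ideal_in_plus_mult[OF Cons.prems(4,5) t]
  have r1: "b \<in> B" if "b \<in> A'" "t * b \<in> B" for b using Cons.prems(1) that by simp
  have r2: "b \<in> C" if "b \<in> B" "t * b \<in> C" for b using Cons.prems(2) that by simp
  have "b \<in> C" if "b \<in> A'" "t * b \<in> C" for b
    using that r1[of b] r2[of b] Cons.prems(6) by blast
  moreover have "weakly_regular ts A' (plus_mult C t A')"
  proof (rule Cons.IH[of "plus_mult B t A'"])
    show sub: "plus_mult C t A' \<subseteq> plus_mult B t A'"
      using Cons.prems(6) by (auto simp: plus_mult_def)
    show "weakly_regular ts A' (plus_mult B t A')" using Cons.prems(1) by simp
    show "weakly_regular ts (plus_mult B t A') (plus_mult C t A')"
    proof (rule weakly_regular_transfer[of ts B "plus_mult C t B" _ _ 1])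
      show "weakly_regular ts B (plus_mult C t B)" using Cons.prems(2) by simp
      show "plus_mult B t A' = plus_mult (plus_mult C t A') 1 B"
      proof
        have "b + t * a = (0 + t * a) + 1 * b" for a b by simp
        then show "plus_mult B t A' \<subseteq> plus_mult (plus_mult C t A') 1 B"
          unfolding plus_mult_def using C(2) by blast
        show "plus_mult (plus_mult C t A') 1 B \<subseteq> plus_mult B t A'"
          using sub tB(2) ideal_inD(3)[OF tB(1)] by (auto simp: plus_mult_def[of _ 1])
      qed
      show "plus_mult C t B = {b \<in> B. 1 * b \<in> plus_mult C t A'}"
      proof
        show "plus_mult C t B \<subseteq> {b \<in> B. 1 * b \<in> plus_mult C t A'}"
        proof -
          have "plus_mult C t B \<subseteq> plus_mult C t A'"
            using Cons.prems(7) unfolding plus_mult_def by blast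
          then show ?thesis using tCB(4)[OF Cons.prems(6)] by auto
        qed
        show "{b \<in> B. 1 * b \<in> plus_mult C t A'} \<subseteq> plus_mult C t B"
        proof
          fix b assume "b \<in> {b \<in> B. 1 * b \<in> plus_mult C t A'}"
          then obtain c a where b: "b \<in> B" "b = c + t * a" "c \<in> C" "a \<in> A'"
            by (auto simp: plus_mult_def)
          have "t * a = b - c" using b by simp
          then have "a \<in> B" using r1[OF b(4)] B(6)[OF b(1)] b(3) Cons.prems(6) by auto
          then show "b \<in> plus_mult C t B" using b by (auto simp: plus_mult_def)
        qed
      qed
    qed (use Cons.prems tB tC tCB sub one_closed in auto)
  qed (use Cons.prems tB tC in auto)
  ultimately show ?case by simp
qed simp

section \<open>Prime ideals\<close>

definition prime_in :: "'r set \<Rightarrow> bool" where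
  "prime_in P \<longleftrightarrow> ideal_in P \<and> 1 \<notin> P \<and> (\<forall>a\<in>A. \<forall>b\<in>A. a * b \<in> P \<longrightarrow> a \<in> P \<or> b \<in> P)"

text \<open>Krull's theorem: by Zorn's lemma there is an ideal that is maximal among those that contain \<open>C\<close> and
  avoid the multiplicative set \<open>T\<close>, and such an ideal is prime.\<close>

lemma exists_prime_avoiding:
  assumes C: "ideal_in C" and T: "T \<subseteq> A" "1 \<in> T" "\<And>s t. s \<in> T \<Longrightarrow> t \<in> T \<Longrightarrow> s * t \<in> T"
    and CT: "C \<inter> T = {}"
  shows "\<exists>P. prime_in P \<and> C \<subseteq> P \<and> P \<inter> T = {}"
proof -
  let ?S = "{I. ideal_in I \<and> C \<subseteq> I \<and> I \<inter> T = {}}"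
  have "\<exists>M\<in>?S. \<forall>X\<in>?S. M \<subseteq> X \<longrightarrow> X = M"
  proof (rule subset_Zorn_nonempty)
    show "?S \<noteq> {}" using C CT by blast
    fix \<C> assume ne: "\<C> \<noteq> {}" and ch: "subset.chain ?S \<C>"
    have S: "ideal_in I" "C \<subseteq> I" "I \<inter> T = {}" if "I \<in> \<C>" for I
      using ch that by (auto simp: subset_chain_def)
    have lin: "I \<subseteq> J \<or> J \<subseteq> I" if "I \<in> \<C>" "J \<in> \<C>" for I J
      using ch that by (auto simp: subset_chain_def)
    have "ideal_in (\<Union>\<C>)"
      unfolding ideal_in_def
    proof (intro conjI ballI)
      have "I \<subseteq> A" "0 \<in> I" if "I \<in> \<C>" for I using S(1)[OF that] by (simp_all add: ideal_in_def)
      then show "\<Union>\<C> \<subseteq> A" "0 \<in> \<Union>\<C>" using ne by auto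
      fix p assume "p \<in> \<Union>\<C>"
      then obtain I where I: "I \<in> \<C>" "p \<in> I" by blast
      show "a * p \<in> \<Union>\<C>" if "a \<in> A" for a
        using ideal_inD(4)[OF S(1)[OF I(1)] that I(2)] I(1) by blast
      fix q assume "q \<in> \<Union>\<C>"
      then obtain J where J: "J \<in> \<C>" "q \<in> J" by blast
      from lin[OF I(1) J(1)] show "p + q \<in> \<Union>\<C>"
      proof
        assume "I \<subseteq> J"
        then have "p + q \<in> J" using ideal_inD(3)[OF S(1)[OF J(1)]] I J by blast
        then show ?thesis using J by blast
      next
        assume "J \<subseteq> I"
        then have "p + q \<in> I" using ideal_inD(3)[OF S(1)[OF I(1)]] I J by blast
        then show ?thesis using I by blast
      qed
    qed
    moreover have "C \<subseteq> \<Union>\<C>" "\<Union>\<C> \<inter> T = {}" using ne S(2,3) by blast+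
    ultimately show "\<Union>\<C> \<in> ?S" by simp
  qed
  then obtain P where "P \<in> ?S" and max': "\<forall>X\<in>?S. P \<subseteq> X \<longrightarrow> X = P" by (rule bexE)
  then have P: "ideal_in P" "C \<subseteq> P" "P \<inter> T = {}" by simp_all
  have max: "X = P" if "ideal_in X" "C \<subseteq> X" "X \<inter> T = {}" "P \<subseteq> X" for X
    using max' that by simp
  note PD = ideal_inD[OF P(1)]
  have meets: "\<exists>p\<in>P. \<exists>r\<in>A. p + a * r \<in> T" if "a \<in> A" "a \<notin> P" for a
  proof -
    note I = ideal_in_plus_mult[OF ideal_in_whole P(1) that(1)]
    have "a * 1 \<in> plus_mult P a A" by (rule I(3)[OF one_closed])
    then have "plus_mult P a A \<noteq> P" using that(2) by auto
    moreover have "C \<subseteq> plus_mult P a A" using I(2) P(2) by (rule subset_trans[rotated])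
    ultimately have "plus_mult P a A \<inter> T \<noteq> {}" using max[OF I(1) _ _ I(2)] by auto
    then show ?thesis by (auto simp: plus_mult_def)
  qed
  have "prime_in P"
    unfolding prime_in_def
  proof (intro conjI ballI impI)
    show "1 \<notin> P" using P(3) T(2) by blast
    fix a b assume ab: "a \<in> A" "b \<in> A" "a * b \<in> P"
    show "a \<in> P \<or> b \<in> P"
    proof (rule ccontr)
      assume "\<not> (a \<in> P \<or> b \<in> P)"
      then obtain p r q s where pr: "p \<in> P" "r \<in> A" "p + a * r \<in> T" and qs: "q \<in> P" "s \<in> A" "q + b * s \<in> T"
        using meets[OF ab(1)] meets[OF ab(2)] by blast
      have "(p + a * r) * (q + b * s) = (q + b * s) * p + (a * r) * q + (r * s) * (a * b)"
        by (simp add: algebra_simps)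
      also have "\<dots> \<in> P"
        using pr qs ab PD(1)
        by (intro PD(3) PD(4)[OF _ pr(1)] PD(4)[OF _ qs(1)] PD(4)[OF _ ab(3)] mult_closed add_closed) auto
      finally show False using T(3)[OF pr(3) qs(3)] P(3) by blast
    qed
  qed fact
  then show ?thesis using P by blast
qed

lemma ideal_in_annihilator:
  assumes "ideal_in B" "ideal_in C"
  shows "ideal_in {a\<in>A. \<forall>b\<in>B. a * b \<in> C}" (is "ideal_in ?I")
  unfolding ideal_in_def
proof (intro conjI ballI)
  note C = ideal_inD[OF assms(2)]
  show "0 \<in> ?I" using C(2) zero_closed by simp
  fix p assume p: "p \<in> ?I"
  show "a * p \<in> ?I" if "a \<in> A" for a
    using p that C(4)[OF that] by (auto simp: mult.assoc intro: mult_closed)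
  show "p + q \<in> ?I" if "q \<in> ?I" for q
    using p that C(3) by (auto simp: distrib_right intro: add_closed)
qed auto

text \<open>An element \<open>t\<close> that is regular on \<open>B / C\<close> lies in no minimal prime of the annihilator: for
  \<open>s\<close> outside the prime \<open>P\<close>, no \<open>s t\<^sup>n\<close> annihilates \<open>B / C\<close>.\<close>

lemma exists_smaller_prime:
  assumes B: "ideal_in B" and C: "ideal_in C" and t: "t \<in> A"
    and reg: "\<And>b. b \<in> B \<Longrightarrow> t * b \<in> C \<Longrightarrow> b \<in> C"
    and P: "prime_in P" "{a\<in>A. \<forall>b\<in>B. a * b \<in> plus_mult C t B} \<subseteq> P"
  obtains Q where "prime_in Q" "{a\<in>A. \<forall>b\<in>B. a * b \<in> C} \<subseteq> Q" "Q \<subset> P"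
proof -
  let ?I = "{a\<in>A. \<forall>b\<in>B. a * b \<in> C}" and ?T = "{s * t ^ n | s n. s \<in> A \<and> s \<notin> P}"
  note BD = ideal_inD[OF B] and CD = ideal_inD[OF C]
  have tn: "t ^ n \<in> A" for n by (induction n) (auto intro: t mult_closed one_closed)
  have regn: "b \<in> C" if "b \<in> B" "t ^ n * b \<in> C" for b n
    using that
  proof (induction n)
    case (Suc n)
    have "t ^ n * b \<in> C"
      by (rule reg) (use Suc.prems BD(4)[OF tn] in \<open>auto simp: mult.assoc\<close>)
    then show ?case using Suc by simp
  qed simp
  have idI: "ideal_in ?I" using B C by (rule ideal_in_annihilator)
  have "?I \<inter> ?T = {}"
  proof (rule ccontr)
    assume "?I \<inter> ?T \<noteq> {}"
    then obtain s n where s: "s \<in> A" "s \<notin> P" "\<forall>b\<in>B. s * t ^ n * b \<in> C" by blast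
    have "s * b \<in> C" if "b \<in> B" for b
      using regn[OF BD(4)[OF s(1) that], of n] s(3) that by (simp add: mult.left_commute mult.assoc)
    then have "s \<in> {a\<in>A. \<forall>b\<in>B. a * b \<in> plus_mult C t B}"
      using s(1) ideal_in_plus_mult(2)[OF B C t] by blast
    then show False using P(2) s(2) by blast
  qed
  moreover have "?T \<subseteq> A" using tn by (auto intro: mult_closed)
  moreover have "1 \<in> ?T"
  proof -
    have "1 * t ^ 0 \<in> ?T" using P(1) one_closed unfolding prime_in_def by blast
    then show ?thesis by simp
  qed
  moreover have "x * y \<in> ?T" if x: "x \<in> ?T" and y: "y \<in> ?T" for x y
  proof -
    from x obtain s n where x: "x = s * t ^ n" "s \<in> A" "s \<notin> P" by auto
    from y obtain r m where y: "y = r * t ^ m" "r \<in> A" "r \<notin> P" by auto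
    have "x * y = (s * r) * t ^ (n + m)" unfolding x(1) y(1) by (simp add: power_add)
    moreover have "s * r \<in> A" using x y mult_closed by simp
    moreover have "s * r \<notin> P" using x y P(1) unfolding prime_in_def by blast
    ultimately show ?thesis by blast
  qed
  ultimately have "\<exists>Q. prime_in Q \<and> ?I \<subseteq> Q \<and> Q \<inter> ?T = {}"
    by (intro exists_prime_avoiding[OF idI]) simp_all
  then obtain Q where Q: "prime_in Q" "?I \<subseteq> Q" "Q \<inter> ?T = {}" by (elim exE conjE)
  have "Q \<subseteq> P"
  proof
    fix s assume "s \<in> Q"
    then have "s \<in> A" "s = s * t ^ 0" using Q(1) by (auto simp: prime_in_def ideal_in_def)
    show "s \<in> P"
    proof (rule ccontr)
      assume "s \<notin> P"
      then have "s \<in> ?T" using \<open>s \<in> A\<close> \<open>s = s * t ^ 0\<close> by blast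
      then show False using Q(3) \<open>s \<in> Q\<close> by blast
    qed
  qed
  moreover have "t \<in> P"
    using P(2) t ideal_in_plus_mult(3)[OF B C t] by blast
  moreover have "t \<notin> Q"
  proof -
    have "1 * t ^ 1 \<in> ?T" using P(1) one_closed unfolding prime_in_def by blast
    then show ?thesis using Q(3) by auto
  qed
  ultimately show ?thesis using that Q by blast
qed

text \<open>Iterating the previous lemma, each member of a regular sequence extends a chain of primes over the
  annihilator downwards by one step. This is the inequality between depth and dimension.\<close>

lemma prime_chain_from_regular_sequence:
  assumes "weakly_regular ts B C" "plus_seq ts B C \<noteq> B"
    and "ideal_in B" "ideal_in C" "C \<subseteq> B" "set ts \<subseteq> A"
  shows "\<exists>P::nat \<Rightarrow> 'r set. (\<forall>i\<le>length ts. prime_in (P i) \<and> {a\<in>A. \<forall>b\<in>B. a * b \<in> C} \<subseteq> P i) \<and>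
    (\<forall>i<length ts. P i \<subset> P (Suc i))"
  using assms
proof (induction ts arbitrary: C)
  case Nil
  note B = ideal_inD[OF Nil.prems(3)] and C = ideal_inD[OF Nil.prems(4)]
  let ?I = "{a\<in>A. \<forall>b\<in>B. a * b \<in> C}"
  have "ideal_in ?I" using Nil.prems(3,4) by (rule ideal_in_annihilator)
  moreover have "?I \<inter> {1} = {}" using Nil.prems(2,5) by auto
  ultimately have "\<exists>P. prime_in P \<and> ?I \<subseteq> P \<and> P \<inter> {1} = {}"
    by (intro exists_prime_avoiding) (simp_all add: one_closed)
  then obtain P where "prime_in P" "?I \<subseteq> P" by (elim exE conjE)
  then show ?case by (intro exI[of _ "\<lambda>_. P"]) simp
next
  case (Cons t ts)
  then have t: "t \<in> A" by simp
  note C' = ideal_in_plus_mult[OF Cons.prems(3,4) t]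
  let ?I = "\<lambda>C. {a\<in>A. \<forall>b\<in>B. a * b \<in> C}"
  have "C \<subseteq> B" "set ts \<subseteq> A" using Cons.prems by auto
  have "\<exists>P::nat \<Rightarrow> 'r set. (\<forall>i\<le>length ts. prime_in (P i) \<and> ?I (plus_mult C t B) \<subseteq> P i) \<and>
      (\<forall>i<length ts. P i \<subset> P (Suc i))"
    by (rule Cons.IH[OF _ _ Cons.prems(3) C'(1) C'(4)[OF \<open>C \<subseteq> B\<close>] \<open>set ts \<subseteq> A\<close>])
      (use Cons.prems(1,2) in simp_all)
  then obtain P where "(\<forall>i\<le>length ts. prime_in (P i) \<and> ?I (plus_mult C t B) \<subseteq> P i) \<and>
      (\<forall>i<length ts. P i \<subset> P (Suc i))" by (rule exE)
  then have P: "\<And>i. i \<le> length ts \<Longrightarrow> prime_in (P i) \<and> ?I (plus_mult C t B) \<subseteq> P i"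
    "\<And>i. i < length ts \<Longrightarrow> P i \<subset> P (Suc i)" by simp_all
  have P0: "prime_in (P 0)" "?I (plus_mult C t B) \<subseteq> P 0" using P(1)[of 0] by auto
  have reg: "b \<in> C" if "b \<in> B" "t * b \<in> C" for b using Cons.prems(1) that by simp
  obtain Q where Q: "prime_in Q" "?I C \<subseteq> Q" "Q \<subset> P 0"
    by (rule exists_smaller_prime[OF Cons.prems(3,4) t reg P0])
  have sub: "?I C \<subseteq> ?I (plus_mult C t B)" using C'(2) by blast
  show ?case
  proof (intro exI[of _ "case_nat Q P"] conjI allI impI)
    fix i assume i: "i \<le> length (t # ts)"
    show "prime_in (case_nat Q P i)"
      using Q(1) P(1) i by (auto split: nat.split)
    show "?I C \<subseteq> case_nat Q P i"
    proof (cases i)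
      case (Suc j)
      then have "?I (plus_mult C t B) \<subseteq> P j" using P(1)[of j] i by simp
      then show ?thesis using sub Suc by auto
    qed (use Q(2) in simp)
  next
    fix i assume "i < length (t # ts)"
    then show "case_nat Q P i \<subset> case_nat Q P (Suc i)"
      using Q(3) P(2) by (cases i) auto
  qed
qed

end

section \<open>Modules presented as quotients of ideals\<close>

context subring_set
begin

definition base_ring :: "'r ring" where
  "base_ring = \<lparr>carrier = A, mult = (*), one = 1, zero = 0, add = (+)\<rparr>"

lemma base_ring_simps [simp]:
  "carrier base_ring = A" "x \<otimes>\<^bsub>base_ring\<^esub> y = x * y" "\<one>\<^bsub>base_ring\<^esub> = 1"
  "\<zero>\<^bsub>base_ring\<^esub> = 0" "x \<oplus>\<^bsub>base_ring\<^esub> y = x + y"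
  by (simp_all add: base_ring_def)

lemma cring_base_ring: "cring base_ring"
proof (rule cringI)
  show "abelian_group base_ring"
  proof (rule abelian_groupI)
    show "\<exists>y\<in>carrier base_ring. y \<oplus>\<^bsub>base_ring\<^esub> x = \<zero>\<^bsub>base_ring\<^esub>" if "x \<in> carrier base_ring" for x
      using that uminus_closed[of x] by (intro bexI[of _ "- x"]) auto
  qed (auto simp: add_closed zero_closed add.assoc add.commute)
  show "comm_monoid base_ring"
    by (rule comm_monoidI) (auto simp: mult_closed one_closed mult.assoc mult.commute)
qed (simp add: distrib_right)

lemma ideal_base_ring_iff: "ideal I base_ring \<longleftrightarrow> ideal_in I"
proof
  assume "ideal I base_ring"
  then interpret ideal I base_ring .
  have "I \<subseteq> A" using a_subset by simp
  moreover have "0 \<in> I" using additive_subgroup.zero_closed[OF is_additive_subgroup] by simp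
  moreover have "p + q \<in> I" if "p \<in> I" "q \<in> I" for p q
    using additive_subgroup.a_closed[OF is_additive_subgroup that] by simp
  moreover have "a * p \<in> I" if "a \<in> A" "p \<in> I" for a p using I_l_closed[of p a] that by simp
  ultimately show "ideal_in I" by (simp add: ideal_in_def)
next
  assume I: "ideal_in I"
  note ID = ideal_inD[OF I]
  interpret R: cring base_ring by (rule cring_base_ring)
  have inv: "\<ominus>\<^bsub>base_ring\<^esub> p = - p" if "p \<in> A" for p
    by (rule R.minus_equality) (use that uminus_closed in auto)
  have "inv\<^bsub>add_monoid base_ring\<^esub> p \<in> I" if "p \<in> I" for p
    using inv[OF ID(1)[OF that]] ID(5)[OF that] by (simp only: a_inv_def)
  then have "subgroup I (add_monoid base_ring)"
    using ID(1-3) by (intro subgroup.intro) (auto simp del: base_ring_simps simp: base_ring_simps(1,4,5))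
  moreover have "a * x \<in> I" if "a \<in> I" "x \<in> A" for a x
    using ID(4)[OF that(2,1)] by (metis mult.commute)
  ultimately show "ideal I base_ring"
    using ID(4) by (intro idealI R.ring_axioms) simp_all
qed

lemma primeideal_base_ring_iff: "primeideal P base_ring \<longleftrightarrow> prime_in P"
proof
  assume "primeideal P base_ring"
  then interpret primeideal P base_ring .
  have "ideal_in P" using is_ideal by (simp add: ideal_base_ring_iff)
  moreover have "1 \<notin> P" using one_imp_carrier I_notcarr by auto
  moreover have "a \<in> P \<or> b \<in> P" if "a \<in> A" "b \<in> A" "a * b \<in> P" for a b
    using I_prime[of a b] that by simp
  ultimately show "prime_in P" by (simp add: prime_in_def)
next
  assume "prime_in P"
  then show "primeideal P base_ring"
    using one_closed
    by (intro primeidealI cring_base_ring) (auto simp: prime_in_def ideal_base_ring_iff)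
qed

text \<open>The map \<open>\<phi>\<close> induces an isomorphism from \<open>B / C\<close> to \<open>M\<close>. Iterated quotient modules have sets of
  cosets as elements; through a presentation their properties become properties of \<open>B\<close> and \<open>C\<close>.\<close>

definition presents :: "('r \<Rightarrow> 'm) \<Rightarrow> 'r set \<Rightarrow> 'r set \<Rightarrow> ('r, 'm) module \<Rightarrow> bool" where
  "presents \<phi> B C M \<longleftrightarrow> ideal_in B \<and> ideal_in C \<and> C \<subseteq> B \<and> \<phi> ` B = carrier M \<and>
     (\<forall>p\<in>B. \<forall>q\<in>B. \<phi> (p + q) = \<phi> p \<oplus>\<^bsub>M\<^esub> \<phi> q) \<and>
     (\<forall>a\<in>A. \<forall>p\<in>B. \<phi> (a * p) = a \<odot>\<^bsub>M\<^esub> \<phi> p) \<and> (\<forall>p\<in>B. \<phi> p = \<zero>\<^bsub>M\<^esub> \<longleftrightarrow> p \<in> C)"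

context
  fixes \<phi> :: "'r \<Rightarrow> 'm" and B C and M :: "('r, 'm) module"
  assumes pres: "presents \<phi> B C M"
begin

lemma presents_ideals: "ideal_in B" "ideal_in C" "C \<subseteq> B"
  using pres by (simp_all add: presents_def)

lemma presents_carrier: "carrier M = \<phi> ` B"
  using pres by (simp add: presents_def)

lemma presents_add: "p \<in> B \<Longrightarrow> q \<in> B \<Longrightarrow> \<phi> (p + q) = \<phi> p \<oplus>\<^bsub>M\<^esub> \<phi> q"
  using pres by (simp add: presents_def)

lemma presents_smult: "a \<in> A \<Longrightarrow> p \<in> B \<Longrightarrow> \<phi> (a * p) = a \<odot>\<^bsub>M\<^esub> \<phi> p"
  using pres by (simp add: presents_def)

lemma presents_zero_iff: "p \<in> B \<Longrightarrow> \<phi> p = \<zero>\<^bsub>M\<^esub> \<longleftrightarrow> p \<in> C"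
  using pres by (simp add: presents_def)

lemma presents_zero: "\<zero>\<^bsub>M\<^esub> = \<phi> 0"
  using presents_zero_iff[of 0] ideal_inD(2)[OF presents_ideals(1)] ideal_inD(2)[OF presents_ideals(2)]
  by simp

lemma presents_eq_iff:
  assumes "p \<in> B" "q \<in> B"
  shows "\<phi> p = \<phi> q \<longleftrightarrow> p - q \<in> C"
proof -
  note BD = ideal_inD[OF presents_ideals(1)]
  have "\<phi> p = \<phi> (p - q) \<oplus>\<^bsub>M\<^esub> \<phi> q" "\<phi> q = \<phi> 0 \<oplus>\<^bsub>M\<^esub> \<phi> q" "\<phi> 0 = \<phi> q \<oplus>\<^bsub>M\<^esub> \<phi> (- q)"
    "\<phi> (p - q) = \<phi> p \<oplus>\<^bsub>M\<^esub> \<phi> (- q)"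
    using presents_add[OF BD(6)[OF assms] assms(2)] presents_add[OF BD(2) assms(2)]
      presents_add[OF assms(2) BD(5)[OF assms(2)]] presents_add[OF assms(1) BD(5)[OF assms(2)]]
    by simp_all
  then show ?thesis
    using presents_zero_iff[OF BD(6)[OF assms]] presents_zero by metis
qed

lemma presents_mem_image:
  assumes "p \<in> B" "D \<subseteq> B" "C \<subseteq> D" "ideal_in D"
  shows "\<phi> p \<in> \<phi> ` D \<longleftrightarrow> p \<in> D"
proof
  assume "\<phi> p \<in> \<phi> ` D"
  then obtain d where d: "d \<in> D" "\<phi> p = \<phi> d" by auto
  then have "p - d \<in> C" using presents_eq_iff assms by blast
  then have "(p - d) + d \<in> D" using d(1) assms(3) ideal_inD(3)[OF assms(4)] by blast
  then show "p \<in> D" by simp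
qed simp

lemma presents_abelian_group: "abelian_group M"
proof (rule abelian_groupI)
  note BD = ideal_inD[OF presents_ideals(1)]
  note [simp] = presents_carrier presents_zero
  show "x \<oplus>\<^bsub>M\<^esub> y \<in> carrier M" if "x \<in> carrier M" "y \<in> carrier M" for x y
    using that BD(3) by (auto simp: presents_add[symmetric])
  show "\<zero>\<^bsub>M\<^esub> \<in> carrier M" using BD(2) by simp
  show "(x \<oplus>\<^bsub>M\<^esub> y) \<oplus>\<^bsub>M\<^esub> z = x \<oplus>\<^bsub>M\<^esub> (y \<oplus>\<^bsub>M\<^esub> z)"
    if "x \<in> carrier M" "y \<in> carrier M" "z \<in> carrier M" for x y z
    using that BD(3) by (auto simp: presents_add[symmetric] add.assoc)
  show "x \<oplus>\<^bsub>M\<^esub> y = y \<oplus>\<^bsub>M\<^esub> x" if "x \<in> carrier M" "y \<in> carrier M" for x y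
    using that BD(3) by (auto simp: presents_add[symmetric] add.commute)
  show "\<zero>\<^bsub>M\<^esub> \<oplus>\<^bsub>M\<^esub> x = x" if "x \<in> carrier M" for x
    using that BD(2) by (auto simp: presents_add[symmetric])
  show "\<exists>y\<in>carrier M. y \<oplus>\<^bsub>M\<^esub> x = \<zero>\<^bsub>M\<^esub>" if x: "x \<in> carrier M" for x
  proof -
    obtain p where p: "x = \<phi> p" "p \<in> B" using x by auto
    have "\<phi> (- p) \<oplus>\<^bsub>M\<^esub> \<phi> p = \<phi> 0" using presents_add[OF BD(5)[OF p(2)] p(2)] by simp
    then show ?thesis using p BD(5)[OF p(2)] by auto
  qed
qed

lemma presents_finsum:
  assumes "finite I" "\<And>i. i \<in> I \<Longrightarrow> f i \<in> B"
  shows "(\<Oplus>\<^bsub>M\<^esub>i\<in>I. \<phi> (f i)) = \<phi> (\<Sum>i\<in>I. f i)"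
proof -
  interpret M: abelian_group M by (rule presents_abelian_group)
  show ?thesis
    using assms
  proof (induction I rule: finite_induct)
    case empty
    then show ?case using presents_zero by simp
  next
    case (insert i I)
    have "sum f I \<in> B" using insert.prems by (intro ideal_in_sum presents_ideals) auto
    moreover have "(\<lambda>i. \<phi> (f i)) \<in> I \<rightarrow> carrier M" "\<phi> (f i) \<in> carrier M"
      using insert.prems presents_carrier by auto
    ultimately show ?case
      using insert presents_add[of "f i" "sum f I"] by (simp add: M.finsum_insert)
  qed
qed

lemma presents_submodule:
  assumes "ideal_in D" "D \<subseteq> B"
  shows "submodule (\<phi> ` D) base_ring M"
proof -
  note DD = ideal_inD[OF assms(1)]
  interpret M: abelian_group M by (rule presents_abelian_group)
  have inv: "\<ominus>\<^bsub>M\<^esub> \<phi> p = \<phi> (- p)" if "p \<in> D" for p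
  proof (rule M.minus_equality)
    show "\<phi> (- p) \<oplus>\<^bsub>M\<^esub> \<phi> p = \<zero>\<^bsub>M\<^esub>"
      using presents_add[OF subsetD[OF assms(2) DD(5)[OF that]] subsetD[OF assms(2) that]] presents_zero
      by simp
  qed (use that DD(5) assms(2) presents_carrier in auto)
  have "subgroup (\<phi> ` D) (add_monoid M)"
  proof (rule subgroup.intro)
    show "\<phi> ` D \<subseteq> carrier (add_monoid M)" using assms(2) presents_carrier by auto
    show "x \<otimes>\<^bsub>add_monoid M\<^esub> y \<in> \<phi> ` D" if xy: "x \<in> \<phi> ` D" "y \<in> \<phi> ` D" for x y
    proof -
      obtain p q where pq: "x = \<phi> p" "p \<in> D" "y = \<phi> q" "q \<in> D" using xy by auto
      then have "x \<oplus>\<^bsub>M\<^esub> y = \<phi> (p + q)"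
        using presents_add[OF subsetD[OF assms(2) pq(2)] subsetD[OF assms(2) pq(4)]] by simp
      then show ?thesis using DD(3)[OF pq(2,4)] by simp
    qed
    show "\<one>\<^bsub>add_monoid M\<^esub> \<in> \<phi> ` D" using DD(2) presents_zero by simp
    show "inv\<^bsub>add_monoid M\<^esub> x \<in> \<phi> ` D" if "x \<in> \<phi> ` D" for x
      using that inv DD(5) by (auto simp: a_inv_def[symmetric])
  qed
  moreover have "a \<odot>\<^bsub>M\<^esub> x \<in> \<phi> ` D" if a: "a \<in> carrier base_ring" and x: "x \<in> \<phi> ` D" for a x
  proof -
    obtain p where p: "x = \<phi> p" "p \<in> D" using x by auto
    have "a \<odot>\<^bsub>M\<^esub> x = \<phi> (a * p)"
      unfolding p(1) by (rule presents_smult[symmetric]) (use a p(2) assms(2) in auto)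
    then show ?thesis using DD(4)[of a p] p a by simp
  qed
  ultimately show ?thesis by (simp add: submodule_def submodule_axioms_def)
qed

lemma presents_graded_submodule:
  assumes "ideal_in D" "D \<subseteq> B"
    and "\<And>p. p \<in> D \<Longrightarrow> \<exists>n f. (\<forall>d\<le>n. f d \<in> D \<and> \<phi> (f d) \<in> G d) \<and> p = (\<Sum>d\<le>n. f d)"
  shows "graded_submodule base_ring M G (\<phi> ` D)"
  unfolding graded_submodule_def
proof (intro conjI ballI)
  show "submodule (\<phi> ` D) base_ring M" using assms(1,2) by (rule presents_submodule)
  fix x assume "x \<in> \<phi> ` D"
  then obtain p where p: "x = \<phi> p" "p \<in> D" by auto
  obtain n f where f: "\<forall>d\<le>n. f d \<in> D \<and> \<phi> (f d) \<in> G d" "p = (\<Sum>d\<le>n. f d)"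
    using assms(3)[OF p(2)] by blast
  have "x = (\<Oplus>\<^bsub>M\<^esub>d\<in>{..n}. \<phi> (f d))"
    unfolding p(1) f(2) by (rule presents_finsum[symmetric]) (use f(1) assms(2) in auto)
  then show "\<exists>n g. (\<forall>d\<le>n. g d \<in> \<phi> ` D \<inter> G d) \<and> x = (\<Oplus>\<^bsub>M\<^esub>d\<in>{..n}. g d)"
    using f(1) by (intro exI[of _ n] exI[of _ "\<lambda>d. \<phi> (f d)"]) auto
qed

lemma presents_annihilator: "annihilator base_ring M = {a\<in>A. \<forall>b\<in>B. a * b \<in> C}"
proof -
  have "a \<odot>\<^bsub>M\<^esub> \<phi> b = \<zero>\<^bsub>M\<^esub> \<longleftrightarrow> a * b \<in> C" if "a \<in> A" "b \<in> B" for a b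
    using presents_smult[OF that] presents_zero_iff[OF ideal_inD(4)[OF presents_ideals(1) that]] by simp
  then show ?thesis unfolding annihilator_def by (auto simp: presents_carrier)
qed

lemma presents_seq_submodule:
  assumes "set ts \<subseteq> A"
  shows "seq_submodule M ts = \<phi> ` plus_seq ts B C"
proof -
  note BD = ideal_inD[OF presents_ideals(1)]
  interpret M: abelian_group M by (rule presents_abelian_group)
  have tA: "ts ! j \<in> A" if "j < length ts" for j using assms that by auto
  have sum: "(\<Oplus>\<^bsub>M\<^esub>j\<in>{..<length ts}. (ts ! j) \<odot>\<^bsub>M\<^esub> \<phi> (y j)) = \<phi> (\<Sum>j<length ts. ts ! j * y j)"
    "(\<Sum>j<length ts. ts ! j * y j) \<in> B"
    if y: "\<forall>j<length ts. y j \<in> B" for y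
  proof -
    have tB: "ts ! j * y j \<in> B" if "j < length ts" for j using BD(4)[OF tA] y that by simp
    have "(\<Oplus>\<^bsub>M\<^esub>j\<in>{..<length ts}. (ts ! j) \<odot>\<^bsub>M\<^esub> \<phi> (y j)) = (\<Oplus>\<^bsub>M\<^esub>j\<in>{..<length ts}. \<phi> (ts ! j * y j))"
      using tA y tB presents_carrier presents_smult
      by (intro M.finsum_cong') auto
    then show "(\<Oplus>\<^bsub>M\<^esub>j\<in>{..<length ts}. (ts ! j) \<odot>\<^bsub>M\<^esub> \<phi> (y j)) = \<phi> (\<Sum>j<length ts. ts ! j * y j)"
      using presents_finsum[of "{..<length ts}" "\<lambda>j. ts ! j * y j"] tB by simp
    show "(\<Sum>j<length ts. ts ! j * y j) \<in> B"
      using tB by (intro ideal_in_sum presents_ideals) auto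
  qed
  show ?thesis
  proof
    show "seq_submodule M ts \<subseteq> \<phi> ` plus_seq ts B C"
    proof
      fix x assume "x \<in> seq_submodule M ts"
      then obtain z where z: "x = (\<Oplus>\<^bsub>M\<^esub>j\<in>{..<length ts}. (ts ! j) \<odot>\<^bsub>M\<^esub> z j)"
        "z \<in> {..<length ts} \<rightarrow> carrier M" unfolding seq_submodule_def by blast
      then have "\<forall>j\<in>{..<length ts}. \<exists>y. y \<in> B \<and> z j = \<phi> y" by (auto simp: presents_carrier Pi_iff)
      then obtain y where y: "\<forall>j\<in>{..<length ts}. y j \<in> B \<and> z j = \<phi> (y j)" by (rule bchoice[THEN exE])
      then have yB: "\<forall>j<length ts. y j \<in> B" by simp
      have "x = (\<Oplus>\<^bsub>M\<^esub>j\<in>{..<length ts}. (ts ! j) \<odot>\<^bsub>M\<^esub> \<phi> (y j))"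
        unfolding z(1) using y tA yB BD(4) presents_carrier
        by (intro M.finsum_cong') (auto simp: presents_smult[symmetric])
      also have "\<dots> = \<phi> (\<Sum>j<length ts. ts ! j * y j)" by (rule sum(1)[OF yB])
      finally have "x = \<phi> (0 + (\<Sum>j<length ts. ts ! j * y j))" by simp
      then show "x \<in> \<phi> ` plus_seq ts B C"
        unfolding plus_seq_eq_sums[OF BD(2)] using yB ideal_inD(2)[OF presents_ideals(2)] by blast
    qed
    show "\<phi> ` plus_seq ts B C \<subseteq> seq_submodule M ts"
    proof
      fix x assume "x \<in> \<phi> ` plus_seq ts B C"
      then obtain c y where y: "x = \<phi> (c + (\<Sum>j<length ts. ts ! j * y j))" "c \<in> C" "\<forall>j<length ts. y j \<in> B"
        unfolding plus_seq_eq_sums[OF BD(2)] by blast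
      let ?s = "\<Sum>j<length ts. ts ! j * y j"
      have "c \<in> B" using y(2) presents_ideals(3) by blast
      then have "x = \<phi> ?s"
        unfolding y(1) using presents_eq_iff[of "c + ?s" ?s] BD(3)[OF _ sum(2)[OF y(3)]] sum(2)[OF y(3)] y(2)
        by simp
      then have "x = (\<Oplus>\<^bsub>M\<^esub>j\<in>{..<length ts}. (ts ! j) \<odot>\<^bsub>M\<^esub> \<phi> (y j))" using sum(1)[OF y(3)] by simp
      moreover have "(\<lambda>j. \<phi> (y j)) \<in> {..<length ts} \<rightarrow> carrier M" using y(3) presents_carrier by auto
      ultimately show "x \<in> seq_submodule M ts" unfolding seq_submodule_def
        by (intro CollectI exI[of _ "\<lambda>j. \<phi> (y j)"]) simp
    qed
  qed
qed

lemma presents_regular_sequence: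
  assumes "set ts \<subseteq> A"
  shows "regular_sequence M ts \<longleftrightarrow> weakly_regular ts B C \<and> plus_seq ts B C \<noteq> B"
proof -
  note BD = ideal_inD[OF presents_ideals(1)]
  have take: "set (take i ts) \<subseteq> A" for i using assms set_take_subset[of i ts] by blast
  note I = ideal_in_plus_seq[OF presents_ideals]
  have mem: "\<phi> p \<in> seq_submodule M (take i ts) \<longleftrightarrow> p \<in> plus_seq (take i ts) B C" if "p \<in> B" for p i
    unfolding presents_seq_submodule[OF take]
    by (rule presents_mem_image[OF that I(3)[OF take] I(2)[OF take] I(1)[OF take]])
  have "(\<forall>i<length ts. \<forall>x\<in>carrier M. (ts ! i) \<odot>\<^bsub>M\<^esub> x \<in> seq_submodule M (take i ts) \<longrightarrow>
      x \<in> seq_submodule M (take i ts)) \<longleftrightarrow> weakly_regular ts B C"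
    unfolding weakly_regular_nth presents_carrier
  proof (intro arg_cong[of _ _ All] ext imp_cong refl)
    fix i assume "i < length ts"
    then have t: "ts ! i \<in> A" using assms by auto
    have "(ts ! i) \<odot>\<^bsub>M\<^esub> \<phi> b \<in> seq_submodule M (take i ts) \<longleftrightarrow> ts ! i * b \<in> plus_seq (take i ts) B C"
      if "b \<in> B" for b
      using mem[OF BD(4)[OF t that]] presents_smult[OF t that] by simp
    then show "(\<forall>x\<in>\<phi> ` B. (ts ! i) \<odot>\<^bsub>M\<^esub> x \<in> seq_submodule M (take i ts) \<longrightarrow> x \<in> seq_submodule M (take i ts)) \<longleftrightarrow>
        (\<forall>b\<in>B. ts ! i * b \<in> plus_seq (take i ts) B C \<longrightarrow> b \<in> plus_seq (take i ts) B C)"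
      using mem by simp
  qed
  moreover have "seq_submodule M ts \<noteq> carrier M \<longleftrightarrow> plus_seq ts B C \<noteq> B"
  proof -
    have "b \<in> plus_seq ts B C \<longleftrightarrow> \<phi> b \<in> seq_submodule M ts" if "b \<in> B" for b
      using mem[OF that, of "length ts"] by simp
    moreover have "seq_submodule M ts \<subseteq> carrier M" "plus_seq ts B C \<subseteq> B"
      unfolding presents_seq_submodule[OF assms] presents_carrier using I(3)[OF assms] by auto
    ultimately show ?thesis unfolding presents_carrier by blast
  qed
  ultimately show ?thesis unfolding regular_sequence_def by blast
qed

text \<open>The depth is at most the dimension, by the prime chain of a regular sequence. So a module is
  Cohen-Macaulay if it has a regular sequence as long as the bound on prime chains.\<close>

lemma presents_cohen_macaulay:
  assumes G: "\<And>d. G d \<subseteq> A" and ts: "\<And>t. t \<in> set ts \<Longrightarrow> \<exists>d>0. t \<in> G d"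
    and reg: "weakly_regular ts B C" "plus_seq ts B C \<noteq> B"
    and dim: "\<And>n P. \<forall>i\<le>n. prime_in (P i) \<Longrightarrow> \<forall>i<n. P i \<subset> P (Suc i) \<Longrightarrow>
      {a\<in>A. \<forall>b\<in>B. a * b \<in> C} \<subseteq> P 0 \<Longrightarrow> n \<le> length ts"
  shows "cohen_macaulay base_ring G M" "module_dim base_ring M = enat (length ts)"
proof -
  let ?chain = "\<lambda>n (P::nat \<Rightarrow> 'r set). (\<forall>i\<le>n. primeideal (P i) base_ring \<and> annihilator base_ring M \<subseteq> P i) \<and>
      (\<forall>i<n. P i \<subset> P (Suc i))"
  have tsA: "set ts \<subseteq> A" using G ts by blast
  have "module_dim base_ring M \<le> enat (length ts)"
    unfolding module_dim_def
  proof (rule Sup_least)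
    fix x assume "x \<in> {enat n |n. \<exists>P. ?chain n P}"
    then obtain n P where nP: "x = enat n" "?chain n P" by blast
    have "n \<le> length ts"
      by (rule dim[of n P]) (use nP(2) in \<open>auto simp: primeideal_base_ring_iff presents_annihilator\<close>)
    then show "x \<le> enat (length ts)" using nP(1) by simp
  qed
  moreover have "enat (length ts) \<le> module_depth G M"
    unfolding module_depth_def
  proof (rule Sup_upper, intro CollectI exI[of _ ts] conjI ballI refl)
    show "regular_sequence M ts" using reg presents_regular_sequence[OF tsA] by simp
  qed (rule ts)
  moreover have "module_depth G M \<le> module_dim base_ring M"
    unfolding module_depth_def
  proof (rule Sup_least)
    fix x assume "x \<in> {enat (length \<theta>s) |\<theta>s. (\<forall>\<theta>\<in>set \<theta>s. \<exists>d>0. \<theta> \<in> G d) \<and> regular_sequence M \<theta>s}"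
    then obtain us where us: "x = enat (length us)" "\<forall>\<theta>\<in>set us. \<exists>d>0. \<theta> \<in> G d" "regular_sequence M us" by blast
    have usA: "set us \<subseteq> A" using us(2) G by blast
    then have "weakly_regular us B C" "plus_seq us B C \<noteq> B"
      using us(3) presents_regular_sequence by auto
    from prime_chain_from_regular_sequence[OF this presents_ideals usA]
    obtain P where "?chain (length us) P"
      unfolding presents_annihilator primeideal_base_ring_iff by (rule exE)
    then show "x \<le> module_dim base_ring M"
      unfolding module_dim_def us(1) by (intro Sup_upper) blast
  qed
  ultimately show "cohen_macaulay base_ring G M" "module_dim base_ring M = enat (length ts)"
    unfolding cohen_macaulay_def by (meson order_antisym order_trans)+
qed

text \<open>The third isomorphism theorem: the quotient of \<open>E / C\<close> by \<open>D / C\<close> is \<open>E / D\<close>.\<close>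

lemma presents_quot_module:
  assumes D: "ideal_in D" and E: "ideal_in E" and sub: "C \<subseteq> D" "D \<subseteq> E" "E \<subseteq> B"
  shows "presents (\<lambda>p. (\<phi> ` D) +>\<^bsub>M\<^esub> \<phi> p) E D (quot_module (M\<lparr>carrier := \<phi> ` E\<rparr>) (\<phi> ` D))"
proof -
  note DD = ideal_inD[OF D] and ED = ideal_inD[OF E]
  let ?Q = "quot_module (M\<lparr>carrier := \<phi> ` E\<rparr>) (\<phi> ` D)"
  let ?K = "\<lambda>p. (\<phi> ` D) +>\<^bsub>M\<^esub> \<phi> p"
  have DB: "D \<subseteq> B" and DE: "\<And>p. p \<in> D \<Longrightarrow> p \<in> E" using sub by auto
  have coset: "?K p = {\<phi> (d + p) |d. d \<in> D}" if "p \<in> E" for p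
  proof -
    have "\<phi> d \<oplus>\<^bsub>M\<^esub> \<phi> p = \<phi> (d + p)" if "d \<in> D" for d
      using presents_add[OF subsetD[OF DB that] subsetD[OF sub(3) \<open>p \<in> E\<close>]] by simp
    then have "(\<lambda>d. \<phi> d \<oplus>\<^bsub>M\<^esub> \<phi> p) ` D = (\<lambda>d. \<phi> (d + p)) ` D" by (rule image_cong[OF HOL.refl])
    moreover have "?K p = (\<lambda>d. \<phi> d \<oplus>\<^bsub>M\<^esub> \<phi> p) ` D" unfolding a_r_coset_def' by auto
    ultimately show ?thesis by (simp add: Setcompr_eq_image)
  qed
  have coset': "\<phi> ` D +>\<^bsub>M\<lparr>carrier := \<phi> ` E\<rparr>\<^esub> x = \<phi> ` D +>\<^bsub>M\<^esub> x" for x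
    by (simp add: a_r_coset_def')
  have shift: "?K (d + p) = ?K p" if "d \<in> D" "p \<in> E" for d p
  proof -
    have *: "{\<phi> (c + (d + p)) |c. c \<in> D} = {\<phi> (c + p) |c. c \<in> D}"
    proof (intro equalityI subsetI)
      fix x assume "x \<in> {\<phi> (c + (d + p)) |c. c \<in> D}"
      then obtain c where "c \<in> D" "x = \<phi> ((c + d) + p)" by (auto simp: add.assoc)
      then show "x \<in> {\<phi> (c + p) |c. c \<in> D}" using DD(3)[of c d] that(1) by blast
    next
      fix x assume "x \<in> {\<phi> (c + p) |c. c \<in> D}"
      then obtain c where "c \<in> D" "x = \<phi> ((c - d) + (d + p))" by (auto simp: algebra_simps)
      then show "x \<in> {\<phi> (c + (d + p)) |c. c \<in> D}" using DD(6)[of c d] that(1) by blast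
    qed
    show ?thesis
      unfolding coset[OF that(2)] coset[OF ED(3)[OF DE[OF that(1)] that(2)]] by (rule *)
  qed
  show ?thesis
    unfolding presents_def
  proof (intro conjI ballI)
    show "?K ` E = carrier ?Q"
      by (auto simp: quot_module_def A_RCOSETS_def' coset')
    show "?K p = \<zero>\<^bsub>?Q\<^esub> \<longleftrightarrow> p \<in> D" if "p \<in> E" for p
    proof -
      have "?K p = \<phi> ` D \<longleftrightarrow> p \<in> D"
      proof
        assume "?K p = \<phi> ` D"
        moreover have "\<phi> (0 + p) \<in> ?K p" unfolding coset[OF that] using DD(2) by blast
        ultimately have "\<phi> p \<in> \<phi> ` D" by simp
        then show "p \<in> D" using presents_mem_image[OF _ DB sub(1) D] that sub(3) by blast
      next
        assume "p \<in> D"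
        have "0 \<in> E" by (rule ED(2))
        have "?K p = ?K (p + 0)" by simp
        also have "?K (p + 0) = ?K 0" by (rule shift) fact+
        also have "\<dots> = \<phi> ` D" unfolding coset[OF \<open>0 \<in> E\<close>] by auto
        finally show "?K p = \<phi> ` D" .
      qed
      then show ?thesis by (simp add: quot_module_def)
    qed
    show "?K (p + q) = ?K p \<oplus>\<^bsub>?Q\<^esub> ?K q" if "p \<in> E" "q \<in> E" for p q
    proof -
      have add: "\<phi> (c + p) \<oplus>\<^bsub>M\<^esub> \<phi> (d + q) = \<phi> ((c + d) + (p + q))" if "c \<in> D" "d \<in> D" for c d
      proof -
        have "c + p \<in> B" "d + q \<in> B" using ED(3) DE that \<open>p \<in> E\<close> \<open>q \<in> E\<close> sub(3) by blast+
        then have "\<phi> (c + p) \<oplus>\<^bsub>M\<^esub> \<phi> (d + q) = \<phi> ((c + p) + (d + q))" using presents_add by simp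
        then show ?thesis by (simp add: algebra_simps)
      qed
      have "?K p \<oplus>\<^bsub>?Q\<^esub> ?K q = (\<Union>x\<in>?K p. \<Union>y\<in>?K q. {x \<oplus>\<^bsub>M\<^esub> y})"
        by (simp add: quot_module_def set_add_def')
      also have "\<dots> = {\<phi> (c + p) \<oplus>\<^bsub>M\<^esub> \<phi> (d + q) |c d. c \<in> D \<and> d \<in> D}"
        unfolding coset[OF that(1)] coset[OF that(2)] by blast
      also have "\<dots> = {\<phi> (c + (p + q)) |c. c \<in> D}"
      proof (intro equalityI subsetI)
        fix x assume "x \<in> {\<phi> (c + p) \<oplus>\<^bsub>M\<^esub> \<phi> (d + q) |c d. c \<in> D \<and> d \<in> D}"
        then obtain c d where "c \<in> D" "d \<in> D" "x = \<phi> ((c + d) + (p + q))" using add by blast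
        then show "x \<in> {\<phi> (c + (p + q)) |c. c \<in> D}" using DD(3) by blast
      next
        fix x assume "x \<in> {\<phi> (c + (p + q)) |c. c \<in> D}"
        then obtain c where "c \<in> D" "x = \<phi> ((c + 0) + (p + q))" by auto
        then have "x = \<phi> (c + p) \<oplus>\<^bsub>M\<^esub> \<phi> (0 + q)" using add[OF _ DD(2)] by simp
        then show "x \<in> {\<phi> (c + p) \<oplus>\<^bsub>M\<^esub> \<phi> (d + q) |c d. c \<in> D \<and> d \<in> D}"
          using \<open>c \<in> D\<close> DD(2) by blast
      qed
      finally show ?thesis unfolding coset[OF ED(3)[OF that]] by simp
    qed
    show "?K (a * p) = a \<odot>\<^bsub>?Q\<^esub> ?K p" if a: "a \<in> A" and p: "p \<in> E" for a p
    proof -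
      have "\<phi> ` D +>\<^bsub>M\<^esub> (a \<odot>\<^bsub>M\<^esub> \<phi> (d + p)) = ?K (a * p)" if "d \<in> D" for d
      proof -
        have "d + p \<in> B" using ED(3)[OF DE[OF that] p] sub(3) by blast
        then have "a \<odot>\<^bsub>M\<^esub> \<phi> (d + p) = \<phi> (a * d + a * p)"
          using presents_smult[OF a, of "d + p"] by (simp add: distrib_left)
        then show ?thesis using shift[OF DD(4)[OF a that] ED(4)[OF a p]] by simp
      qed
      then have "(\<Union>x\<in>?K p. \<phi> ` D +>\<^bsub>M\<^esub> (a \<odot>\<^bsub>M\<^esub> x)) = ?K (a * p)"
        unfolding coset[OF p] using DD(2) by blast
      then show ?thesis by (simp add: quot_module_def coset')
    qed
  qed (use D E sub in auto)
qed

end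

end

section \<open>Polynomials, homogeneous parts and ideals of faces\<close>

type_synonym ('a, 'k) polynomial = "('a \<Rightarrow>\<^sub>0 nat) \<Rightarrow>\<^sub>0 'k"

abbreviation keys :: "('b \<Rightarrow>\<^sub>0 'c::zero) \<Rightarrow> 'b set" where "keys \<equiv> Poly_Mapping.keys"
abbreviation lookup :: "('b \<Rightarrow>\<^sub>0 'c::zero) \<Rightarrow> 'b \<Rightarrow> 'c" where "lookup \<equiv> Poly_Mapping.lookup"
abbreviation single :: "'b \<Rightarrow> 'c \<Rightarrow> 'b \<Rightarrow>\<^sub>0 'c::zero" where "single \<equiv> Poly_Mapping.single"

text \<open>Serves both for homogeneous parts and for splitting a polynomial by the supports of its monomials.\<close>

definition part :: "('b \<Rightarrow> bool) \<Rightarrow> ('b \<Rightarrow>\<^sub>0 'c::zero) \<Rightarrow> 'b \<Rightarrow>\<^sub>0 'c" where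
  "part Q p = Poly_Mapping.Abs_poly_mapping (\<lambda>m. if Q m then lookup p m else 0)"

lemma lookup_part: "lookup (part Q p) m = (if Q m then lookup p m else 0)"
proof -
  have "finite {m. (if Q m then lookup p m else 0) \<noteq> 0}"
    by (rule finite_subset[OF _ finite_lookup[of p]]) auto
  then show ?thesis by (simp add: part_def)
qed

lemma keys_part: "keys (part Q p) = {m \<in> keys p. Q m}"
  by (auto simp: in_keys_iff lookup_part split: if_splits)

lemma part_add: "part Q (p + q) = part Q p + part Q q"
  by (rule poly_mapping_eqI) (simp add: lookup_part lookup_add)

lemma part_sum: "part Q (\<Sum>i\<in>I. f i) = (\<Sum>i\<in>I. part Q (f i))"
  by (rule poly_mapping_eqI) (simp add: lookup_part lookup_sum)

lemma part_split: "part Q p + part (\<lambda>m. \<not> Q m) p = p"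
  by (rule poly_mapping_eqI) (simp add: lookup_part lookup_add)

lemma part_eq_self: "(\<And>m. m \<in> keys p \<Longrightarrow> Q m) \<Longrightarrow> part Q p = p"
  by (rule poly_mapping_eqI) (auto simp: lookup_part in_keys_iff)

lemma part_eq_0: "(\<And>m. m \<in> keys p \<Longrightarrow> \<not> Q m) \<Longrightarrow> part Q p = 0"
  by (rule poly_mapping_eqI) (auto simp: lookup_part in_keys_iff)

lemma sum_monomials: "(\<Sum>m\<in>keys p. single m (lookup p m)) = p"
proof (rule poly_mapping_eqI)
  fix m
  have "lookup (\<Sum>m\<in>keys p. single m (lookup p m)) m = (\<Sum>n\<in>keys p. if n = m then lookup p n else 0)"
    by (simp add: lookup_sum lookup_single when_def)
  then show "lookup (\<Sum>m\<in>keys p. single m (lookup p m)) m = lookup p m"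
    by (auto simp: in_keys_iff)
qed

lemma keys_sum_subset: "keys (\<Sum>i\<in>I. f i) \<subseteq> (\<Union>i\<in>I. keys (f i))"
proof
  fix m assume "m \<in> keys (\<Sum>i\<in>I. f i)"
  then have "(\<Sum>i\<in>I. lookup (f i) m) \<noteq> 0" by (simp add: in_keys_iff lookup_sum)
  then obtain i where "i \<in> I" "lookup (f i) m \<noteq> 0" by (meson sum.neutral)
  then show "m \<in> (\<Union>i\<in>I. keys (f i))" by (auto simp: in_keys_iff)
qed

lemma keys_exponent_add: "keys (m + n :: 'a \<Rightarrow>\<^sub>0 nat) = keys m \<union> keys n"
  by (auto simp: in_keys_iff lookup_add)

lemma monomial_degree_sum:
  assumes "finite S" "keys m \<subseteq> S"
  shows "monomial_degree m = (\<Sum>v\<in>S. lookup m v)"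
  unfolding monomial_degree_def
  by (rule sum.mono_neutral_left) (use assms in \<open>auto simp: in_keys_iff\<close>)

lemma monomial_degree_add: "monomial_degree (m + n) = monomial_degree m + monomial_degree n"
  using monomial_degree_sum[of "keys m \<union> keys n" "m + n"]
    monomial_degree_sum[of "keys m \<union> keys n" m] monomial_degree_sum[of "keys m \<union> keys n" n]
  by (simp add: keys_exponent_add lookup_add sum.distrib)

lemma keys_multE:
  assumes "m \<in> keys (p * q)"
  obtains a b where "a \<in> keys p" "b \<in> keys q" "m = a + b"
  using keys_mult[of p q] assms by auto

lemma lookup_single_mult:
  fixes p :: "('a, 'k::field) polynomial"
  shows "lookup (single u c * p) (u + m) = c * lookup p m"
proof -
  let ?q = "part (\<lambda>n. n \<noteq> m) p"
  have "part (\<lambda>n. n = m) p = single m (lookup p m)"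
    by (rule poly_mapping_eqI) (simp add: lookup_part lookup_single when_def)
  then have "p = single m (lookup p m) + ?q"
    using part_split[of "\<lambda>n. n = m" p] by simp
  then have "single u c * p = single u c * single m (lookup p m) + single u c * ?q"
    by (metis distrib_left)
  then have "single u c * p = single (u + m) (c * lookup p m) + single u c * ?q"
    by (simp add: mult_single)
  moreover have "u + m \<notin> keys (single u c * ?q)"
    by (auto elim!: keys_multE simp: keys_part split: if_splits)
  ultimately show ?thesis by (simp add: lookup_add in_keys_iff)
qed

lemma keys_single_mult:
  fixes p :: "('a, 'k::field) polynomial"
  shows "keys (single u 1 * p) = (\<lambda>m. u + m) ` keys p"
proof
  show "keys (single u 1 * p) \<subseteq> (\<lambda>m. u + m) ` keys p"
    by (auto elim!: keys_multE split: if_splits)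
  show "(\<lambda>m. u + m) ` keys p \<subseteq> keys (single u 1 * p)"
    by (auto simp: in_keys_iff lookup_single_mult)
qed

definition polys :: "'a set \<Rightarrow> ('a, 'k::field) polynomial set" where
  "polys V = {p. \<forall>m\<in>keys p. keys m \<subseteq> V}"

text \<open>Spanned by the monomials whose support is not in \<open>\<Gamma>\<close>. It is the Stanley-Reisner ideal of \<open>\<Gamma>\<close> if \<open>\<Gamma>\<close> has
  vertex set \<open>V\<close>, the ideal of the variables outside \<open>F\<close> for \<open>\<Gamma> = Pow F\<close>, and the whole ring for
  \<open>\<Gamma> = {}\<close>.\<close>

definition face_ideal :: "'a set \<Rightarrow> 'a set set \<Rightarrow> ('a, 'k::field) polynomial set" where
  "face_ideal V \<Gamma> = {p \<in> polys V. \<forall>m\<in>keys p. keys m \<notin> \<Gamma>}"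

definition down_closed :: "'a set set \<Rightarrow> bool" where
  "down_closed \<Gamma> \<longleftrightarrow> (\<forall>\<sigma>\<in>\<Gamma>. Pow \<sigma> \<subseteq> \<Gamma>)"

interpretation polys: subring_set "polys V"
proof
  show "(1 :: ('a, 'k::field) polynomial) \<in> polys V" by (simp add: polys_def)
  fix p q :: "('a, 'k::field) polynomial"
  assume p: "p \<in> polys V"
  show "- p \<in> polys V"
    using p by (simp add: polys_def in_keys_iff)
  assume q: "q \<in> polys V"
  show "p + q \<in> polys V"
    using p q Poly_Mapping.keys_add[of p q] unfolding polys_def by blast
  show "p * q \<in> polys V"
    using p q by (fastforce simp: polys_def keys_exponent_add elim!: keys_multE)
qed

lemma single_in_polys: "keys m \<subseteq> V \<Longrightarrow> single m c \<in> polys V"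
  by (simp add: polys_def)

lemma part_in_polys: "p \<in> polys V \<Longrightarrow> part Q p \<in> polys V"
  by (simp add: polys_def keys_part)

lemma part_in_face_ideal: "p \<in> face_ideal V \<Gamma> \<Longrightarrow> part Q p \<in> face_ideal V \<Gamma>"
  by (simp add: face_ideal_def keys_part part_in_polys)

lemma ideal_in_face_ideal:
  assumes "down_closed \<Gamma>"
  shows "polys.ideal_in V (face_ideal V \<Gamma> :: ('a, 'k::field) polynomial set)"
  unfolding polys.ideal_in_def
proof (intro conjI ballI)
  show "face_ideal V \<Gamma> \<subseteq> polys V" "0 \<in> face_ideal V \<Gamma>"
    by (auto simp: face_ideal_def polys.zero_closed)
  fix p :: "('a, 'k) polynomial" assume p: "p \<in> face_ideal V \<Gamma>"
  show "p + q \<in> face_ideal V \<Gamma>" if "q \<in> face_ideal V \<Gamma>" for q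
  proof -
    have "p + q \<in> polys V" using p that by (simp add: face_ideal_def polys.add_closed)
    then show ?thesis using p that Poly_Mapping.keys_add[of p q] unfolding face_ideal_def by blast
  qed
  show "a * p \<in> face_ideal V \<Gamma>" if "a \<in> polys V" for a
  proof -
    have "keys m \<notin> \<Gamma>" if "m \<in> keys (a * p)" for m
    proof -
      obtain a' b where m: "b \<in> keys p" "m = a' + b" using \<open>m \<in> keys (a * p)\<close> by (rule keys_multE)
      then have "keys b \<notin> \<Gamma>" using p by (simp add: face_ideal_def)
      then show ?thesis using assms unfolding m(2) keys_exponent_add down_closed_def by blast
    qed
    then show ?thesis using that p by (simp add: face_ideal_def polys.mult_closed)
  qed
qed

lemma face_ideal_antimono: "\<Gamma> \<subseteq> \<Gamma>' \<Longrightarrow> face_ideal V \<Gamma>' \<subseteq> face_ideal V \<Gamma>"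
  by (auto simp: face_ideal_def)

definition squarefree_exponent :: "'a set \<Rightarrow> 'a \<Rightarrow>\<^sub>0 nat" where
  "squarefree_exponent S = (\<Sum>v\<in>S. single v 1)"

lemma lookup_squarefree_exponent:
  "finite S \<Longrightarrow> lookup (squarefree_exponent S) v = (if v \<in> S then 1 else 0)"
  by (simp add: squarefree_exponent_def lookup_sum lookup_single when_def)

lemma keys_squarefree_exponent: "finite S \<Longrightarrow> keys (squarefree_exponent S) = S"
  by (auto simp: in_keys_iff lookup_squarefree_exponent split: if_splits)

lemma monomial_degree_squarefree: "finite S \<Longrightarrow> monomial_degree (squarefree_exponent S) = card S"
  by (simp add: monomial_degree_def keys_squarefree_exponent lookup_squarefree_exponent)

lemma prod_variable:
  "finite S \<Longrightarrow> (\<Prod>v\<in>S. variable v) = (single (squarefree_exponent S) 1 :: ('a, 'k::field) polynomial)"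
proof (induction S rule: finite_induct)
  case (insert v S)
  then show ?case by (simp add: squarefree_exponent_def variable_def mult_single)
qed (simp add: squarefree_exponent_def)

lemma squarefree_divides:
  fixes p :: "('a, 'k::field) polynomial"
  assumes "finite R" "p \<in> polys V" "\<And>m. m \<in> keys p \<Longrightarrow> R \<subseteq> keys m"
  obtains q where "q \<in> polys V" "p = single (squarefree_exponent R) 1 * q"
proof -
  let ?u = "squarefree_exponent R"
  let ?q = "\<Sum>m\<in>keys p. single (m - ?u) (lookup p m)"
  have m: "?u + (m - ?u) = m" if "m \<in> keys p" for m
  proof (rule poly_mapping_eqI)
    fix v
    have "v \<in> R \<Longrightarrow> lookup m v \<ge> 1" using assms(3)[OF that] by (auto simp: in_keys_iff Suc_le_eq)
    then show "lookup (?u + (m - ?u)) v = lookup m v"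
      using assms(1) by (simp add: lookup_add lookup_minus lookup_squarefree_exponent)
  qed
  have "keys (m - ?u) \<subseteq> V" if "m \<in> keys p" for m
  proof -
    have "keys (m - ?u) \<subseteq> keys m" by (auto simp: in_keys_iff lookup_minus)
    then show ?thesis using assms(2) that by (auto simp: polys_def)
  qed
  then have "?q \<in> polys V" by (intro polys.sum_closed single_in_polys)
  moreover have "single ?u 1 * ?q = (\<Sum>m\<in>keys p. single m (lookup p m))"
    unfolding sum_distrib_left by (intro sum.cong refl) (simp add: mult_single m)
  ultimately show ?thesis using that sum_monomials[of p] by metis
qed

subsection \<open>Homogeneous elements\<close>

definition homogeneous :: "nat \<Rightarrow> ('a, 'k::field) polynomial \<Rightarrow> bool" where
  "homogeneous n p \<longleftrightarrow> (\<forall>m\<in>keys p. monomial_degree m = n)"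

abbreviation hpart :: "nat \<Rightarrow> ('a, 'k::field) polynomial \<Rightarrow> ('a, 'k) polynomial" where
  "hpart n \<equiv> part (\<lambda>m. monomial_degree m = n)"

definition graded :: "('a, 'k::field) polynomial set \<Rightarrow> bool" where
  "graded C \<longleftrightarrow> (\<forall>p\<in>C. \<forall>n. hpart n p \<in> C)"

lemma homogeneous_hpart: "homogeneous n (hpart n p)"
  by (simp add: homogeneous_def keys_part)

lemma hpart_homogeneous: "homogeneous n p \<Longrightarrow> hpart n p = p"
  by (simp add: homogeneous_def part_eq_self)

lemma homogeneous_mult: "homogeneous k t \<Longrightarrow> homogeneous n p \<Longrightarrow> homogeneous (k + n) (t * p)"
  by (auto simp: homogeneous_def monomial_degree_add elim!: keys_multE)

lemma hpart_mult:
  assumes "homogeneous k t"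
  shows "hpart (k + n) (t * p) = t * hpart n p" "i < k \<Longrightarrow> hpart i (t * p) = 0"
proof -
  let ?q = "part (\<lambda>m. monomial_degree m \<noteq> n) p"
  have "t * p = t * hpart n p + t * ?q"
    by (metis distrib_left part_split)
  then have "hpart (k + n) (t * p) = hpart (k + n) (t * hpart n p) + hpart (k + n) (t * ?q)"
    by (simp add: part_add)
  moreover have "hpart (k + n) (t * hpart n p) = t * hpart n p"
    using assms by (intro hpart_homogeneous homogeneous_mult homogeneous_hpart)
  moreover have "hpart (k + n) (t * ?q) = 0"
    using assms
    by (intro part_eq_0) (auto simp: homogeneous_def monomial_degree_add keys_part elim!: keys_multE)
  ultimately show "hpart (k + n) (t * p) = t * hpart n p" by simp
  show "hpart i (t * p) = 0" if "i < k"
    using assms that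
    by (intro part_eq_0) (auto simp: homogeneous_def monomial_degree_add elim!: keys_multE)
qed

lemma sum_hparts:
  obtains N where "p = (\<Sum>n\<le>N. hpart n p)"
proof
  let ?N = "Max (monomial_degree ` keys p)"
  show "p = (\<Sum>n\<le>?N. hpart n p)"
  proof (rule poly_mapping_eqI)
    fix m
    have "lookup p m = 0" if "\<not> monomial_degree m \<le> ?N"
    proof (rule ccontr)
      assume "lookup p m \<noteq> 0"
      then have "monomial_degree m \<le> ?N" by (intro Max_ge) (auto simp: in_keys_iff)
      then show False using that by simp
    qed
    then show "lookup p m = lookup (\<Sum>n\<le>?N. hpart n p) m"
      by (simp add: lookup_sum lookup_part)
  qed
qed

lemma graded_face_ideal: "graded (face_ideal V \<Gamma>)"
  by (simp add: graded_def part_in_face_ideal)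

lemma graded_plus_mult:
  assumes "graded C" "0 \<in> C" "homogeneous k t"
  shows "graded (plus_mult C t (polys V))"
  unfolding graded_def
proof (intro ballI allI)
  fix p n assume "p \<in> plus_mult C t (polys V)"
  then obtain c b where p: "p = c + t * b" "c \<in> C" "b \<in> polys V" by (auto simp: plus_mult_def)
  have c: "hpart n c \<in> C" using assms(1) p(2) by (simp add: graded_def)
  show "hpart n p \<in> plus_mult C t (polys V)"
  proof (cases "n < k")
    case True
    then have "hpart n p = hpart n c + t * 0"
      unfolding p(1) part_add hpart_mult(2)[OF assms(3) True] by simp
    then show ?thesis using c polys.zero_closed unfolding plus_mult_def by blast
  next
    case False
    then have "hpart n p = hpart n c + t * hpart (n - k) b"
      unfolding p(1) part_add using hpart_mult(1)[OF assms(3), of "n - k" b] by simp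
    then show ?thesis using c part_in_polys[OF p(3)] unfolding plus_mult_def by blast
  qed
qed

text \<open>A graded form of the fact that regular sequences can be permuted. An element \<open>p\<close> with
  \<open>t p \<in> C\<close> is divisible by \<open>x\<close> modulo \<open>C\<close>, and the quotient has the same property but smaller degree.\<close>

lemma regular_if_regular_modulo:
  assumes C: "polys.ideal_in V C" "graded C" and x: "x \<in> polys V" "homogeneous 1 x"
    and t: "t \<in> polys V" "homogeneous k t"
    and regx: "\<And>p. p \<in> polys V \<Longrightarrow> x * p \<in> C \<Longrightarrow> p \<in> C"
    and regt: "\<And>p. p \<in> polys V \<Longrightarrow> t * p \<in> plus_mult C x (polys V) \<Longrightarrow> p \<in> plus_mult C x (polys V)"
    and p: "p \<in> polys V" "t * p \<in> C"
  shows "p \<in> C"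
proof -
  note CD = polys.ideal_inD[OF C(1)]
  note Cx = polys.ideal_in_plus_mult[OF polys.ideal_in_whole C(1) x(1)]
  have hom: "q \<in> C" if "q \<in> polys V" "homogeneous n q" "t * q \<in> C" for q n
    using that
  proof (induction n arbitrary: q)
    case 0
    have "q \<in> plus_mult C x (polys V)" using regt Cx(2) 0 by blast
    then obtain c b where cb: "q = c + x * b" "c \<in> C" by (auto simp: plus_mult_def)
    have "q = hpart 0 q" using 0 by (simp add: hpart_homogeneous)
    also have "\<dots> = hpart 0 c" unfolding cb(1) part_add hpart_mult(2)[OF x(2) zero_less_one] by simp
    finally show ?case using C(2) cb(2) by (simp add: graded_def)
  next
    case (Suc n)
    have "q \<in> plus_mult C x (polys V)" using regt Cx(2) Suc.prems by blast
    then obtain c b where cb: "q = c + x * b" "c \<in> C" "b \<in> polys V" by (auto simp: plus_mult_def)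
    let ?c = "hpart (Suc n) c" and ?b = "hpart n b"
    have "q = hpart (Suc n) q" using Suc.prems by (simp add: hpart_homogeneous)
    also have "\<dots> = ?c + x * ?b"
      unfolding cb(1) part_add using hpart_mult(1)[OF x(2), of n b] by simp
    finally have q: "q = ?c + x * ?b" .
    have c: "?c \<in> C" using C(2) cb(2) by (simp add: graded_def)
    have b: "?b \<in> polys V" using cb(3) by (rule part_in_polys)
    have "x * (t * ?b) = t * q - t * ?c" using q by (simp add: algebra_simps)
    also have "\<dots> \<in> C" using CD(6)[OF Suc.prems(3) CD(4)[OF t(1) c]] .
    finally have "t * ?b \<in> C" using regx polys.mult_closed[OF t(1) b] by blast
    then have "?b \<in> C" using Suc.IH[OF b homogeneous_hpart] by blast
    then show ?case using q CD(3)[OF c CD(4)[OF x(1)]] by metis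
  qed
  obtain N where N: "p = (\<Sum>n\<le>N. hpart n p)" by (rule sum_hparts)
  have "hpart n p \<in> C" for n
  proof (rule hom[OF part_in_polys[OF p(1)] homogeneous_hpart])
    have "hpart (k + n) (t * p) \<in> C" using C(2) p(2) by (simp add: graded_def)
    then show "t * hpart n p \<in> C" unfolding hpart_mult(1)[OF t(2)] .
  qed
  then have "(\<Sum>n\<le>N. hpart n p) \<in> C" by (intro polys.ideal_in_sum[OF C(1)])
  then show ?thesis using N by simp
qed

text \<open>Moving \<open>x\<close> from the front of a regular sequence to its end, one transposition at a time.\<close>

lemma weakly_regular_if_modulo:
  assumes "polys.ideal_in V C" "graded C" and x: "x \<in> polys V" "homogeneous 1 x"
    and ts: "\<And>t. t \<in> set ts \<Longrightarrow> t \<in> polys V \<and> (\<exists>k. homogeneous k t)"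
    and "\<And>p. p \<in> polys V \<Longrightarrow> x * p \<in> C \<Longrightarrow> p \<in> C"
    and "weakly_regular ts (polys V) (plus_mult C x (polys V))"
  shows "weakly_regular ts (polys V) C \<and>
    (\<forall>p\<in>polys V. x * p \<in> plus_seq ts (polys V) C \<longrightarrow> p \<in> plus_seq ts (polys V) C)"
  using assms
proof (induction ts arbitrary: C)
  case (Cons t ts)
  obtain k where t: "t \<in> polys V" "homogeneous k t" using Cons.prems(5)[of t] by auto
  note C = polys.ideal_inD[OF Cons.prems(1)]
  note Ct = polys.ideal_in_plus_mult[OF polys.ideal_in_whole Cons.prems(1) t(1)]
  note Cx = polys.ideal_in_plus_mult[OF polys.ideal_in_whole Cons.prems(1) x(1)]
  have regt: "p \<in> plus_mult C x (polys V)" if "p \<in> polys V" "t * p \<in> plus_mult C x (polys V)" for p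
    using Cons.prems(7) that by simp
  have 1: "p \<in> C" if "p \<in> polys V" "t * p \<in> C" for p
    using regular_if_regular_modulo[OF Cons.prems(1-4) t Cons.prems(6) regt that] .
  have "weakly_regular ts (polys V) (plus_mult C t (polys V)) \<and>
    (\<forall>p\<in>polys V. x * p \<in> plus_seq ts (polys V) (plus_mult C t (polys V)) \<longrightarrow>
       p \<in> plus_seq ts (polys V) (plus_mult C t (polys V)))"
  proof (rule Cons.IH[OF Ct(1) _ x])
    show "graded (plus_mult C t (polys V))"
      using Cons.prems(2) C(2) t(2) by (rule graded_plus_mult)
    show "s \<in> polys V \<and> (\<exists>k. homogeneous k s)" if "s \<in> set ts" for s
      using Cons.prems(5) that by simp
    show "p \<in> plus_mult C t (polys V)" if p: "p \<in> polys V" "x * p \<in> plus_mult C t (polys V)" for p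
    proof -
      obtain c q where cq: "x * p = c + t * q" "c \<in> C" "q \<in> polys V"
        using p(2) by (auto simp: plus_mult_def)
      have "t * q = (- c) + x * p" using cq(1) by simp
      then have "t * q \<in> plus_mult C x (polys V)" using C(5)[OF cq(2)] p(1) unfolding plus_mult_def by blast
      then obtain c' b where b: "q = c' + x * b" "c' \<in> C" "b \<in> polys V"
        using regt[OF cq(3)] by (auto simp: plus_mult_def)
      have "x * (p - t * b) = c + t * c'" using cq(1) unfolding b(1) by (simp add: algebra_simps)
      also have "\<dots> \<in> C" using C(3)[OF cq(2) C(4)[OF t(1) b(2)]] .
      finally have "p - t * b \<in> C"
        using Cons.prems(6) polys.ideal_inD(6)[OF polys.ideal_in_whole p(1) polys.mult_closed[OF t(1) b(3)]]
        by blast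
      moreover have "p = (p - t * b) + t * b" by simp
      ultimately show ?thesis using b(3) unfolding plus_mult_def by blast
    qed
    have "plus_mult (plus_mult C t (polys V)) x (polys V) = plus_mult (plus_mult C x (polys V)) t (polys V)"
      (is "?l = ?r")
    proof -
      have "(c + t * a) + x * b = (c + x * b) + t * a" for c a b by (simp add: algebra_simps)
      then show ?thesis unfolding plus_mult_def by (auto, metis+)
    qed
    then show "weakly_regular ts (polys V) (plus_mult (plus_mult C t (polys V)) x (polys V))"
      using Cons.prems(7) by simp
  qed
  then show ?case using 1 by simp
qed auto

text \<open>Nakayama's lemma: an element of \<open>B\<close> outside \<open>C\<close> of least degree is no combination of the
  elements of positive degree in \<open>ts\<close> modulo \<open>C\<close>.\<close>

lemma graded_Nakayama:
  assumes B: "polys.ideal_in V B" "graded B" and C: "polys.ideal_in V C" "graded C"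
    and "C \<subset> B" and ts: "\<And>t. t \<in> set ts \<Longrightarrow> t \<in> polys V \<and> (\<exists>k>0. homogeneous k t)"
  shows "plus_seq ts B C \<noteq> B"
proof
  assume eq: "plus_seq ts B C = B"
  note CD = polys.ideal_inD[OF C(1)] and BD = polys.ideal_inD[OF B(1)]
  let ?P = "\<lambda>n. \<exists>p\<in>B - C. homogeneous n p"
  obtain p where p: "p \<in> B" "p \<notin> C" using \<open>C \<subset> B\<close> by blast
  obtain N where N: "p = (\<Sum>n\<le>N. hpart n p)" by (rule sum_hparts)
  have "\<not> (\<forall>n. hpart n p \<in> C)"
    using polys.ideal_in_sum[OF C(1), of "{..N}" "\<lambda>n. hpart n p"] N p(2) by auto
  then obtain i where "hpart i p \<notin> C" by blast
  moreover have "hpart i p \<in> B" using B(2) p(1) by (simp add: graded_def)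
  ultimately have "\<exists>n. ?P n" using homogeneous_hpart[of i p] by blast
  then obtain n where n: "?P n" and least: "\<And>i. i < n \<Longrightarrow> \<not> ?P i"
    using exists_least_iff[of ?P] by auto
  then obtain q where q: "q \<in> B" "q \<notin> C" "homogeneous n q" by blast
  have "q \<in> plus_seq ts B C" using eq q by simp
  then obtain c y where cy: "q = c + (\<Sum>j<length ts. ts ! j * y j)" "c \<in> C" "\<forall>j<length ts. y j \<in> B"
    unfolding plus_seq_eq_sums[OF BD(2)] by blast
  have "q = hpart n q" using q(3) by (simp add: hpart_homogeneous)
  also have "\<dots> = hpart n c + (\<Sum>j<length ts. hpart n (ts ! j * y j))"
    unfolding cy(1) part_add part_sum by simp
  also have "\<dots> \<in> C"
  proof (intro CD(3) polys.ideal_in_sum[OF C(1)])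
    show "hpart n c \<in> C" using C(2) cy(2) by (simp add: graded_def)
    fix j assume "j \<in> {..<length ts}"
    then have j: "ts ! j \<in> set ts" "y j \<in> B" using cy(3) by auto
    then obtain k where k: "k > 0" "homogeneous k (ts ! j)" "ts ! j \<in> polys V" using ts by blast
    show "hpart n (ts ! j * y j) \<in> C"
    proof (cases "n < k")
      case True
      then show ?thesis using hpart_mult(2)[OF k(2) True] CD(2) by simp
    next
      case False
      then have "hpart n (ts ! j * y j) = ts ! j * hpart (n - k) (y j)"
        using hpart_mult(1)[OF k(2), of "n - k" "y j"] by simp
      moreover have "hpart (n - k) (y j) \<in> C"
      proof -
        have "n - k < n" using k(1) False by simp
        then have "\<not> ?P (n - k)" by (rule least)
        moreover have "hpart (n - k) (y j) \<in> B" using B(2) j(2) by (simp add: graded_def)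
        ultimately show ?thesis using homogeneous_hpart[of "n - k" "y j"] by blast
      qed
      ultimately show ?thesis using CD(4)[OF k(3)] by simp
    qed
  qed
  finally show False using q(2) by simp
qed

section \<open>Elementary symmetric polynomials as a regular sequence\<close>

definition esym :: "'a set \<Rightarrow> nat \<Rightarrow> ('a, 'k::field) polynomial" where
  "esym V j = (\<Sum>S | S \<subseteq> V \<and> card S = j. single (squarefree_exponent S) 1)"

lemma esym_in_polys: "finite V \<Longrightarrow> esym V j \<in> polys V"
  unfolding esym_def
  by (intro polys.sum_closed single_in_polys) (auto simp: keys_squarefree_exponent finite_subset)

lemma homogeneous_esym:
  assumes "finite V"
  shows "homogeneous j (esym V j :: ('a, 'k::field) polynomial)"
  unfolding homogeneous_def
proof
  fix m assume "m \<in> keys (esym V j :: ('a, 'k) polynomial)"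
  then have "m \<in> (\<Union>S\<in>{S. S \<subseteq> V \<and> card S = j}. keys (single (squarefree_exponent S) (1::'k)))"
    unfolding esym_def by (rule subsetD[OF keys_sum_subset])
  then obtain S where "S \<subseteq> V" "card S = j" "m = squarefree_exponent S" by auto
  then show "monomial_degree m = j" using assms finite_subset monomial_degree_squarefree by metis
qed

lemma down_closed_Pow: "down_closed (Pow F)"
  by (auto simp: down_closed_def)

lemma variable_regular:
  fixes p :: "('a, 'k::field) polynomial"
  assumes "v \<in> F" "p \<in> polys V" "variable v * p \<in> face_ideal V (Pow F)"
  shows "p \<in> face_ideal V (Pow F)"
proof -
  have "\<not> keys m \<subseteq> F" if "m \<in> keys p" for m
  proof -
    have "single v 1 + m \<in> keys (variable v * p)"
      using that unfolding variable_def keys_single_mult by (rule imageI)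
    then have "\<not> keys (single v (1::nat) + m) \<subseteq> F"
      using assms(3) unfolding face_ideal_def by blast
    then show ?thesis using assms(1) by (simp add: keys_exponent_add)
  qed
  then show ?thesis using assms(2) by (simp add: face_ideal_def)
qed

lemma face_ideal_remove_vertex:
  assumes "v \<in> F" "v \<in> V"
  shows "(face_ideal V (Pow (F - {v})) :: ('a, 'k::field) polynomial set) =
    plus_mult (face_ideal V (Pow F)) (variable v) (polys V)" (is "?l = ?r")
proof
  have "polys.ideal_in V ?l" by (intro ideal_in_face_ideal down_closed_Pow)
  note I = polys.ideal_inD[OF this]
  show "?l \<subseteq> ?r"
  proof
    fix p :: "('a, 'k) polynomial" assume p: "p \<in> ?l"
    let ?a = "part (\<lambda>m. \<not> keys m \<subseteq> F) p" and ?b = "part (\<lambda>m. \<not> \<not> keys m \<subseteq> F) p"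
    have pV: "p \<in> polys V" using p by (simp add: face_ideal_def)
    have "{v} \<subseteq> keys m" if "m \<in> keys ?b" for m
      using that p by (auto simp: keys_part face_ideal_def)
    then obtain q where q: "q \<in> polys V" "?b = single (squarefree_exponent {v}) 1 * q"
      using squarefree_divides[of "{v}" ?b V] part_in_polys[OF pV] by blast
    have "?b = variable v * q"
      using q(2) by (simp add: squarefree_exponent_def variable_def)
    then have "p = ?a + variable v * q" using part_split[of "\<lambda>m. \<not> keys m \<subseteq> F" p] by simp
    moreover have "?a \<in> face_ideal V (Pow F)"
      using part_in_polys[OF pV] by (auto simp: face_ideal_def keys_part)
    ultimately show "p \<in> ?r" using q(1) unfolding plus_mult_def by blast
  qed
  have x: "variable v \<in> ?l"
    using assms by (auto simp: variable_def face_ideal_def intro!: single_in_polys)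
  show "?r \<subseteq> ?l"
  proof
    fix p :: "('a, 'k) polynomial" assume "p \<in> ?r"
    then obtain c b where p: "p = c + variable v * b" "c \<in> face_ideal V (Pow F)" "b \<in> polys V"
      by (auto simp: plus_mult_def)
    have "c \<in> ?l" using p(2) face_ideal_antimono[of "Pow (F - {v})" "Pow F" V] by auto
    moreover have "b * variable v \<in> ?l" by (rule I(4)[OF p(3) x])
    ultimately show "p \<in> ?l" unfolding p(1) using I(3) by (simp add: mult.commute)
  qed
qed

text \<open>Induction on \<open>F\<close>. Modulo the variable of a vertex \<open>v\<close> of \<open>F\<close> the induction hypothesis applies to
  all but the last polynomial. As regular sequences can be permuted, each variable of \<open>F\<close> is regular
  modulo these polynomials, and so is the last one, which is the product of the variables of \<open>F\<close>
  modulo the ideal of \<open>F\<close>.\<close>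

lemma esym_weakly_regular_simplex:
  assumes "finite V" "F \<subseteq> V"
  shows "weakly_regular (map (esym V) [1..<Suc (card F)]) (polys V)
    (face_ideal V (Pow F) :: ('a, 'k::field) polynomial set)"
  using assms(2)
proof (induction "card F" arbitrary: F)
  case 0
  then show ?case by simp
next
  case (Suc d)
  let ?A = "polys V :: ('a, 'k) polynomial set" and ?P = "face_ideal V (Pow F) :: ('a, 'k) polynomial set"
  let ?es = "map (esym V) [1..<Suc d] :: ('a, 'k) polynomial list"
  have finF: "finite F" "F \<noteq> {}"
    using finite_subset[OF Suc.prems assms(1)] Suc.hyps(2) by auto
  have idP: "polys.ideal_in V ?P" by (intro ideal_in_face_ideal down_closed_Pow)
  have step: "weakly_regular ?es ?A ?P \<and>
      (\<forall>p\<in>?A. variable v * p \<in> plus_seq ?es ?A ?P \<longrightarrow> p \<in> plus_seq ?es ?A ?P)" if v: "v \<in> F" for v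
  proof (rule weakly_regular_if_modulo[OF idP graded_face_ideal])
    show "variable v \<in> ?A" using v Suc.prems by (auto simp: variable_def intro!: single_in_polys)
    show "homogeneous 1 (variable v :: ('a, 'k) polynomial)"
      by (simp add: homogeneous_def variable_def monomial_degree_def)
    show "t \<in> ?A \<and> (\<exists>k. homogeneous k t)" if "t \<in> set ?es" for t
      using that homogeneous_esym[OF assms(1)] esym_in_polys[OF assms(1)] by auto
    show "p \<in> ?P" if "p \<in> ?A" "variable v * p \<in> ?P" for p
      using v that by (rule variable_regular)
    have "d = card (F - {v})" using Suc.hyps(2) v finF by simp
    moreover have "F - {v} \<subseteq> V" using Suc.prems by auto
    ultimately have "weakly_regular (map (esym V) [1..<Suc (card (F - {v}))]) ?A
        (face_ideal V (Pow (F - {v})) :: ('a, 'k) polynomial set)" by (rule Suc.hyps(1))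
    moreover have "v \<in> V" using v Suc.prems by auto
    ultimately show "weakly_regular ?es ?A (plus_mult ?P (variable v) ?A)"
      using face_ideal_remove_vertex[OF v, where 'k = 'k] \<open>d = card (F - {v})\<close> by simp
  qed
  let ?Q = "plus_seq ?es ?A ?P"
  have Q: "polys.ideal_in V ?Q" "?P \<subseteq> ?Q"
  proof -
    have "?P \<subseteq> ?A" "set ?es \<subseteq> ?A"
      using esym_in_polys[OF assms(1)] by (auto simp: face_ideal_def)
    note * = polys.ideal_in_plus_seq[OF polys.ideal_in_whole idP this]
    then show "polys.ideal_in V ?Q" "?P \<subseteq> ?Q" by auto
  qed
  have prod: "p \<in> ?Q" if "finite S" "S \<subseteq> F" "p \<in> ?A" "(\<Prod>v\<in>S. variable v) * p \<in> ?Q" for S p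
    using that
  proof (induction S rule: finite_induct)
    case (insert v S)
    let ?m = "(\<Prod>v\<in>S. variable v) :: ('a, 'k) polynomial"
    have "?m * p \<in> ?A"
      using insert.prems Suc.prems
      by (intro polys.mult_closed polys.prod_closed) (auto simp: variable_def intro!: single_in_polys)
    moreover have "variable v * (?m * p) \<in> ?Q"
      using insert by (simp add: mult.assoc)
    ultimately have "?m * p \<in> ?Q" using step[of v] insert.prems by auto
    then show ?case using insert by auto
  qed simp
  have "p \<in> ?Q" if p: "p \<in> ?A" "esym V (Suc d) * p \<in> ?Q" for p
  proof (rule prod[OF finF(1) order_refl p(1)])
    \<comment> \<open>No other set of \<open>d + 1\<close> vertices is contained in \<open>F\<close>, so the other terms vanish modulo \<open>?P\<close>.\<close>
    let ?rest = "\<Sum>S | S \<subseteq> V \<and> card S = Suc d \<and> S \<noteq> F. single (squarefree_exponent S) (1::'k)"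
    have split: "{S. S \<subseteq> V \<and> card S = Suc d} = insert F {S. S \<subseteq> V \<and> card S = Suc d \<and> S \<noteq> F}"
      using Suc.prems Suc.hyps(2) by auto
    have "finite {S. S \<subseteq> V \<and> card S = Suc d \<and> S \<noteq> F}"
      by (rule finite_subset[of _ "Pow V"]) (use assms(1) in auto)
    then have es: "esym V (Suc d) = (\<Prod>v\<in>F. variable v) + ?rest"
      unfolding esym_def split prod_variable[OF finF(1)] by (subst sum.insert) auto
    have "single (squarefree_exponent S) (1::'k) \<in> ?P" if "S \<subseteq> V" "card S = Suc d" "S \<noteq> F" for S
    proof -
      have "finite S" using that(1) assms(1) by (rule finite_subset)
      moreover have "\<not> S \<subseteq> F"
        using that(2,3) Suc.hyps(2) card_subset_eq[OF finF(1)] by metis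
      ultimately show ?thesis
        using that(1) by (auto simp: face_ideal_def keys_squarefree_exponent intro!: single_in_polys)
    qed
    then have "?rest \<in> ?P" by (intro polys.ideal_in_sum[OF idP]) auto
    then have "p * ?rest \<in> ?Q" using polys.ideal_inD(4)[OF Q(1) p(1)] Q(2) by blast
    then have "esym V (Suc d) * p - p * ?rest \<in> ?Q" using polys.ideal_inD(6)[OF Q(1) p(2)] by blast
    then show "(\<Prod>v\<in>F. variable v) * p \<in> ?Q" unfolding es by (simp add: algebra_simps)
  qed
  moreover have "weakly_regular ?es ?A ?P" using step finF(2) by blast
  moreover have "map (esym V) [1..<Suc (card F)] = ?es @ [esym V (Suc d)]"
    using Suc.hyps(2)[symmetric] by simp
  ultimately show ?case by (simp only: weakly_regular_snoc) blast
qed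

lemma weakly_regular_trivial: "B \<subseteq> C \<Longrightarrow> 0 \<in> B \<Longrightarrow> weakly_regular ts B C"
proof (induction ts arbitrary: C)
  case (Cons t ts)
  have "c + t * 0 \<in> plus_mult C t B" if "c \<in> C" for c
    using that Cons.prems(2) unfolding plus_mult_def by blast
  then have "B \<subseteq> plus_mult C t B" using Cons.prems(1) by auto
  then show ?case using Cons by auto
qed simp

lemma attach_down_closed: "attach i \<Gamma> \<Gamma>' \<Longrightarrow> down_closed \<Gamma> \<Longrightarrow> down_closed \<Gamma>'"
proof (induction rule: attach.induct)
  case (add \<Gamma>' F R)
  then have "down_closed \<Gamma>'" by simp
  then show ?case unfolding down_closed_def by blast
qed

text \<open>A monomial outside \<open>\<Gamma>\<close> either is supported outside \<open>\<Gamma> \<union> Pow F\<close>, or its support lies between \<open>R\<close> and \<open>F\<close>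
  and it is divisible by the monomial \<open>u\<close> of \<open>R\<close>. So \<open>u\<close> generates the quotient of the two ideals, and
  its annihilator consists of the polynomials without monomials in the variables of \<open>F\<close>.\<close>

lemma face_ideal_attached_face:
  fixes \<Gamma> :: "'a set set"
  assumes "down_closed \<Gamma>" "finite R" "R \<subseteq> F" "F \<subseteq> V" and new: "\<And>\<sigma>. \<sigma> \<subseteq> F \<Longrightarrow> \<sigma> \<in> \<Gamma> \<longleftrightarrow> \<not> R \<subseteq> \<sigma>"
  defines "u \<equiv> single (squarefree_exponent R) 1 :: ('a, 'k::field) polynomial"
  shows "face_ideal V \<Gamma> = plus_mult (face_ideal V (\<Gamma> \<union> Pow F)) u (polys V)"
    and "face_ideal V (Pow F) = {p \<in> polys V. u * p \<in> face_ideal V (\<Gamma> \<union> Pow F)}"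
proof -
  let ?J = "face_ideal V \<Gamma> :: ('a, 'k) polynomial set"
  let ?J' = "face_ideal V (\<Gamma> \<union> Pow F) :: ('a, 'k) polynomial set"
  have J: "polys.ideal_in V ?J" using assms(1) by (rule ideal_in_face_ideal)
  note JD = polys.ideal_inD[OF J]
  have u: "u \<in> ?J"
    using new[of R] assms(2-4)
    by (auto simp: u_def face_ideal_def keys_squarefree_exponent intro!: single_in_polys)
  have J'J: "?J' \<subseteq> ?J" by (rule face_ideal_antimono) simp
  show "?J = plus_mult ?J' u (polys V)"
  proof
    show "?J \<subseteq> plus_mult ?J' u (polys V)"
    proof
      fix p assume p: "p \<in> ?J"
      let ?a = "part (\<lambda>m. \<not> keys m \<subseteq> F) p" and ?b = "part (\<lambda>m. \<not> \<not> keys m \<subseteq> F) p"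
      have "R \<subseteq> keys m" if "m \<in> keys ?b" for m
        using that p new[of "keys m"] by (auto simp: keys_part face_ideal_def)
      moreover have pV: "p \<in> polys V" using p by (simp add: face_ideal_def)
      ultimately obtain q where q: "q \<in> polys V" "?b = u * q"
        unfolding u_def using squarefree_divides[OF assms(2), of ?b V] part_in_polys[OF pV] by blast
      have "p = ?a + u * q" using part_split[of "\<lambda>m. \<not> keys m \<subseteq> F" p] q(2) by simp
      moreover have "?a \<in> ?J'" using p part_in_polys[OF pV] by (auto simp: face_ideal_def keys_part)
      ultimately show "p \<in> plus_mult ?J' u (polys V)" using q(1) unfolding plus_mult_def by blast
    qed
    show "plus_mult ?J' u (polys V) \<subseteq> ?J"
    proof
      fix p assume "p \<in> plus_mult ?J' u (polys V)"
      then obtain c b where p: "p = c + u * b" "c \<in> ?J'" "b \<in> polys V" by (auto simp: plus_mult_def)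
      then show "p \<in> ?J" using JD(3)[of c "b * u"] JD(4)[OF p(3) u] J'J by (auto simp: mult.commute)
    qed
  qed
  show "face_ideal V (Pow F) = {p \<in> polys V. u * p \<in> ?J'}"
  proof (intro equalityI subsetI)
    fix p :: "('a, 'k) polynomial" assume p: "p \<in> face_ideal V (Pow F)"
    have pV: "p \<in> polys V" using p by (simp add: face_ideal_def)
    have P: "polys.ideal_in V (face_ideal V (Pow F) :: ('a, 'k) polynomial set)"
      by (intro ideal_in_face_ideal down_closed_Pow)
    have "u \<in> polys V" using u JD(1) by blast
    then have "u * p \<in> face_ideal V (Pow F)" using polys.ideal_inD(4)[OF P _ p] by blast
    moreover have "p * u \<in> ?J" using JD(4)[OF pV u] .
    ultimately have "u * p \<in> ?J'" by (auto simp: face_ideal_def mult.commute)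
    then show "p \<in> {p \<in> polys V. u * p \<in> ?J'}" using pV by simp
  next
    fix p assume p: "p \<in> {p \<in> polys V. u * p \<in> ?J'}"
    have "\<not> keys m \<subseteq> F" if "m \<in> keys p" for m
    proof -
      have "squarefree_exponent R + m \<in> keys (u * p)"
        using that unfolding u_def keys_single_mult by (rule imageI)
      then have "\<not> keys (squarefree_exponent R + m) \<subseteq> F" using p by (auto simp: face_ideal_def)
      then show ?thesis using assms(2,3) by (simp add: keys_exponent_add keys_squarefree_exponent)
    qed
    then show "p \<in> face_ideal V (Pow F)" using p by (simp add: face_ideal_def)
  qed
qed

text \<open>Attaching one facet \<open>F\<close> along \<open>[R, F]\<close> contributes a copy of the polynomial ring in the variables
  of \<open>F\<close>, generated by the monomial of \<open>R\<close>. The elementary symmetric polynomials form one sequence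
  that is regular on all these copies, whatever the facets, and hence on the successive extensions.
  A sequence of linear forms with this property need not exist over a finite field.\<close>

lemma attach_weakly_regular:
  assumes "finite V" "attach i \<Gamma> \<Gamma>'" "down_closed \<Gamma>" "\<Gamma>' \<subseteq> Pow V"
  shows "weakly_regular (map (esym V) [1..<Suc i])
    (face_ideal V \<Gamma> :: ('a, 'k::field) polynomial set) (face_ideal V \<Gamma>')"
  using assms(2,4)
proof (induction rule: attach.induct)
  case start
  show ?case by (rule weakly_regular_trivial) (auto simp: face_ideal_def polys.zero_closed)
next
  case (add \<Gamma>' F R)
  let ?es = "map (esym V) [1..<Suc i] :: ('a, 'k) polynomial list"
  let ?I = "face_ideal V :: 'a set set \<Rightarrow> ('a, 'k) polynomial set"
  have sub: "\<Gamma>' \<subseteq> Pow V" "F \<subseteq> V" using add.prems by auto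
  have dc: "down_closed \<Gamma>'" using add.hyps(1) assms(3) by (rule attach_down_closed)
  have dc': "down_closed (\<Gamma>' \<union> Pow F)" using dc by (auto simp: down_closed_def)
  have es: "set ?es \<subseteq> polys V" using esym_in_polys[OF assms(1)] by auto
  have "finite R" using add.hyps(2,4) finite_subset by blast
  note face = face_ideal_attached_face[OF dc this add.hyps(4) sub(2) add.hyps(5), where 'k = 'k]
  have "weakly_regular ?es (polys V) (?I (Pow F))"
    using esym_weakly_regular_simplex[OF assms(1) sub(2), where 'k = 'k] add.hyps(3) by simp
  then have "weakly_regular ?es (?I \<Gamma>') (?I (\<Gamma>' \<union> Pow F))"
  proof (rule polys.weakly_regular_transfer)
    show "?I (\<Gamma>' \<union> Pow F) \<subseteq> ?I \<Gamma>'" by (rule face_ideal_antimono) simp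
    show "single (squarefree_exponent R) 1 \<in> polys V"
      using \<open>finite R\<close> add.hyps(4) sub(2)
      by (intro single_in_polys) (auto simp: keys_squarefree_exponent)
    show "?I (Pow F) = {p \<in> polys V. single (squarefree_exponent R) 1 * p \<in> ?I (\<Gamma>' \<union> Pow F)}"
      by (rule face(2))
  qed (rule ideal_in_face_ideal polys.ideal_in_whole dc dc' down_closed_Pow es face(1))+
  with add.IH[OF sub(1)] show ?case
    by (rule polys.weakly_regular_extension)
      (rule ideal_in_face_ideal assms(3) dc dc' face_ideal_antimono attach_subset[OF add.hyps(1)]
        Un_upper1 es)+
qed

section \<open>The Krull dimension of a polynomial ring\<close>

text \<open>Eliminate one unknown with one equation.\<close>

lemma underdetermined_system_solution:
  fixes a :: "'i \<Rightarrow> 'b \<Rightarrow> 'k::field"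
  assumes "finite B" "finite I" "card B < card I"
  shows "\<exists>c. (\<exists>i\<in>I. c i \<noteq> 0) \<and> (\<forall>b\<in>B. (\<Sum>i\<in>I. c i * a i b) = 0)"
  using assms
proof (induction B arbitrary: I a rule: finite_induct)
  case empty
  then have "I \<noteq> {}" by auto
  then show ?case by (intro exI[of _ "\<lambda>_. 1"]) auto
next
  case (insert b B)
  show ?case
  proof (cases "\<forall>i\<in>I. a i b = 0")
    case True
    moreover have "card B < card I" using insert by simp
    ultimately show ?thesis using insert.IH[OF insert.prems(1), of a] by auto
  next
    case False
    then obtain j where j: "j \<in> I" "a j b \<noteq> 0" by blast
    let ?I = "I - {j}" and ?a = "\<lambda>i b'. a i b' - a i b / a j b * a j b'"
    have "card B < card ?I" using insert j by simp
    then obtain c i where c: "i \<in> ?I" "c i \<noteq> 0" "\<And>b'. b' \<in> B \<Longrightarrow> (\<Sum>i\<in>?I. c i * ?a i b') = 0"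
      using insert.IH[of ?I ?a] insert.prems(1) by auto
    let ?s = "- (\<Sum>i\<in>?I. c i * a i b) / a j b"
    have sum: "(\<Sum>i\<in>I. (c(j := ?s)) i * a i b') = ?s * a j b' + (\<Sum>i\<in>?I. c i * a i b')" for b'
      using insert.prems(1) j(1) by (subst sum.remove[of _ j]) (auto intro!: sum.cong)
    have "(\<Sum>i\<in>I. (c(j := ?s)) i * a i b') = 0" if "b' \<in> insert b B" for b'
    proof (cases "b' = b")
      case True
      then show ?thesis unfolding sum using j(2) by simp
    next
      case False
      have "?s * a j b' + (\<Sum>i\<in>?I. c i * a i b') = (\<Sum>i\<in>?I. c i * ?a i b')"
        by (simp add: right_diff_distrib sum_subtractf sum_distrib_right sum_divide_distrib mult.assoc)
      then show ?thesis unfolding sum using c(3) that False by simp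
    qed
    then show ?thesis using c(1,2) by (intro exI[of _ "c(j := ?s)"]) auto
  qed
qed

fun eval_monomial :: "'r::comm_ring_1 list \<Rightarrow> nat list \<Rightarrow> 'r" where
  "eval_monomial (y # ys) (a # as) = y ^ a * eval_monomial ys as"
| "eval_monomial _ _ = 1"

context subring_set
begin

lemma power_closed: "p \<in> A \<Longrightarrow> p ^ n \<in> A"
  by (induction n) (auto intro: one_closed mult_closed)

lemma eval_monomial_closed: "set ys \<subseteq> A \<Longrightarrow> eval_monomial ys as \<in> A"
  by (induction ys as rule: eval_monomial.induct)
    (auto intro!: mult_closed one_closed power_closed)

lemma prime_in_power: "prime_in P \<Longrightarrow> p \<in> A \<Longrightarrow> p \<notin> P \<Longrightarrow> p ^ n \<notin> P"
  by (induction n) (auto simp: prime_in_def power_closed)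

lemma prime_in_prod:
  assumes "prime_in P" "finite I" "\<And>i. i \<in> I \<Longrightarrow> f i \<in> A - P"
  shows "prod f I \<notin> P"
  using assms(2,3)
proof (induction I rule: finite_induct)
  case empty
  then show ?case using assms(1) by (simp add: prime_in_def)
next
  case (insert i I)
  moreover have "prod f I \<in> A" using insert.prems by (intro prod_closed) auto
  ultimately show ?case using assms(1) unfolding prime_in_def by auto
qed

end

text \<open>Elements that witness the strictness of a chain of primes are algebraically independent modulo
  its first member: in a relation the lowest power of the first of them can be cancelled, and the rest
  is a relation modulo the second prime.\<close>

lemma prime_chain_independent:
  fixes P :: "nat \<Rightarrow> ('a, 'k::field) polynomial set"
  assumes "\<And>i. i \<le> length ys \<Longrightarrow> polys.prime_in V (P i)" "\<And>i. i < length ys \<Longrightarrow> P i \<subseteq> P (Suc i)"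
    and "\<And>i. i < length ys \<Longrightarrow> ys ! i \<in> P (Suc i) - P i"
    and "(\<Sum>as | set as \<subseteq> {..<N} \<and> length as = length ys. single 0 (c as) * eval_monomial ys as) \<in> P 0"
    and "set as \<subseteq> {..<N}" "length as = length ys"
  shows "c as = 0"
  using assms
proof (induction ys arbitrary: P c as)
  case Nil
  have P: "polys.ideal_in V (P 0)" "1 \<notin> P 0"
    using Nil.prems(1)[of 0] by (simp_all add: polys.prime_in_def)
  have "{as. set as \<subseteq> {..<N} \<and> length as = length ([]::('a, 'k) polynomial list)} = {[]}" by auto
  then have "single 0 (c []) \<in> P 0" using Nil.prems(4) by simp
  then have "single 0 (inverse (c [])) * single 0 (c []) \<in> P 0"
    by (intro polys.ideal_inD(4)[OF P(1)] single_in_polys) auto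
  then have "c [] = 0" using P(2) by (cases "c [] = 0") (auto simp: mult_single)
  then show ?case using Nil.prems by simp
next
  case (Cons y ys)
  let ?L = "{as. set as \<subseteq> {..<N} \<and> length as = length ys}"
  define g where "g a = (\<Sum>as\<in>?L. single 0 (c (a # as)) * eval_monomial ys as)" for a
  have P0: "polys.prime_in V (P 0)" and P1: "polys.prime_in V (P 1)" "P 0 \<subseteq> P 1" and y: "y \<in> P 1" "y \<notin> P 0"
    using Cons.prems(1)[of 0] Cons.prems(1)[of 1] Cons.prems(2)[of 0] Cons.prems(3)[of 0] by auto
  have id0: "polys.ideal_in V (P 0)" and id1: "polys.ideal_in V (P 1)"
    using P0 P1 by (simp_all add: polys.prime_in_def)
  have yV: "y \<in> polys V" using polys.ideal_inD(1)[OF id1] y(1) .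
  have ysV: "set ys \<subseteq> polys V"
  proof
    fix z assume "z \<in> set ys"
    then obtain i where i: "i < length ys" "z = ys ! i" by (auto simp: in_set_conv_nth)
    then have "z \<in> P (Suc (Suc i))" using Cons.prems(3)[of "Suc i"] by simp
    moreover have "polys.prime_in V (P (Suc (Suc i)))" using Cons.prems(1)[of "Suc (Suc i)"] i by simp
    ultimately show "z \<in> polys V" by (auto simp: polys.prime_in_def polys.ideal_in_def)
  qed
  have gV: "g a \<in> polys V" for a
    unfolding g_def by (intro polys.sum_closed polys.mult_closed single_in_polys polys.eval_monomial_closed ysV) simp
  have "finite ?L" by (intro finite_lists_length_eq) simp
  have L: "{as. set as \<subseteq> {..<N} \<and> length as = length (y # ys)} = (\<lambda>(a, as). a # as) ` ({..<N} \<times> ?L)"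
    by (auto simp: image_iff length_Suc_conv)
  have "(\<Sum>as | set as \<subseteq> {..<N} \<and> length as = length (y # ys). single 0 (c as) * eval_monomial (y # ys) as)
      = (\<Sum>(a, as)\<in>{..<N} \<times> ?L. single 0 (c (a # as)) * eval_monomial (y # ys) (a # as))"
    unfolding L by (subst sum.reindex) (auto simp: inj_on_def case_prod_beta)
  also have "\<dots> = (\<Sum>a<N. \<Sum>as\<in>?L. single 0 (c (a # as)) * eval_monomial (y # ys) (a # as))"
    by (rule sum.cartesian_product[symmetric])
  also have "\<dots> = (\<Sum>a<N. y ^ a * g a)"
    unfolding g_def sum_distrib_left
    by (rule sum.cong[OF refl], rule sum.cong[OF refl]) (simp add: mult.left_commute)
  finally have rel: "(\<Sum>a<N. y ^ a * g a) \<in> P 0" using Cons.prems(4) by simp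
  have all0: "c (a # as) = 0" if "a < N" "as \<in> ?L" for a as
  proof (rule ccontr)
    assume "c (a # as) \<noteq> 0"
    let ?bad = "\<lambda>a. a < N \<and> (\<exists>as\<in>?L. c (a # as) \<noteq> 0)"
    define b where "b = (LEAST a. ?bad a)"
    have "?bad a" using \<open>c (a # as) \<noteq> 0\<close> that by blast
    then have b: "?bad b" unfolding b_def by (rule LeastI)
    have least: "\<not> ?bad a" if "a < b" for a using that unfolding b_def by (rule not_less_Least)
    let ?h = "\<Sum>a\<in>{b<..<N}. y ^ (a - Suc b) * g a"
    have hV: "?h \<in> polys V" by (intro polys.sum_closed polys.mult_closed polys.power_closed yV gV)
    have zero: "g a = 0" if "a < b" for a
      unfolding g_def
    proof (rule sum.neutral, rule ballI)
      fix as assume "as \<in> ?L"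
      moreover have "a < N" using that b by simp
      ultimately have "c (a # as) = 0" using least[OF that] by blast
      then show "single 0 (c (a # as)) * eval_monomial ys as = 0" by simp
    qed
    have "(\<Sum>a<N. y ^ a * g a) = (\<Sum>a\<in>{..<b} \<union> insert b {b<..<N}. y ^ a * g a)"
      by (rule sum.cong) (use b in auto)
    also have "\<dots> = (\<Sum>a<b. y ^ a * g a) + (\<Sum>a\<in>insert b {b<..<N}. y ^ a * g a)"
      by (rule sum.union_disjoint) auto
    also have "(\<Sum>a<b. y ^ a * g a) = 0" by (rule sum.neutral) (simp add: zero)
    also have "(\<Sum>a\<in>insert b {b<..<N}. y ^ a * g a) = y ^ b * g b + (\<Sum>a\<in>{b<..<N}. y ^ a * g a)"
      by (rule sum.insert) auto
    also have "(\<Sum>a\<in>{b<..<N}. y ^ a * g a) = y ^ b * (y * ?h)"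
      unfolding sum_distrib_left[of _ _ "{b<..<N}"]
    proof (rule sum.cong[OF refl])
      fix a assume "a \<in> {b<..<N}"
      then have "a = b + Suc (a - Suc b)" by simp
      then have "y ^ a = y ^ b * (y * y ^ (a - Suc b))" by (metis power_add power_Suc)
      then show "y ^ a * g a = y ^ b * (y * (y ^ (a - Suc b) * g a))" by (simp only: mult.assoc)
    qed
    finally have "(\<Sum>a<N. y ^ a * g a) = y ^ b * (g b + y * ?h)" by (simp only: add_0 distrib_left)
    then have "y ^ b * (g b + y * ?h) \<in> P 0" using rel by (simp only:)
    moreover have "g b + y * ?h \<in> polys V"
      by (intro polys.add_closed polys.mult_closed yV gV hV)
    moreover have "y ^ b \<in> polys V" "y ^ b \<notin> P 0"
      using polys.power_closed[OF yV] polys.prime_in_power[OF P0 yV y(2)] by blast+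
    ultimately have "g b + y * ?h \<in> P 1" using P0 P1(2) unfolding polys.prime_in_def by blast
    moreover have "?h * y \<in> P 1" by (rule polys.ideal_inD(4)[OF id1 hV y(1)])
    ultimately have "(g b + y * ?h) - ?h * y \<in> P 1" by (rule polys.ideal_inD(6)[OF id1])
    then have gb: "g b \<in> P 1" by (simp only: mult.commute[of y] add_diff_cancel_right')
    have "c (b # as) = 0" if as: "as \<in> ?L" for as
    proof (rule Cons.IH[of "\<lambda>i. P (Suc i)" "\<lambda>as. c (b # as)"])
      show "polys.prime_in V (P (Suc i))" if "i \<le> length ys" for i using Cons.prems(1)[of "Suc i"] that by simp
      show "P (Suc i) \<subseteq> P (Suc (Suc i))" if "i < length ys" for i using Cons.prems(2)[of "Suc i"] that by simp
      show "ys ! i \<in> P (Suc (Suc i)) - P (Suc i)" if "i < length ys" for i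
        using Cons.prems(3)[of "Suc i"] that by simp
      show "(\<Sum>as\<in>?L. single 0 (c (b # as)) * eval_monomial ys as) \<in> P (Suc 0)"
        using gb by (simp add: g_def)
    qed (use as in auto)
    then show False using b by blast
  qed
  obtain a bs where "as = a # bs" using Cons.prems(6) by (cases as) auto
  then show ?case using all0[of a bs] Cons.prems(5,6) by simp
qed

definition box :: "'a set \<Rightarrow> nat \<Rightarrow> ('a \<Rightarrow>\<^sub>0 nat) set" where
  "box F e = {m. keys m \<subseteq> F \<and> (\<forall>v. lookup m v \<le> e)}"

lemma box_add: "m \<in> box F e \<Longrightarrow> n \<in> box F f \<Longrightarrow> m + n \<in> box F (e + f)"
  by (simp add: box_def keys_exponent_add lookup_add add_mono)

lemma box_mono: "e \<le> f \<Longrightarrow> box F e \<subseteq> box F f"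
  using le_trans unfolding box_def by blast

lemma card_box:
  assumes "finite F"
  shows "finite (box F e)" "card (box F e) \<le> Suc e ^ card F"
proof -
  let ?r = "\<lambda>m. restrict (lookup m) F"
  have inj: "inj_on ?r (box F e)"
  proof (rule inj_onI, rule poly_mapping_eqI)
    fix m n v assume m: "m \<in> box F e" and n: "n \<in> box F e" and eq: "?r m = ?r n"
    show "lookup m v = lookup n v"
    proof (cases "v \<in> F")
      case True
      then show ?thesis using fun_cong[OF eq, of v] by simp
    next
      case False
      then have "v \<notin> keys m" "v \<notin> keys n" using m n by (auto simp: box_def)
      then show ?thesis by (simp add: in_keys_iff)
    qed
  qed
  have sub: "?r ` box F e \<subseteq> F \<rightarrow>\<^sub>E {..e}" by (auto simp: box_def)
  have fin: "finite (F \<rightarrow>\<^sub>E {..e})" using assms by (intro finite_PiE) auto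
  show "finite (box F e)" using inj sub fin by (rule inj_on_finite)
  have "card (box F e) \<le> card (F \<rightarrow>\<^sub>E {..e})" using inj sub fin by (rule card_inj_on_le)
  then show "card (box F e) \<le> Suc e ^ card F" using assms by (simp add: card_PiE)
qed

lemma keys_mult_box:
  assumes "keys p \<subseteq> box F e" "keys q \<subseteq> box F f"
  shows "keys (p * q) \<subseteq> box F (e + f)"
proof
  fix m assume "m \<in> keys (p * q)"
  then obtain a b where "a \<in> keys p" "b \<in> keys q" "m = a + b" by (rule keys_multE)
  then show "m \<in> box F (e + f)" using assms box_add by blast
qed

lemma keys_power_box:
  fixes p :: "('a, 'k::field) polynomial"
  assumes "keys p \<subseteq> box F e"
  shows "keys (p ^ n) \<subseteq> box F (n * e)"
proof (induction n)
  case 0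
  show ?case by (simp add: box_def)
next
  case (Suc n)
  then show ?case using keys_mult_box[OF assms Suc.IH] by simp
qed

lemma keys_eval_monomial_box:
  fixes ys :: "('a, 'k::field) polynomial list"
  assumes "\<And>y. y \<in> set ys \<Longrightarrow> keys y \<subseteq> box F e" "set as \<subseteq> {..<N}"
  shows "keys (eval_monomial ys as) \<subseteq> box F (length ys * (N * e))"
  using assms
proof (induction ys as rule: eval_monomial.induct)
  case (1 y ys a as)
  have "keys y \<subseteq> box F e" by (rule "1.prems"(1)) simp
  then have "keys (y ^ a) \<subseteq> box F (a * e)" by (rule keys_power_box)
  moreover have "a \<le> N" using "1.prems"(2) by simp
  then have "box F (a * e) \<subseteq> box F (N * e)" by (intro box_mono mult_le_mono1)
  ultimately have "keys (y ^ a) \<subseteq> box F (N * e)" by blast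
  moreover have "keys (eval_monomial ys as) \<subseteq> box F (length ys * (N * e))"
    by (rule "1.IH") (use "1.prems"(2) in \<open>auto intro!: "1.prems"(1)\<close>)
  ultimately have "keys (y ^ a * eval_monomial ys as) \<subseteq> box F (N * e + length ys * (N * e))"
    by (rule keys_mult_box)
  then show ?case by simp
qed (auto simp: box_def)

text \<open>If the chain were longer than the number \<open>d\<close> of variables, then the monomials of exponents
  below \<open>N\<close> in \<open>d + 1\<close> witnesses would be linearly independent; but there are \<open>N\<^sup>d\<^sup>+\<^sup>1\<close> of them, in a
  space of dimension \<open>O(N\<^sup>d)\<close>.\<close>

lemma prime_chain_length_le:
  fixes P :: "nat \<Rightarrow> ('a, 'k::field) polynomial set"
  assumes "finite F" "F \<subseteq> V"
    and P: "\<And>i. i \<le> n \<Longrightarrow> polys.prime_in V (P i)" "\<And>i. i < n \<Longrightarrow> P i \<subset> P (Suc i)"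
    and PF: "face_ideal V (Pow F) \<subseteq> P 0"
  shows "n \<le> card F"
proof (rule ccontr)
  let ?d = "card F"
  assume "\<not> n \<le> ?d"
  then have d: "Suc ?d \<le> n" by simp
  have P0: "P 0 \<subseteq> P i" if "i \<le> n" for i
    using that
  proof (induction i)
    case (Suc i)
    then show ?case using P(2)[of i] by simp
  qed simp
  have "\<exists>y. y \<in> P (Suc i) - P i \<and> (\<forall>m\<in>keys y. keys m \<subseteq> F)" if i: "i < n" for i
  proof -
    obtain z where z: "z \<in> P (Suc i)" "z \<notin> P i" using P(2)[OF i] by blast
    let ?y = "part (\<lambda>m. keys m \<subseteq> F) z" and ?r = "part (\<lambda>m. \<not> keys m \<subseteq> F) z"
    have id: "polys.ideal_in V (P i)" "polys.ideal_in V (P (Suc i))"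
      using P(1)[of i] P(1)[of "Suc i"] i by (simp_all add: polys.prime_in_def)
    have "z \<in> polys V" by (rule polys.ideal_inD(1)[OF id(2) z(1)])
    then have "?r \<in> face_ideal V (Pow F)" by (simp add: face_ideal_def part_in_polys keys_part)
    then have r: "?r \<in> P i" "?r \<in> P (Suc i)" using PF P0[of i] P0[of "Suc i"] i by auto
    have split: "?y + ?r = z" by (rule part_split)
    have "?y \<in> P (Suc i)"
      using polys.ideal_inD(6)[OF id(2) z(1) r(2)] split by (metis add_diff_cancel_right')
    moreover have "?y \<notin> P i" using polys.ideal_inD(3)[OF id(1) _ r(1), of ?y] split z(2) by auto
    ultimately show ?thesis by (intro exI[of _ ?y]) (simp add: keys_part)
  qed
  then obtain y where y: "\<And>i. i < n \<Longrightarrow> y i \<in> P (Suc i) - P i"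
    "\<And>i m. i < n \<Longrightarrow> m \<in> keys (y i) \<Longrightarrow> keys m \<subseteq> F" by metis
  define ys where "ys = map y [0..<Suc ?d]"
  have len: "length ys = Suc ?d" by (simp add: ys_def)
  have nth: "ys ! i = y i" if "i < Suc ?d" for i
    using that unfolding ys_def by (subst nth_map) (auto simp del: upt_Suc)
  define e where "e = Max (insert 0 ((\<lambda>(m, v). lookup m v) ` ((\<Union>i\<le>?d. keys (y i)) \<times> F)))"
  have "keys z \<subseteq> box F e" if z: "z \<in> set ys" for z
  proof
    fix m assume m: "m \<in> keys z"
    obtain i where "i < Suc ?d" "z = ys ! i" using z len by (auto simp: in_set_conv_nth)
    then have i: "i \<le> ?d" "z = y i" using nth by simp_all
    have mF: "keys m \<subseteq> F" using y(2)[of i m] i m d by simp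
    have "lookup m v \<le> e" for v
    proof (cases "v \<in> F")
      case True
      then have "(m, v) \<in> (\<Union>i\<le>?d. keys (y i)) \<times> F" using i m by auto
      then show ?thesis unfolding e_def using assms(1) by (intro Max_ge) (auto simp: image_iff)
    next
      case False
      then have "v \<notin> keys m" using mF by blast
      then show ?thesis by (simp add: in_keys_iff)
    qed
    then show "m \<in> box F e" using mF by (simp add: box_def)
  qed
  note eval_box = keys_eval_monomial_box[of ys, OF this]
  \<comment> \<open>Evaluated monomials have exponents below \<open>N C\<close>, and \<open>N\<close> is chosen so that \<open>(N C)\<^sup>d < N\<^sup>d\<^sup>+\<^sup>1\<close>.\<close>
  define C where "C = Suc (Suc ?d * e)"
  define N where "N = Suc (C ^ ?d)"
  let ?L = "{as. set as \<subseteq> {..<N} \<and> length as = length ys}" and ?B = "box F (Suc ?d * (N * e))"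
  have "card ?B \<le> Suc (Suc ?d * (N * e)) ^ ?d" by (rule card_box(2)[OF assms(1)])
  also have "Suc (Suc ?d * (N * e)) \<le> N * C"
    unfolding C_def by (simp add: N_def algebra_simps)
  then have "Suc (Suc ?d * (N * e)) ^ ?d \<le> (N * C) ^ ?d" by (rule power_mono) simp
  also have "\<dots> = N ^ ?d * C ^ ?d" by (rule power_mult_distrib)
  also have "\<dots> < N ^ ?d * N" by (simp add: N_def)
  also have "\<dots> = card ?L" by (simp add: card_lists_length_eq len)
  finally have "card ?B < card ?L" .
  moreover have "finite ?L" by (intro finite_lists_length_eq) simp
  ultimately have "\<exists>c. (\<exists>as\<in>?L. c as \<noteq> 0) \<and>
      (\<forall>m\<in>?B. (\<Sum>as\<in>?L. c as * lookup (eval_monomial ys as) m) = 0)"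
    by (intro underdetermined_system_solution card_box(1) assms(1))
  then obtain c where c0: "\<exists>as\<in>?L. c as \<noteq> 0"
    and c: "\<forall>m\<in>?B. (\<Sum>as\<in>?L. c as * lookup (eval_monomial ys as) m) = 0"
    by (elim exE conjE)
  from c0 obtain as where as: "as \<in> ?L" "c as \<noteq> 0" by (rule bexE)
  have "(\<Sum>as\<in>?L. single 0 (c as) * eval_monomial ys as) = 0"
  proof (rule poly_mapping_eqI)
    fix m
    have "lookup (single 0 (c as) * eval_monomial ys as) m = c as * lookup (eval_monomial ys as) m" for as
      using lookup_single_mult[of 0 "c as" "eval_monomial ys as" m] by simp
    then have eq: "lookup (\<Sum>as\<in>?L. single 0 (c as) * eval_monomial ys as) m
        = (\<Sum>as\<in>?L. c as * lookup (eval_monomial ys as) m)"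
      by (simp add: lookup_sum)
    show "lookup (\<Sum>as\<in>?L. single 0 (c as) * eval_monomial ys as) m = lookup 0 m"
    proof (cases "m \<in> ?B")
      case True
      then show ?thesis using c eq by simp
    next
      case False
      then have "lookup (eval_monomial ys as) m = 0" if "as \<in> ?L" for as
      proof -
        have "keys (eval_monomial ys as) \<subseteq> ?B" using eval_box[of as N] that unfolding len by simp
        then have "m \<notin> keys (eval_monomial ys as)" using False by blast
        then show ?thesis by (simp add: in_keys_iff)
      qed
      then show ?thesis unfolding eq by (simp add: sum.neutral)
    qed
  qed
  moreover have "0 \<in> P 0" using P(1)[of 0] by (simp add: polys.prime_in_def polys.ideal_in_def)
  ultimately have rel: "(\<Sum>as\<in>?L. single 0 (c as) * eval_monomial ys as) \<in> P 0" by simp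
  have "c as = 0"
  proof (rule prime_chain_independent[where ys = ys and V = V and P = P and N = N and c = c])
    show "polys.prime_in V (P i)" if "i \<le> length ys" for i using P(1)[of i] that d len by simp
    show "P i \<subseteq> P (Suc i)" if "i < length ys" for i using P(2)[of i] that d len by auto
    show "ys ! i \<in> P (Suc i) - P i" if "i < length ys" for i
      using y(1)[of i] nth[of i] that d len by simp
    show "(\<Sum>as\<in>?L. single 0 (c as) * eval_monomial ys as) \<in> P 0" by (rule rel)
  qed (use as(1) in simp_all)
  then show False using as(2) by simp
qed

text \<open>Every face that is new in \<open>\<Gamma>'\<close> lies below some \<open>F\<close> of size \<open>i\<close>, hence the product of the
  ideals of all \<open>F\<close> of size \<open>i\<close> annihilates the quotient.\<close>

lemma prime_over_annihilator:
  fixes P :: "('a, 'k::field) polynomial set"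
  assumes "finite V" "polys.prime_in V P" "down_closed \<Gamma>"
    and new: "\<And>\<sigma>. \<sigma> \<in> \<Gamma>' - \<Gamma> \<Longrightarrow> \<exists>F\<subseteq>V. card F = i \<and> \<sigma> \<subseteq> F"
    and ann: "{a\<in>polys V. \<forall>b\<in>face_ideal V \<Gamma>. a * b \<in> face_ideal V \<Gamma>'} \<subseteq> P"
  shows "\<exists>F\<subseteq>V. card F = i \<and> face_ideal V (Pow F) \<subseteq> P"
proof (rule ccontr)
  assume "\<not> ?thesis"
  then have "\<exists>a. a \<in> face_ideal V (Pow F) - P" if "F \<subseteq> V" "card F = i" for F
    using that by blast
  then obtain a where a: "\<And>F. F \<subseteq> V \<Longrightarrow> card F = i \<Longrightarrow> a F \<in> face_ideal V (Pow F) - P" by metis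
  let ?Fs = "{F. F \<subseteq> V \<and> card F = i}"
  have "finite ?Fs" by (rule finite_subset[of _ "Pow V"]) (use assms(1) in auto)
  have aV: "a F \<in> polys V" if "F \<in> ?Fs" for F using a that by (auto simp: face_ideal_def)
  let ?a = "prod a ?Fs"
  have "?a \<notin> P" using a aV by (intro polys.prime_in_prod[OF assms(2) \<open>finite ?Fs\<close>]) auto
  moreover have "?a \<in> polys V" using aV by (rule polys.prod_closed)
  moreover have "?a * b \<in> face_ideal V \<Gamma>'" if b: "b \<in> face_ideal V \<Gamma>" for b
  proof -
    have bV: "b \<in> polys V" using b by (simp add: face_ideal_def)
    have "?a * b \<in> face_ideal V (Pow F)" if F: "F \<in> ?Fs" for F
    proof -
      have I: "polys.ideal_in V (face_ideal V (Pow F) :: ('a, 'k) polynomial set)"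
        by (intro ideal_in_face_ideal down_closed_Pow)
      have "prod a (?Fs - {F}) * b \<in> polys V"
        using aV bV by (intro polys.mult_closed polys.prod_closed) auto
      then have "(prod a (?Fs - {F}) * b) * a F \<in> face_ideal V (Pow F)"
        using a F by (intro polys.ideal_inD(4)[OF I]) auto
      moreover have "?a = a F * prod a (?Fs - {F})"
        using \<open>finite ?Fs\<close> F by (rule prod.remove)
      ultimately show ?thesis by (simp add: mult.assoc mult.commute mult.left_commute)
    qed
    moreover have "?a * b \<in> face_ideal V \<Gamma>"
      by (rule polys.ideal_inD(4)[OF ideal_in_face_ideal[OF assms(3)] \<open>?a \<in> polys V\<close> b])
    ultimately show ?thesis using new unfolding face_ideal_def by blast
  qed
  ultimately show False using ann by blast
qed

section \<open>Sequential Cohen-Macaulayness\<close>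

lemma poly_ring_eq: "poly_ring V = polys.base_ring V"
  unfolding poly_ring_def polys.base_ring_def by (simp add: polys_def)

lemma homogeneous_polys_eq: "homogeneous_polys V d = {p \<in> polys V. homogeneous d p}"
  by (simp add: homogeneous_polys_def poly_ring_eq homogeneous_def)

text \<open>A monomial is divisible by the squarefree monomial of its support.\<close>

lemma stanley_reisner_ideal_eq:
  fixes \<Delta> :: "'a set set"
  assumes \<Delta>: "simplicial_complex \<Delta>"
  shows "stanley_reisner_ideal \<Delta> = (face_ideal (\<Union>\<Delta>) \<Delta> :: ('a, 'k::field) polynomial set)"
proof -
  let ?V = "\<Union>\<Delta>"
  let ?S = "{\<Prod>v\<in>\<sigma>. variable v | \<sigma>. finite \<sigma> \<and> \<sigma> \<subseteq> ?V \<and> \<sigma> \<notin> \<Delta>} :: ('a, 'k) polynomial set"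
  let ?R = "polys.base_ring ?V :: ('a, 'k) polynomial ring"
  interpret R: cring ?R by (rule polys.cring_base_ring)
  have "down_closed \<Delta>" using \<Delta> by (simp add: simplicial_complex_def down_closed_def)
  then have id: "polys.ideal_in ?V (face_ideal ?V \<Delta> :: ('a, 'k) polynomial set)"
    by (rule ideal_in_face_ideal)
  have S: "?S \<subseteq> face_ideal ?V \<Delta>"
  proof
    fix p assume "p \<in> ?S"
    then obtain \<sigma> where \<sigma>: "p = single (squarefree_exponent \<sigma>) 1" "finite \<sigma>" "\<sigma> \<subseteq> ?V" "\<sigma> \<notin> \<Delta>"
      using prod_variable by blast
    then show "p \<in> face_ideal ?V \<Delta>"
      by (simp add: face_ideal_def single_in_polys keys_squarefree_exponent)
  qed
  then have "?S \<subseteq> carrier ?R" by (auto simp: face_ideal_def)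
  then have gen: "ideal (genideal ?R ?S) ?R" "?S \<subseteq> genideal ?R ?S"
    by (rule R.genideal_ideal, rule R.genideal_self)
  have genid: "polys.ideal_in ?V (genideal ?R ?S)"
    using gen(1) by (simp add: polys.ideal_base_ring_iff)
  have "genideal ?R ?S = face_ideal ?V \<Delta>"
  proof
    show "genideal ?R ?S \<subseteq> face_ideal ?V \<Delta>"
      by (rule R.genideal_minimal) (use id S in \<open>simp_all add: polys.ideal_base_ring_iff\<close>)
    show "face_ideal ?V \<Delta> \<subseteq> genideal ?R ?S"
    proof
      fix p :: "('a, 'k) polynomial" assume p: "p \<in> face_ideal ?V \<Delta>"
      have "single m (lookup p m) \<in> genideal ?R ?S" if m: "m \<in> keys p" for m
      proof -
        have mV: "keys m \<subseteq> ?V" "keys m \<notin> \<Delta>" using p m by (auto simp: face_ideal_def polys_def)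
        have "single m (lookup p m) \<in> polys ?V" using mV(1) by (rule single_in_polys)
        moreover have "keys m \<subseteq> keys n" if "n \<in> keys (single m (lookup p m))" for n
          using that by (auto split: if_splits)
        ultimately obtain q where q: "q \<in> polys ?V"
          "single m (lookup p m) = single (squarefree_exponent (keys m)) 1 * q"
          using squarefree_divides[OF finite_keys] by metis
        have "(\<Prod>v\<in>keys m. variable v) \<in> ?S" using mV finite_keys[of m] by blast
        then have "single (squarefree_exponent (keys m)) 1 \<in> ?S"
          unfolding prod_variable[OF finite_keys] .
        then have "single (squarefree_exponent (keys m)) 1 \<in> genideal ?R ?S"
          by (rule subsetD[OF gen(2)])
        then show ?thesis
          unfolding q(2) mult.commute[of _ q] by (rule polys.ideal_inD(4)[OF genid q(1)])
      qed
      then have "(\<Sum>m\<in>keys p. single m (lookup p m)) \<in> genideal ?R ?S"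
        by (rule polys.ideal_in_sum[OF genid])
      then show "p \<in> genideal ?R ?S" by (simp add: sum_monomials)
    qed
  qed
  then show ?thesis unfolding stanley_reisner_ideal_def poly_ring_eq .
qed

definition residue_class :: "'a set set \<Rightarrow> ('a, 'k::field) polynomial \<Rightarrow> ('a, 'k) polynomial set" where
  "residue_class \<Delta> p = face_ideal (\<Union>\<Delta>) \<Delta> +>\<^bsub>poly_ring (\<Union>\<Delta>)\<^esub> p"

lemma stanley_reisner_presents:
  fixes \<Delta> :: "'a set set"
  assumes \<Delta>: "simplicial_complex \<Delta>"
  shows "polys.presents (\<Union>\<Delta>) (residue_class \<Delta>) (polys (\<Union>\<Delta>)) (face_ideal (\<Union>\<Delta>) \<Delta>)
    (stanley_reisner_module \<Delta> :: (('a, 'k::field) polynomial, _) module)"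
proof -
  let ?V = "\<Union>\<Delta>"
  let ?A = "polys ?V :: ('a, 'k) polynomial set"
  let ?M = "regular_module (poly_ring ?V) :: (('a, 'k) polynomial, _) module"
  have "down_closed \<Delta>" using \<Delta> by (simp add: simplicial_complex_def down_closed_def)
  then have id: "polys.ideal_in ?V (face_ideal ?V \<Delta> :: ('a, 'k) polynomial set)"
    by (rule ideal_in_face_ideal)
  have sub: "face_ideal ?V \<Delta> \<subseteq> ?A" by (auto simp: face_ideal_def)
  have "polys.ideal_in ?V ({0} :: ('a, 'k) polynomial set)"
    by (simp add: polys.ideal_in_def polys.zero_closed)
  then have "polys.presents ?V (\<lambda>p. p) ?A {0} ?M"
    by (simp add: polys.presents_def polys.ideal_in_whole polys.zero_closed regular_module_def poly_ring_eq)
  from polys.presents_quot_module[OF this id polys.ideal_in_whole _ sub order_refl]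
  have "polys.presents ?V (\<lambda>p. (\<lambda>p. p) ` face_ideal ?V \<Delta> +>\<^bsub>?M\<^esub> p) ?A (face_ideal ?V \<Delta>)
      (quot_module (?M\<lparr>carrier := (\<lambda>p. p) ` ?A\<rparr>) ((\<lambda>p. p) ` face_ideal ?V \<Delta>))"
    using polys.ideal_inD(2)[OF id] by simp
  moreover have "?M\<lparr>carrier := ?A\<rparr> = ?M" by (simp add: regular_module_def poly_ring_eq)
  moreover have "(\<lambda>p. face_ideal ?V \<Delta> +>\<^bsub>?M\<^esub> p) = residue_class \<Delta>"
    by (rule ext) (simp add: residue_class_def a_r_coset_def' regular_module_def)
  ultimately show ?thesis
    by (simp add: stanley_reisner_module_def stanley_reisner_ideal_eq[OF \<Delta>])
qed

text \<open>A filtration may repeat members; the distinct ones form a filtration with strict inclusions.\<close>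

lemma strict_subfiltration:
  fixes N :: "nat \<Rightarrow> 'b set" and dim :: "'b set \<Rightarrow> 'b set \<Rightarrow> enat"
  assumes "\<And>i. i < n \<Longrightarrow> N i \<subseteq> N (Suc i)"
    and "\<And>i. i < n \<Longrightarrow> N i \<noteq> N (Suc i) \<Longrightarrow> CM (N i) (N (Suc i)) \<and> dim (N i) (N (Suc i)) = enat i"
  shows "\<exists>r N'. N' 0 = N 0 \<and> N' r = N n \<and> (\<forall>j\<le>r. N' j \<in> range N) \<and>
    (\<forall>j<r. N' j \<subset> N' (Suc j) \<and> CM (N' j) (N' (Suc j)) \<and> dim (N' j) (N' (Suc j)) < enat n) \<and>
    (\<forall>j. Suc j < r \<longrightarrow> dim (N' j) (N' (Suc j)) < dim (N' (Suc j)) (N' (Suc (Suc j))))"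
  using assms
proof (induction n)
  case 0
  show ?case by (intro exI[of _ 0] exI[of _ N]) auto
next
  case (Suc n)
  then obtain r N' where N': "N' 0 = N 0" "N' r = N n" "\<forall>j\<le>r. N' j \<in> range N"
    "\<And>j. j < r \<Longrightarrow> N' j \<subset> N' (Suc j) \<and> CM (N' j) (N' (Suc j)) \<and> dim (N' j) (N' (Suc j)) < enat n"
    "\<And>j. Suc j < r \<Longrightarrow> dim (N' j) (N' (Suc j)) < dim (N' (Suc j)) (N' (Suc (Suc j)))"
    by (metis less_SucI)
  have less: "x < enat (Suc n)" if "x < enat n" for x using that by (rule less_trans) simp
  show ?case
  proof (cases "N n = N (Suc n)")
    case True
    show ?thesis
      by (rule exI[of _ r], rule exI[of _ N']) (use N' True less in auto)
  next
    case False
    let ?N = "N'(Suc r := N (Suc n))"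
    have new: "N n \<subset> N (Suc n)" "CM (N n) (N (Suc n))" "dim (N n) (N (Suc n)) = enat n"
      using Suc.prems False by auto
    show ?thesis
    proof (rule exI[of _ "Suc r"], rule exI[of _ ?N], intro conjI allI impI)
      fix j
      show "?N j \<in> range N" if "j \<le> Suc r" using N'(3) that by auto
      assume j: "j < Suc r"
      show "?N j \<subset> ?N (Suc j)" "CM (?N j) (?N (Suc j))" "dim (?N j) (?N (Suc j)) < enat (Suc n)"
        using N'(2) N'(4)[of j] new j less by (cases "j = r"; simp)+
    next
      fix j assume "Suc j < Suc r"
      then show "dim (?N j) (?N (Suc j)) < dim (?N (Suc j)) (?N (Suc (Suc j)))"
        using N'(2) N'(4)[of j] N'(5)[of j] new by (cases "Suc j = r") auto
    qed (use N' in auto)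
  qed
qed

text \<open>The filtration of the Stanley-Reisner ring by the ideals of the subcomplexes generated by the
  faces of size at least \<open>i\<close>. Its quotients have dimension \<open>i\<close>: the elementary symmetric polynomials
  of degrees \<open>1, \<dots>, i\<close> are a regular sequence, and every prime over the annihilator contains
  the ideal of some set of \<open>i\<close> vertices.\<close>

theorem vertex_decomposable_sequentially_CM:
  fixes \<Delta> :: "'a set set"
  assumes vd: "vertex_decomposable \<Delta>" and \<Delta>: "simplicial_complex \<Delta>"
  shows "sequentially_CM_complex TYPE('k::field) \<Delta>"
proof -
  let ?V = "\<Union>\<Delta>"
  let ?A = "polys ?V :: ('a, 'k) polynomial set"
  let ?I = "face_ideal ?V :: _ \<Rightarrow> ('a, 'k) polynomial set"
  let ?R = "polys.base_ring ?V :: ('a, 'k) polynomial ring"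
  let ?G = "homogeneous_polys ?V :: nat \<Rightarrow> ('a, 'k) polynomial set"
  let ?M = "stanley_reisner_module \<Delta> :: (('a, 'k) polynomial, _) module"
  let ?\<phi> = "residue_class \<Delta> :: ('a, 'k) polynomial \<Rightarrow> _"
  let ?Q = "\<lambda>N' N. quot_module (?M\<lparr>carrier := N\<rparr>) N'"
  let ?J = "\<lambda>i. ?I (faces_below \<Delta> i)"
  define n where "n = Suc (card ?V)"
  note pres = stanley_reisner_presents[OF \<Delta>, where 'k = 'k]
  have finV: "finite ?V" using \<Delta> by (simp add: simplicial_complex_def)
  have dc: "down_closed (faces_below \<Delta> i)" for i by (auto simp: down_closed_def faces_below_def)
  have idJ: "polys.ideal_in ?V (?J i)" for i by (rule ideal_in_face_ideal[OF dc])
  have JA: "?J i \<subseteq> ?A" for i by (auto simp: face_ideal_def)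
  have IJ: "?I \<Delta> \<subseteq> ?J i" for i by (rule face_ideal_antimono[OF faces_below_subset[OF \<Delta>]])
  have step: "?J i \<subseteq> ?J (Suc i)" for i by (rule face_ideal_antimono[OF faces_below_Suc_subset])
  have quot: "cohen_macaulay ?R ?G (?Q (?\<phi> ` ?J i) (?\<phi> ` ?J (Suc i))) \<and>
      module_dim ?R (?Q (?\<phi> ` ?J i) (?\<phi> ` ?J (Suc i))) = enat i"
    if ne: "?\<phi> ` ?J i \<noteq> ?\<phi> ` ?J (Suc i)" for i
  proof -
    let ?es = "map (esym ?V) [1..<Suc i] :: ('a, 'k) polynomial list"
    have len: "length ?es = i" by (simp only: length_map length_upt)
    have es: "\<exists>d>0. t \<in> ?G d" if t: "t \<in> set ?es" for t
    proof -
      have "t \<in> esym ?V ` {1..<Suc i}" using t by (simp only: set_map set_upt)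
      then obtain j where "t = esym ?V j" "j \<in> {1..<Suc i}" by (rule imageE)
      then show ?thesis
        by (intro exI[of _ j])
          (simp add: homogeneous_polys_eq esym_in_polys[OF finV] homogeneous_esym[OF finV])
    qed
    have es': "t \<in> ?A \<and> (\<exists>k>0. homogeneous k t)" if "t \<in> set ?es" for t
      using es[OF that] by (auto simp: homogeneous_polys_eq)
    have attach: "attach i (faces_below \<Delta> (Suc i)) (faces_below \<Delta> i)"
      by (rule vertex_decomposable_attach[OF vd \<Delta>])
    have pres': "polys.presents ?V (\<lambda>p. (?\<phi> ` ?J i) +>\<^bsub>?M\<^esub> ?\<phi> p) (?J (Suc i)) (?J i)
        (?Q (?\<phi> ` ?J i) (?\<phi> ` ?J (Suc i)))"
      by (rule polys.presents_quot_module[OF pres idJ idJ IJ step JA])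
    have reg: "weakly_regular ?es (?J (Suc i)) (?J i)"
      by (rule attach_weakly_regular[OF finV attach dc]) (auto simp: faces_below_def)
    have "?J i \<subset> ?J (Suc i)" using step[of i] ne by auto
    then have proper: "plus_seq ?es (?J (Suc i)) (?J i) \<noteq> ?J (Suc i)"
      by (intro graded_Nakayama[OF idJ graded_face_ideal idJ graded_face_ideal] es')
    have dim: "m \<le> length ?es"
      if chain: "\<forall>j\<le>m. polys.prime_in ?V (P j)" "\<forall>j<m. P j \<subset> P (Suc j)"
        and ann: "{a\<in>?A. \<forall>b\<in>?J (Suc i). a * b \<in> ?J i} \<subseteq> P 0" for m and P :: "nat \<Rightarrow> ('a, 'k) polynomial set"
    proof -
      have P: "\<And>j. j \<le> m \<Longrightarrow> polys.prime_in ?V (P j)" "\<And>j. j < m \<Longrightarrow> P j \<subset> P (Suc j)"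
        using chain by simp_all
      have new: "\<exists>F\<subseteq>?V. card F = i \<and> \<sigma> \<subseteq> F" if \<sigma>: "\<sigma> \<in> faces_below \<Delta> i - faces_below \<Delta> (Suc i)" for \<sigma>
      proof -
        obtain F where F: "F \<in> \<Delta>" "\<sigma> \<subseteq> F" "i \<le> card F" using \<sigma> by (auto simp: faces_below_def)
        moreover have "\<not> Suc i \<le> card F" using F \<sigma> by (auto simp: faces_below_def)
        ultimately show ?thesis by (intro exI[of _ F]) auto
      qed
      obtain F where F: "F \<subseteq> ?V" "card F = i" "?I (Pow F) \<subseteq> P 0"
        using prime_over_annihilator[OF finV P(1)[of 0] dc new ann] by auto
      have "m \<le> card F"
        by (rule prime_chain_length_le[OF finite_subset[OF F(1) finV] F(1) P(1,2) F(3)])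
      then show ?thesis using F(2) len by simp
    qed
    have G: "?G d \<subseteq> ?A" for d by (auto simp: homogeneous_polys_eq)
    note CM = polys.presents_cohen_macaulay[OF pres' G _ reg proper]
    have "cohen_macaulay ?R ?G (?Q (?\<phi> ` ?J i) (?\<phi> ` ?J (Suc i)))"
      by (rule CM(1), erule es) (rule dim)
    moreover have "module_dim ?R (?Q (?\<phi> ` ?J i) (?\<phi> ` ?J (Suc i))) = enat (length ?es)"
      by (rule CM(2), erule es) (rule dim)
    ultimately show ?thesis unfolding len by blast
  qed
  let ?N = "\<lambda>i. ?\<phi> ` ?J i"
  have "\<exists>r N'. N' 0 = ?N 0 \<and> N' r = ?N n \<and> (\<forall>j\<le>r. N' j \<in> range ?N) \<and>
    (\<forall>j<r. N' j \<subset> N' (Suc j) \<and> cohen_macaulay ?R ?G (?Q (N' j) (N' (Suc j))) \<and>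
       module_dim ?R (?Q (N' j) (N' (Suc j))) < enat n) \<and>
    (\<forall>j. Suc j < r \<longrightarrow> module_dim ?R (?Q (N' j) (N' (Suc j))) <
       module_dim ?R (?Q (N' (Suc j)) (N' (Suc (Suc j)))))"
    by (rule strict_subfiltration) (use step quot in \<open>blast+\<close>)
  then obtain r N' where N': "N' 0 = ?N 0" "N' r = ?N n" "\<forall>j\<le>r. N' j \<in> range ?N"
    "\<forall>j<r. N' j \<subset> N' (Suc j) \<and> cohen_macaulay ?R ?G (?Q (N' j) (N' (Suc j))) \<and>
       module_dim ?R (?Q (N' j) (N' (Suc j))) < enat n"
    "\<forall>j. Suc j < r \<longrightarrow> module_dim ?R (?Q (N' j) (N' (Suc j))) <
       module_dim ?R (?Q (N' (Suc j)) (N' (Suc (Suc j))))" by (elim exE conjE)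
  have zero: "?N 0 = {\<zero>\<^bsub>?M\<^esub>}"
  proof -
    have "?\<phi> p = \<zero>\<^bsub>?M\<^esub>" if "p \<in> ?I \<Delta>" for p
      using that polys.presents_zero_iff[OF pres] by (simp add: face_ideal_def)
    moreover have "0 \<in> ?I \<Delta>" by (simp add: face_ideal_def polys.zero_closed)
    ultimately show ?thesis unfolding faces_below_0[OF \<Delta>] by force
  qed
  have whole: "?N n = carrier ?M"
    using polys.presents_carrier[OF pres] faces_below_large[OF \<Delta>, of n]
    by (simp add: n_def face_ideal_def)
  have gr: "graded_submodule ?R ?M (stanley_reisner_component \<Delta>) (?N i)" for i
  proof (rule polys.presents_graded_submodule[OF pres idJ JA])
    fix p assume p: "p \<in> ?J i"
    obtain m where m: "p = (\<Sum>d\<le>m. hpart d p)" by (rule sum_hparts)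
    have "hpart d p \<in> ?J i" for d by (rule part_in_face_ideal[OF p])
    moreover have "?\<phi> (hpart d p) \<in> stanley_reisner_component \<Delta> d" for d
    proof -
      have "hpart d p \<in> ?G d"
        using JA p by (auto simp: homogeneous_polys_eq homogeneous_hpart intro!: part_in_polys)
      then show ?thesis
        unfolding stanley_reisner_component_def stanley_reisner_ideal_eq[OF \<Delta>] residue_class_def[symmetric]
        by (rule imageI)
    qed
    ultimately show "\<exists>m f. (\<forall>d\<le>m. f d \<in> ?J i \<and> ?\<phi> (f d) \<in> stanley_reisner_component \<Delta> d) \<and>
        p = (\<Sum>d\<le>m. f d)"
      using m by (intro exI[of _ m] exI[of _ "\<lambda>d. hpart d p"]) simp
  qed
  show ?thesis
    unfolding sequentially_CM_complex_def sequentially_CM_module_def poly_ring_eq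
  proof (rule exI[of _ r], rule exI[of _ N'], intro conjI)
    show "N' 0 = {\<zero>\<^bsub>?M\<^esub>}" unfolding N'(1) by (rule zero)
    show "N' r = carrier ?M" unfolding N'(2) by (rule whole)
    show "\<forall>j\<le>r. graded_submodule ?R ?M (stanley_reisner_component \<Delta>) (N' j)"
    proof (intro allI impI)
      fix j assume "j \<le> r"
      then have "N' j \<in> range ?N" using N'(3) by simp
      then obtain i where i: "N' j = ?N i" by (rule rangeE)
      show "graded_submodule ?R ?M (stanley_reisner_component \<Delta>) (N' j)"
        unfolding i by (rule gr)
    qed
    show "\<forall>j<r. N' j \<subset> N' (Suc j) \<and> cohen_macaulay ?R ?G (?Q (N' j) (N' (Suc j)))"
      using N'(4) by simp
  qed (rule N'(5))
qed

section \<open>Cameron-Walker graphs\<close>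

lemma simplicial_complex_indep_complex:
  assumes "simple_graph V E"
  shows "simplicial_complex (indep_complex V E)"
proof -
  have "\<Union>(indep_complex V E) \<subseteq> V" "finite V"
    using assms by (auto simp: indep_complex_def simple_graph_def)
  then have "finite (\<Union>(indep_complex V E))" by (rule finite_subset)
  moreover have "Pow \<sigma> \<subseteq> indep_complex V E" if "\<sigma> \<in> indep_complex V E" for \<sigma>
    using that unfolding indep_complex_def by blast
  ultimately show ?thesis by (simp add: simplicial_complex_def)
qed

theorem theorem3p1:
  fixes V :: "'a set" and E :: "'a set set"
  assumes "cameron_walker V E"
  shows "vertex_decomposable_graph V E \<and> shellable_graph V E \<and>
    sequentially_CM_graph TYPE('k::field) V E"
proof -
  have G: "simple_graph V E" and eq: "induced_matching_number E = matching_number E"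
    using assms by (simp_all add: cameron_walker_def)
  obtain M where "maximum_induced_matching V E M"
    by (rule exists_maximum_induced_matching[OF G eq])
  then have vd: "vertex_decomposable (indep_complex V E)"
    by (rule vertex_decomposable_indep_complex[OF G])
  note sc = simplicial_complex_indep_complex[OF G]
  show ?thesis
    unfolding vertex_decomposable_graph_def shellable_graph_def sequentially_CM_graph_def
      clique_complex_complement[OF G]
    using vd vertex_decomposable_shellable[OF vd sc] vertex_decomposable_sequentially_CM[OF vd sc]
    by blast
qed

end
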